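(* Let $\Omega=(0,L_\Omega)^3$ and let $\nu,\mu,\tau>0$. Suppose that, for $j=1,\dots,J$, the data $u^0(x;\omega_j)$, $f(x;\omega_j)$ are smooth, $L_\Omega$-periodic, mean-zero $L^2(\Omega)$ vector fields with $\nabla\cdot u^0=\nabla\cdot f=0$, with $F>0$. Let $u(x,t;\omega_j)$, $j=1,\dots,J$, be a weak solution of the ensemble eddy viscosity model with turbulent viscosity $\nu_{\text{turb}}=\mu\tau|u'|_e^2$ and periodic boundary conditions, satisfying the energy inequality. Then the time and ensemble averaged energy dissipation rate satisfies, for any $0<\alpha<1$, $$\langle\varepsilon\rangle_\infty\le\left(\frac{1}{1-\alpha}+\frac{1}{4\alpha(1-\alpha)}\mathcal{R}e^{-1}+\frac{\mu}{4\alpha(1-\alpha)}\frac{\tau}{T^*}I(u)\right)\frac{U^3}{L}.$$ Thus, for $\alpha=1/2$ and $\mu=0.55$, $$\langle\varepsilon\rangle_\infty\le\left(2+\mathcal{R}e^{-1}+0.55\,\frac{\tau}{T^*}I(u)\right)\frac{U^3}{L}.$$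
   Context: **Domain and averages.** $\Omega=(0,L_\Omega)^3$; $\|\cdot\|$ and $(\cdot,\cdot)$ are the $L^2(\Omega)$ norm and inner product. Periodic boundary conditions mean that $\phi=u,u^0,f,p$ satisfy $\phi(x+L_\Omega e_i,t)=\phi(x,t)$ for $i=1,2,3$ and $\int_\Omega\phi\,dx=0$. For a finite ensemble $\omega_1,\dots,\omega_J$ write $\langle\phi\rangle_e=\frac1J\sum_{j=1}^J\phi(\omega_j)$. Time averages are $\langle\phi\rangle_T=\frac1T\int_0^T\phi(t)\,dt$ and $\langle\phi\rangle_\infty=\limsup_{T\to\infty}\langle\phi\rangle_T$. Fluctuations are $u'(x,t;\omega_j)=u(x,t;\omega_j)-\langle u\rangle_e(x,t)$, with magnitude $|u'|_e^2(x,t)=\frac1J\sum_{j=1}^J|u'(x,t;\omega_j)|^2$. **Model.** For $j=1,\dots,J$, $u=u(x,t;\omega_j)$ and $p=p(x,t;\omega_j)$ satisfy $$u_t+u\cdot\nabla u-\nu\Delta u-\nabla\cdot(\nu_{\text{turb}}\nabla u)+\nabla p=f(x;\omega_j),\quad \nabla\cdot u=0,\quad u(x,0;\omega_j)=u^0(x;\omega_j),$$ where $\nu_{\text{turb}}(x,t)=\mu\tau|u'|_e^2(x,t)$ (turbulence length scale $l=|u'|_e\tau$), which couples the $J$ realizations. The body force $f(x;\omega_j)$ does not depend on time. **Weak solution with energy inequality.** For each $j$, $u(\cdot,\cdot;\omega_j)$ is periodic, mean-zero, divergence free, lies in $L^\infty(0,T;L^2(\Omega))\cap L^2(0,T;H^1(\Omega))$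 for every $T>0$, is weakly continuous in time into $L^2(\Omega)$, and for every $T>0$: (i) for every smooth, $x$-periodic, divergence-free vector field $\phi(x,t)$ on $\mathbb{R}^3\times[0,T]$, $$(u(T),\phi(T))-\int_0^T(u,\phi_t)\,dt-\int_0^T\!\int_\Omega (u\otimes u):\nabla\phi\,dx\,dt+\int_0^T\!\int_\Omega(\nu+\nu_{\text{turb}})\nabla u:\nabla\phi\,dx\,dt=(u^0,\phi(0))+\int_0^T(f,\phi)\,dt;$$ (ii) the energy inequality $$\tfrac12\|u(T)\|^2+\int_0^T\!\int_\Omega\big(\nu+\mu\tau|u'|_e^2\big)|\nabla u|^2\,dx\,dt\le\tfrac12\|u^0\|^2+\int_0^T(f,u)\,dt.$$ **Dissipation rate.** $$\varepsilon(t)=\Big\langle\frac1{|\Omega|}\int_\Omega\big(\nu+\mu\tau|u'(x,t)|_e^2\big)|\nabla u(x,t;\omega_j)|^2\,dx\Big\rangle_e,\qquad \langle\varepsilon\rangle_\infty=\limsup_{T\to\infty}\frac1T\int_0^T\varepsilon(t)\,dt.$$ **Scales.** $$F=\Big\langle\tfrac1{|\Omega|}\|f\|^2\Big\rangle_e^{1/2},\quad U=\Big\langle\Big\langle\tfrac1{|\Omega|}\|u\|^2\Big\rangle_e\Big\rangle_\infty^{1/2},\quad U'=\Big\langle\Big\langle\tfrac1{|\Omega|}\|u'\|^2\Big\rangle_e\Big\rangle_\infty^{1/2},$$ $$L=\min\left(L_\Omega,\ \frac{F}{\max_j\|\nabla f(\cdot;\omega_j)\|_{L^\infty}},\ \frac{F}{\langle\frac1{|\Omega|}\|\nabla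 f\|^2\rangle_e^{1/2}}\right),$$ $$T^*=\frac LU,\qquad I(u)=\Big(\frac{U'}{U}\Big)^2,\qquad \mathcal{R}e=\frac{LU}{\nu}.$$ Gradients are measured pointwise in the Frobenius norm. *)

theory Defs
  imports "HOL-Analysis.Analysis" "HOL-Probability.Essential_Supremum"
begin

section \<open>Smooth and periodic functions\<close>

text \<open>
  On a convex set with nonempty interior, such as the whole space or a closed time slab, the
  derivative within the set is unique, so \<open>Ck_on k S\<close> is the usual class of functions all of
  whose derivatives up to order \<open>k\<close> exist and are continuous up to the boundary.
\<close>

primrec Ck_on :: "nat \<Rightarrow> 'a::real_normed_vector set \<Rightarrow> ('a \<Rightarrow> 'b::real_normed_vector) \<Rightarrow> bool" where
  "Ck_on 0 S g \<longleftrightarrow> continuous_on S g"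
| "Ck_on (Suc k) S g \<longleftrightarrow>
     (\<exists>g'. (\<forall>x\<in>S. (g has_derivative g' x) (at x within S)) \<and> (\<forall>v. Ck_on k S (\<lambda>x. g' x v)))"

definition smooth_on :: "'a::real_normed_vector set \<Rightarrow> ('a \<Rightarrow> 'b::real_normed_vector) \<Rightarrow> bool" where
  "smooth_on S g \<longleftrightarrow> (\<forall>k. Ck_on k S g)"

definition cube :: "real \<Rightarrow> (real^3) set" where
  "cube LO = box 0 (vec LO)"

definition periodic :: "real \<Rightarrow> (real^3 \<Rightarrow> 'b) \<Rightarrow> bool" where
  "periodic LO g \<longleftrightarrow> (\<forall>x i. g (x + LO *\<^sub>R axis i 1) = g x)"

definition mean_zero :: "real \<Rightarrow> (real^3 \<Rightarrow> real^3) \<Rightarrow> bool" where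
  "mean_zero LO v \<longleftrightarrow> (LINT x:cube LO|lborel. v x) = 0"

text \<open>
  The matrix \<open>grad v x\<close> has entries \<open>(grad v x) $ i $ k = \<partial>\<^sub>k v\<^sub>i(x)\<close>. The library norm and inner
  product on \<^typ>\<open>real^3^3\<close> are the Frobenius norm and the contraction \<open>A : B\<close>.
\<close>

definition grad :: "(real^3 \<Rightarrow> real^3) \<Rightarrow> real^3 \<Rightarrow> real^3^3" where
  "grad v x = jacobian v (at x)"

definition divergence :: "(real^3 \<Rightarrow> real^3) \<Rightarrow> real^3 \<Rightarrow> real" where
  "divergence v x = trace (grad v x)"

definition tensor :: "real^3 \<Rightarrow> real^3 \<Rightarrow> real^3^3" where
  "tensor a b = (\<chi> i k. a $ i * b $ k)"


section \<open>Square integrable fields on the cube\<close>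

definition L2 :: "real \<Rightarrow> (real^3 \<Rightarrow> 'b::euclidean_space) \<Rightarrow> bool" where
  "L2 LO v \<longleftrightarrow> set_borel_measurable lborel (cube LO) v \<and>
                set_integrable lborel (cube LO) (\<lambda>x. (norm (v x))\<^sup>2)"

definition L2_norm :: "real \<Rightarrow> (real^3 \<Rightarrow> 'b::euclidean_space) \<Rightarrow> real" where
  "L2_norm LO v = sqrt (LINT x:cube LO|lborel. (norm (v x))\<^sup>2)"

definition L2_inner :: "real \<Rightarrow> (real^3 \<Rightarrow> 'b::euclidean_space) \<Rightarrow> (real^3 \<Rightarrow> 'b) \<Rightarrow> real" where
  "L2_inner LO v w = (LINT x:cube LO|lborel. v x \<bullet> w x)"

definition Linf_norm :: "real \<Rightarrow> (real^3 \<Rightarrow> 'b::euclidean_space) \<Rightarrow> real" where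
  "Linf_norm LO v =
     real_of_ereal (esssup (restrict_space lborel (cube LO)) (\<lambda>x. ereal (norm (v x))))"

text \<open>
  Distributional gradient and divergence on the torus, tested against smooth periodic scalars:
  \<open>\<integral> v\<^sub>i \<partial>\<^sub>k\<psi> = - \<integral> G\<^sub>i\<^sub>k \<psi>\<close> and \<open>\<integral> v \<cdot> \<nabla>\<psi> = 0\<close>.
  Thus \<open>weak_gradient LO v G\<close> says that the periodic field \<open>v\<close> lies in \<open>H\<^sup>1\<close> of the torus, with
  no jump across the faces of the cube, and that \<open>G\<close> represents its gradient.
\<close>

definition weak_gradient :: "real \<Rightarrow> (real^3 \<Rightarrow> real^3) \<Rightarrow> (real^3 \<Rightarrow> real^3^3) \<Rightarrow> bool" where
  "weak_gradient LO v G \<longleftrightarrow> L2 LO v \<and> L2 LO G \<and>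
     (\<forall>\<psi> :: real^3 \<Rightarrow> real. smooth_on UNIV \<psi> \<and> periodic LO \<psi> \<longrightarrow>
       (\<forall>i k. (LINT x:cube LO|lborel. v x $ i * frechet_derivative \<psi> (at x) (axis k 1)) =
              - (LINT x:cube LO|lborel. G x $ i $ k * \<psi> x)))"

definition weakly_div_free :: "real \<Rightarrow> (real^3 \<Rightarrow> real^3) \<Rightarrow> bool" where
  "weakly_div_free LO v \<longleftrightarrow>
     (\<forall>\<psi> :: real^3 \<Rightarrow> real. smooth_on UNIV \<psi> \<and> periodic LO \<psi> \<longrightarrow>
       (LINT x:cube LO|lborel. frechet_derivative \<psi> (at x) (v x)) = 0)"

definition admissible_data :: "real \<Rightarrow> (real^3 \<Rightarrow> real^3) \<Rightarrow> bool" where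
  "admissible_data LO v \<longleftrightarrow>
     smooth_on UNIV v \<and> periodic LO v \<and> L2 LO v \<and> mean_zero LO v \<and> (\<forall>x. divergence v x = 0)"


section \<open>Ensembles, fluctuations and averages\<close>

text \<open>
  Realizations are indexed by \<open>j \<in> {1..J}\<close>; a velocity ensemble is written \<open>u j t x\<close>.
\<close>

definition ens :: "nat \<Rightarrow> (nat \<Rightarrow> 'b::real_vector) \<Rightarrow> 'b" where
  "ens J \<phi> = (1 / real J) *\<^sub>R (\<Sum>j=1..J. \<phi> j)"

definition fluct ::
  "nat \<Rightarrow> (nat \<Rightarrow> real \<Rightarrow> real^3 \<Rightarrow> real^3) \<Rightarrow> nat \<Rightarrow> real \<Rightarrow> real^3 \<Rightarrow> real^3" where
  "fluct J u j t x = u j t x - ens J (\<lambda>k. u k t x)"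

definition fluct_magnitude_sq ::
  "nat \<Rightarrow> (nat \<Rightarrow> real \<Rightarrow> real^3 \<Rightarrow> real^3) \<Rightarrow> real \<Rightarrow> real^3 \<Rightarrow> real" where
  "fluct_magnitude_sq J u t x = ens J (\<lambda>j. (norm (fluct J u j t x))\<^sup>2)"

definition nu_turb ::
  "real \<Rightarrow> real \<Rightarrow> nat \<Rightarrow> (nat \<Rightarrow> real \<Rightarrow> real^3 \<Rightarrow> real^3) \<Rightarrow> real \<Rightarrow> real^3 \<Rightarrow> real" where
  "nu_turb \<mu> \<tau> J u t x = \<mu> * \<tau> * fluct_magnitude_sq J u t x"

definition time_avg :: "real \<Rightarrow> (real \<Rightarrow> real) \<Rightarrow> real" where
  "time_avg T \<phi> = (1 / T) * (LINT t:{0..T}|lborel. \<phi> t)"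

definition limsup_avg :: "(real \<Rightarrow> real) \<Rightarrow> ereal" where
  "limsup_avg \<phi> = Limsup at_top (\<lambda>T. ereal (time_avg T \<phi>))"


section \<open>Weak solutions of the ensemble eddy viscosity model\<close>

text \<open>
  \<open>Du\<close> is a representative of the weak gradient of the velocity \<open>u\<close>. Fields are
  represented by Borel functions that are defined, periodic and square integrable for every
  \<open>t \<ge> 0\<close>; such a representative exists because of the weak continuity in time.
\<close>

definition solution_space ::
  "real \<Rightarrow> (real \<Rightarrow> real^3 \<Rightarrow> real^3) \<Rightarrow> (real \<Rightarrow> real^3 \<Rightarrow> real^3^3) \<Rightarrow> bool" where
  "solution_space LO u Du \<longleftrightarrow>
     set_borel_measurable borel ({0..} \<times> UNIV) (\<lambda>(t, x). u t x) \<and>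
     set_borel_measurable borel ({0..} \<times> UNIV) (\<lambda>(t, x). Du t x) \<and>
     (\<forall>t\<ge>0. periodic LO (u t) \<and> L2 LO (u t) \<and> mean_zero LO (u t) \<and> weakly_div_free LO (u t)) \<and>
     (\<forall>w. L2 LO w \<longrightarrow> continuous_on {0..} (\<lambda>t. L2_inner LO (u t) w)) \<and>
     (AE t in lborel. t \<ge> 0 \<longrightarrow> weak_gradient LO (u t) (Du t)) \<and>
     (\<forall>T>0. (\<exists>C. AE t in lborel. t \<in> {0..T} \<longrightarrow> L2_norm LO (u t) \<le> C) \<and>
            (\<integral>\<^sup>+t\<in>{0..T}. (\<integral>\<^sup>+x\<in>cube LO. ennreal ((norm (Du t x))\<^sup>2) \<partial>lborel) \<partial>lborel) < \<infinity>)"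

definition test_field :: "real \<Rightarrow> real \<Rightarrow> (real \<Rightarrow> real^3 \<Rightarrow> real^3) \<Rightarrow> bool" where
  "test_field LO T \<phi> \<longleftrightarrow>
     smooth_on ({0..T} \<times> UNIV) (\<lambda>(t, x). \<phi> t x) \<and>
     (\<forall>t\<in>{0..T}. periodic LO (\<phi> t) \<and> (\<forall>x. divergence (\<phi> t) x = 0))"

definition weak_momentum ::
  "real \<Rightarrow> real \<Rightarrow> (real \<Rightarrow> real^3 \<Rightarrow> real) \<Rightarrow> (real^3 \<Rightarrow> real^3) \<Rightarrow> (real^3 \<Rightarrow> real^3) \<Rightarrow>
   (real \<Rightarrow> real^3 \<Rightarrow> real^3) \<Rightarrow> (real \<Rightarrow> real^3 \<Rightarrow> real^3^3) \<Rightarrow> real \<Rightarrow> bool" where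
  "weak_momentum LO \<nu> \<nu>t u0 f u Du T \<longleftrightarrow>
     (\<forall>\<phi>. test_field LO T \<phi> \<longrightarrow>
        L2_inner LO (u T) (\<phi> T)
        - (LINT t:{0..T}|lborel.
             L2_inner LO (u t) (\<lambda>x. vector_derivative (\<lambda>s. \<phi> s x) (at t within {0..T})))
        - (LINT t:{0..T}|lborel. LINT x:cube LO|lborel. tensor (u t x) (u t x) \<bullet> grad (\<phi> t) x)
        + (LINT t:{0..T}|lborel. LINT x:cube LO|lborel. (\<nu> + \<nu>t t x) * (Du t x \<bullet> grad (\<phi> t) x))
        = L2_inner LO u0 (\<phi> 0) + (LINT t:{0..T}|lborel. L2_inner LO f (\<phi> t)))"

text \<open>
  The dissipation on the left is an integral with values in \<open>[0, \<infinity>]\<close>, so that the inequality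
  includes its finiteness. This is what makes the viscous term of \<^const>\<open>weak_momentum\<close>, and the
  dissipation rate below, integrals of integrable functions.
\<close>

definition energy_inequality ::
  "real \<Rightarrow> real \<Rightarrow> (real \<Rightarrow> real^3 \<Rightarrow> real) \<Rightarrow> (real^3 \<Rightarrow> real^3) \<Rightarrow> (real^3 \<Rightarrow> real^3) \<Rightarrow>
   (real \<Rightarrow> real^3 \<Rightarrow> real^3) \<Rightarrow> (real \<Rightarrow> real^3 \<Rightarrow> real^3^3) \<Rightarrow> real \<Rightarrow> bool" where
  "energy_inequality LO \<nu> \<nu>t u0 f u Du T \<longleftrightarrow>
     ereal ((L2_norm LO (u T))\<^sup>2 / 2)
     + enn2ereal (\<integral>\<^sup>+t\<in>{0..T}. (\<integral>\<^sup>+x\<in>cube LO.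
         ennreal ((\<nu> + \<nu>t t x) * (norm (Du t x))\<^sup>2) \<partial>lborel) \<partial>lborel)
     \<le> ereal ((L2_norm LO u0)\<^sup>2 / 2 + (LINT t:{0..T}|lborel. L2_inner LO f (u t)))"

definition weak_solution ::
  "real \<Rightarrow> real \<Rightarrow> real \<Rightarrow> real \<Rightarrow> nat \<Rightarrow> (nat \<Rightarrow> real^3 \<Rightarrow> real^3) \<Rightarrow> (nat \<Rightarrow> real^3 \<Rightarrow> real^3) \<Rightarrow>
   (nat \<Rightarrow> real \<Rightarrow> real^3 \<Rightarrow> real^3) \<Rightarrow> (nat \<Rightarrow> real \<Rightarrow> real^3 \<Rightarrow> real^3^3) \<Rightarrow> bool" where
  "weak_solution LO \<nu> \<mu> \<tau> J u0 f u Du \<longleftrightarrow>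
     (\<forall>j\<in>{1..J}. solution_space LO (u j) (Du j) \<and>
        (\<forall>T>0. weak_momentum LO \<nu> (nu_turb \<mu> \<tau> J u) (u0 j) (f j) (u j) (Du j) T \<and>
               energy_inequality LO \<nu> (nu_turb \<mu> \<tau> J u) (u0 j) (f j) (u j) (Du j) T))"


section \<open>Dissipation rate and scales\<close>

definition dissipation ::
  "real \<Rightarrow> real \<Rightarrow> real \<Rightarrow> real \<Rightarrow> nat \<Rightarrow> (nat \<Rightarrow> real \<Rightarrow> real^3 \<Rightarrow> real^3) \<Rightarrow>
   (nat \<Rightarrow> real \<Rightarrow> real^3 \<Rightarrow> real^3^3) \<Rightarrow> real \<Rightarrow> real" where
  "dissipation LO \<nu> \<mu> \<tau> J u Du t =
     ens J (\<lambda>j. 1 / measure lborel (cube LO) *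
       (LINT x:cube LO|lborel. (\<nu> + nu_turb \<mu> \<tau> J u t x) * (norm (Du j t x))\<^sup>2))"

definition force_scale :: "real \<Rightarrow> nat \<Rightarrow> (nat \<Rightarrow> real^3 \<Rightarrow> real^3) \<Rightarrow> real" where
  "force_scale LO J f = sqrt (ens J (\<lambda>j. 1 / measure lborel (cube LO) * (L2_norm LO (f j))\<^sup>2))"

text \<open>
  For \<open>v = u\<close> this is \<open>U\<close>, for \<open>v = u'\<close> it is \<open>U'\<close>. For weak solutions both limits superior are
  finite: the energy inequality and the Poincare inequality bound the time averages of
  \<open>\<parallel>u\<parallel>\<^sup>2\<close> uniformly in \<open>T\<close>. Hence \<^const>\<open>real_of_ereal\<close> never meets an infinite argument there.
\<close>

definition velocity_scale ::
  "real \<Rightarrow> nat \<Rightarrow> (nat \<Rightarrow> real \<Rightarrow> real^3 \<Rightarrow> real^3) \<Rightarrow> real" where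
  "velocity_scale LO J v = sqrt (real_of_ereal (limsup_avg
     (\<lambda>t. ens J (\<lambda>j. 1 / measure lborel (cube LO) * (L2_norm LO (v j t))\<^sup>2))))"

definition length_scale :: "real \<Rightarrow> nat \<Rightarrow> (nat \<Rightarrow> real^3 \<Rightarrow> real^3) \<Rightarrow> real" where
  "length_scale LO J f =
     (let F = force_scale LO J f in
      min LO (min (F / Max ((\<lambda>j. Linf_norm LO (grad (f j))) ` {1..J}))
                  (F / sqrt (ens J (\<lambda>j. 1 / measure lborel (cube LO) * (L2_norm LO (grad (f j)))\<^sup>2)))))"

end

theory Submission
  imports Defs "HOL-Real_Asymp.Real_Asymp"
begin

text \<open>
  Two inequalities are averaged over the ensemble and over \<open>[0, T]\<close>. The energy inequality gives
  \<open>\<langle>\<epsilon>\<rangle> \<le> F U\<close> in the limit. Testing the momentum equation of each realization with its own force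
  gives \<open>F\<^sup>2 \<le> (F / L) U\<^sup>2 + \<langle>\<epsilon>\<rangle>\<^sup>1\<^sup>/\<^sup>2 (F / L) (\<nu> + \<mu> \<tau> U'\<^sup>2)\<^sup>1\<^sup>/\<^sup>2\<close>, because \<open>\<bar>\<nabla>f\<bar> \<le> F / L\<close> both uniformly and in
  the mean square. Eliminating \<open>F\<close> and splitting the last product by Young's inequality with weight
  \<open>\<alpha>\<close> yields the bound. Instead of the square roots, both estimates are kept as Young inequalities
  with a free parameter, which are linear in the averages and pass to the limit superior.

  The limits superior are finite because the Poincare inequality lets the viscous dissipation
  absorb the work of the force. For weak gradients it follows from Fourier series: Bessel's
  inequality for the gradient, and the density of trigonometric polynomials in \<open>L\<^sup>2\<close> for the
  velocity.
\<close>

section \<open>Fourier series on the cube\<close>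

text \<open>The averages of velocity, fluctuations and dissipation may come near their limits
  superior at different times, so no single time need reach all three limits. Monotonicity rescues
  the passage: every average on a right side has a nonnegative coefficient, so an eventual upper
  bound on each is enough. The free weights are chosen only afterwards, since the good values
  \<open>U / F\<close> and \<open>2 * \<alpha> * F / U\<close> involve the limits themselves. The
  share \<alpha> of the dissipation moved to the left gives the factor
  \<open>1 / (1 - \<alpha>)\<close>, and the other half of Young's inequality gives
  \<open>1 / (4 * \<alpha>)\<close>. The two gradient quantities in the length scale have different
  tasks: the uniform bound controls convection and the turbulent viscosity, whose weights |u|^2 and
  |u'|_e^2 are merely integrable, and the mean square controls the term with \<nu>. In the Poincare
  inequality the weak gradient is known only through integrals against test functions. It is
  therefore compared with the velocity frequency by frequency, on finite sets of
  frequencies.\<close>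

abbreviation cube_measure :: "real \<Rightarrow> (real^3) measure" where
  "cube_measure LO \<equiv> restrict_space lborel (cube LO)"

lemma cube_sets [measurable]: "cube LO \<in> sets borel"
  by (simp add: cube_def)

lemma set_integral_cube:
  fixes g :: "real^3 \<Rightarrow> 'b::{banach, second_countable_topology}"
  shows "(LINT x:cube LO|lborel. g x) = integral\<^sup>L (cube_measure LO) g"
  by (simp add: set_lebesgue_integral_def integral_restrict_space)

lemma mem_cube: "x \<in> cube LO \<longleftrightarrow> (\<forall>i. 0 < x $ i \<and> x $ i < LO)"
  by (simp add: cube_def mem_box_cart)

lemma emeasure_cube: "LO > 0 \<Longrightarrow> emeasure lborel (cube LO) = ennreal (LO ^ 3)"
proof -
  assume "LO > 0"
  then have "(\<Prod>b\<in>(Basis::(real^3) set). (vec LO - 0) \<bullet> b) = LO ^ 3"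
  proof -
    have "(\<Prod>b\<in>(Basis::(real^3) set). (vec LO - 0) \<bullet> b) = (\<Prod>b\<in>(Basis::(real^3) set). LO)"
      by (rule prod.cong) (auto simp: Basis_vec_def inner_axis)
    then show ?thesis by simp
  qed
  then show ?thesis
    unfolding cube_def using \<open>LO > 0\<close>
    by (subst emeasure_lborel_box) (auto simp: Basis_vec_def inner_axis)
qed

lemma measure_cube: "LO > 0 \<Longrightarrow> measure lborel (cube LO) = LO ^ 3"
  by (simp add: measure_def emeasure_cube)

lemma finite_measure_cube: "finite_measure (cube_measure LO)"
  by (rule finite_measureI)
    (simp add: space_restrict_space emeasure_restrict_space cube_def emeasure_lborel_box_eq)

lemma space_cube_measure [simp]: "space (cube_measure LO) = cube LO"
  by (simp add: space_restrict_space)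

lemma measurable_cube_measure: "g \<in> borel_measurable borel \<Longrightarrow> g \<in> borel_measurable (cube_measure LO)"
  by (simp add: measurable_restrict_space1)

section \<open>Characters of the torus and their orthogonality\<close>

definition wave_vector :: "real \<Rightarrow> int^3 \<Rightarrow> real^3" where
  "wave_vector LO k = (\<chi> i. 2 * pi / LO * of_int (k $ i))"

definition wave :: "real \<Rightarrow> int^3 \<Rightarrow> real^3 \<Rightarrow> complex" where
  "wave LO k x = cis (wave_vector LO k \<bullet> x)"

lemma wave_vector_add: "wave_vector LO (k + l) = wave_vector LO k + wave_vector LO l"
  by (simp add: wave_vector_def vec_eq_iff distrib_left)

lemma wave_vector_minus: "wave_vector LO (- k) = - wave_vector LO k"
  by (simp add: wave_vector_def vec_eq_iff)

lemma wave_add: "wave LO (k + l) x = wave LO k x * wave LO l x"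
  by (simp add: wave_def wave_vector_add inner_add_left cis_mult)

lemma wave_minus: "wave LO (- k) x = cnj (wave LO k x)"
  by (simp add: wave_def wave_vector_minus cis_cnj)

lemma wave_0 [simp]: "wave LO 0 x = 1"
  by (simp add: wave_def wave_vector_def inner_vec_def)

lemma norm_wave [simp]: "norm (wave LO k x) = 1"
  by (simp add: wave_def)

lemma continuous_wave: "continuous_on S (wave LO k)"
  unfolding wave_def cis_conv_exp by (intro continuous_intros)

lemma wave_measurable [measurable]: "wave LO k \<in> borel_measurable borel"
  by (rule borel_measurable_continuous_onI[OF continuous_wave])

lemma integral_cis_period:
  fixes m :: int
  assumes "LO > 0" "m \<noteq> 0"
  shows "(\<integral>x. indicator {0<..<LO} x *\<^sub>R cis (2 * pi / LO * of_int m * x) \<partial>lborel) = 0"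
proof -
  define c where "c = 2 * pi / LO * of_int m"
  have c: "c \<noteq> 0" "c * LO = 2 * pi * of_int m" using assms by (auto simp: c_def)
  have "((\<lambda>x. cis (c * x) / (\<i> * c)) has_vector_derivative cis (c * x)) (at x within {0..LO})" for x
  proof -
    have "((\<lambda>x. exp (\<i> * (c * of_real x)) / (\<i> * c)) has_vector_derivative exp (\<i> * (c * of_real x)))
        (at x within {0..LO})"
      using c by (auto intro!: derivative_eq_intros has_vector_derivative_real_field
            simp: mult.left_commute[of \<i> _ \<i>])
    then show ?thesis by (simp add: cis_conv_exp)
  qed
  then have "(\<integral>x. indicator {0..LO} x *\<^sub>R cis (c * x) \<partial>lborel) = cis (c * LO) / (\<i> * c) - cis (c * 0) / (\<i> * c)"
    using assms by (intro integral_FTC_Icc continuous_intros) (auto simp: cis_conv_exp intro!: continuous_intros)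
  also have "\<dots> = 0" using c by (simp add: cis_multiple_2pi)
  \<comment> \<open>The antiderivative is used on the closed interval, while the cube is open; the
    two endpoints form a null set.\<close>
  also have "(\<integral>x. indicator {0..LO} x *\<^sub>R cis (c * x) \<partial>lborel)
      = (\<integral>x. indicator {0<..<LO} x *\<^sub>R cis (c * x) \<partial>lborel)"
    unfolding set_lebesgue_integral_def[symmetric]
    by (rule set_integral_discrete_difference[where X="{0, LO}"]) auto
  finally show ?thesis unfolding c_def by simp
qed

text \<open>The wave factors over the coordinates, and the factor of a coordinate with
  \<open>k $ i \<noteq> 0\<close> integrates to zero over a whole period.\<close>

lemma integral_wave:
  assumes "LO > 0"
  shows "(\<integral>x. wave LO k x \<partial>cube_measure LO) = (if k = 0 then of_real (LO ^ 3) else 0)"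
proof (cases "k = 0")
  case True
  then show ?thesis using assms
    by (simp add: measure_restrict_space measure_cube scaleR_conv_of_real)
next
  case False
  then obtain i where i: "k $ i \<noteq> 0" by (auto simp: vec_eq_iff)
  define g :: "real^3 \<Rightarrow> real \<Rightarrow> complex"
    where "g b = (\<lambda>y. indicator {0<..<LO} y *\<^sub>R cis (wave_vector LO k \<bullet> b * y))" for b
  have g: "integrable lborel (g b)" for b
    unfolding g_def using assms
    by (intro integrableI_bounded_set[where A="{0<..<LO}" and B=1])
      (auto simp: cis_conv_exp intro!: borel_measurable_continuous_on_indicator borel_measurable_scaleR borel_measurable_continuous_onI continuous_intros split: split_indicator)
  interpret product_sigma_finite "\<lambda>b::real^3. lborel :: real measure" ..
  have "(\<integral>x. wave LO k x \<partial>cube_measure LO) = (\<integral>x. indicator (cube LO) x *\<^sub>R wave LO k x \<partial>lborel)"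
    by (simp add: integral_restrict_space)
  also have "\<dots> = (\<integral>x. (\<Prod>b\<in>Basis. g b (x \<bullet> b)) \<partial>lborel)"
  proof (rule Bochner_Integration.integral_cong[OF refl])
    fix x :: "real^3"
    have "(\<Prod>b\<in>Basis. cis (wave_vector LO k \<bullet> b * (x \<bullet> b))) = cis (wave_vector LO k \<bullet> x)"
      by (simp add: cis_conv_exp flip: exp_sum) (simp add: euclidean_inner[of _ x] sum_distrib_left)
    moreover have "(\<Prod>b\<in>Basis. indicator {0<..<LO} (x \<bullet> b)) = (indicator (cube LO) x :: real)"
      by (auto simp: indicator_def mem_cube Basis_vec_def inner_axis prod_zero_iff intro!: prod.neutral)
    ultimately show "indicator (cube LO) x *\<^sub>R wave LO k x = (\<Prod>b\<in>Basis. g b (x \<bullet> b))"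
      unfolding g_def wave_def by (simp add: scaleR_conv_of_real prod.distrib flip: of_real_prod)
  qed
  also have "\<dots> = (\<integral>f. (\<Prod>b\<in>Basis. g b (f b)) \<partial>(\<Pi>\<^sub>M b\<in>(Basis::(real^3) set). lborel))"
    using g by (subst lborel_eq, subst integral_distr) (auto intro!: Bochner_Integration.integral_cong borel_measurable_prod
      measurable_compose[OF _ borel_measurable_integrable[OF g, unfolded measurable_lborel2]] prod.cong simp: inner_sum_left inner_Basis if_distrib cong: if_cong)
  also have "\<dots> = (\<Prod>b\<in>Basis. integral\<^sup>L lborel (g b))"
    by (rule product_integral_prod) (auto intro: g)
  also have "\<dots> = 0"
  proof -
    have "integral\<^sup>L lborel (g (axis i 1)) = 0"
      using integral_cis_period[OF assms i] unfolding g_def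
      by (simp add: wave_vector_def inner_axis)
    then show ?thesis by (intro prod_zero) (auto simp: Basis_vec_def)
  qed
  finally show ?thesis using False by simp
qed

section \<open>Fourier coefficients and Bessel's inequality\<close>

lemma integrable_of_square:
  fixes v :: "real^3 \<Rightarrow> real"
  assumes [measurable]: "v \<in> borel_measurable (cube_measure LO)"
    and "integrable (cube_measure LO) (\<lambda>x. (v x)\<^sup>2)"
  shows "integrable (cube_measure LO) v"
proof -
  interpret finite_measure "cube_measure LO" by (rule finite_measure_cube)
  show ?thesis
  proof (rule Bochner_Integration.integrable_bound)
    show "integrable (cube_measure LO) (\<lambda>x. 1 + (v x)\<^sup>2)" using assms by simp
    have "\<bar>a\<bar> \<le> 1 + a\<^sup>2" for a :: real
      using sum_squares_ge_zero[of "\<bar>a\<bar> - 1" "\<bar>a\<bar>"] zero_le_power2[of "\<bar>a\<bar> - 1"]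
      by (simp add: power2_eq_square algebra_simps)
    then show "AE x in cube_measure LO. norm (v x) \<le> norm (1 + (v x)\<^sup>2)" by auto
  qed simp
qed

text \<open>There is no division by the volume; the factors \<open>LO ^ 3\<close> in Bessel's
  inequality and in its converse make up for it.\<close>

definition fourier_coeff :: "real \<Rightarrow> (real^3 \<Rightarrow> real) \<Rightarrow> int^3 \<Rightarrow> complex" where
  "fourier_coeff LO v k = (\<integral>x. of_real (v x) * cnj (wave LO k x) \<partial>cube_measure LO)"

lemma wave_measurable_cube [measurable]: "wave LO k \<in> borel_measurable (cube_measure LO)"
  by (rule measurable_cube_measure) simp

lemma integrable_mult_wave:
  assumes "v \<in> borel_measurable (cube_measure LO)" "integrable (cube_measure LO) (\<lambda>x. (v x)\<^sup>2)"
  shows "integrable (cube_measure LO) (\<lambda>x. of_real (v x) * cnj (wave LO k x))"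
proof (rule Bochner_Integration.integrable_bound[OF integrable_of_square[OF assms]])
  have "(\<lambda>x. cnj (wave LO k x)) \<in> borel_measurable (cube_measure LO)"
    by (simp flip: wave_minus)
  then show "(\<lambda>x. complex_of_real (v x) * cnj (wave LO k x)) \<in> borel_measurable (cube_measure LO)"
    using assms by (intro borel_measurable_times borel_measurable_of_real) auto
qed (auto simp: norm_mult)

lemma integrable_wave: "integrable (cube_measure LO) (wave LO k)"
proof -
  interpret finite_measure "cube_measure LO" by (rule finite_measure_cube)
  show ?thesis by (rule integrable_const_bound[where B=1]) auto
qed

text \<open>The coefficients are left arbitrary, so that one identity serves both the projection, in
  Bessel's inequality, and a given approximant, in its converse. By orthogonality only the diagonal
  of the double sum survives.\<close>

lemma square_distance_trig_poly:
  assumes "LO > 0" and K: "finite K" and v: "v \<in> borel_measurable (cube_measure LO)"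
    "integrable (cube_measure LO) (\<lambda>x. (v x)\<^sup>2)"
  shows "(\<integral>x. (cmod (of_real (v x) - (\<Sum>k\<in>K. c k * wave LO k x)))\<^sup>2 \<partial>cube_measure LO)
    = (\<integral>x. (v x)\<^sup>2 \<partial>cube_measure LO)
      - 2 * (\<Sum>k\<in>K. Re (cnj (c k) * fourier_coeff LO v k)) + LO ^ 3 * (\<Sum>k\<in>K. (cmod (c k))\<^sup>2)"
    (is "integral\<^sup>L ?M _ = _")
proof -
  have pw: "(cmod (of_real (v x) - (\<Sum>k\<in>K. c k * wave LO k x)))\<^sup>2 =
    (v x)\<^sup>2 - 2 * Re (\<Sum>k\<in>K. cnj (c k) * (of_real (v x) * cnj (wave LO k x)))
      + Re (\<Sum>k\<in>K. \<Sum>l\<in>K. c k * cnj (c l) * wave LO (k - l) x)" for x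
  proof -
    define p where "p = (\<Sum>k\<in>K. c k * wave LO k x)"
    have "(cmod (of_real (v x) - p))\<^sup>2 = (v x)\<^sup>2 - 2 * Re (of_real (v x) * cnj p) + Re (p * cnj p)"
      unfolding cmod_power2 by (simp add: power2_eq_square algebra_simps)
    also have "of_real (v x) * cnj p = (\<Sum>k\<in>K. cnj (c k) * (of_real (v x) * cnj (wave LO k x)))"
      by (simp add: p_def sum_distrib_left mult_ac)
    also have "p * cnj p = (\<Sum>k\<in>K. \<Sum>l\<in>K. c k * cnj (c l) * wave LO (k - l) x)"
      using wave_add[of LO _ "- _"]
      by (simp add: p_def sum_product mult_ac wave_minus diff_conv_add_uminus del: add_uminus_conv_diff)
    finally show ?thesis unfolding p_def .
  qed
  have i1: "integrable ?M (\<lambda>x. \<Sum>k\<in>K. cnj (c k) * (of_real (v x) * cnj (wave LO k x)))"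
    by (intro Bochner_Integration.integrable_sum integrable_mult_right integrable_mult_wave v)
  have i2: "integrable ?M (\<lambda>x. \<Sum>k\<in>K. \<Sum>l\<in>K. c k * cnj (c l) * wave LO (k - l) x)"
    by (intro Bochner_Integration.integrable_sum integrable_mult_right integrable_wave)
  have "(\<integral>x. (\<Sum>k\<in>K. cnj (c k) * (of_real (v x) * cnj (wave LO k x))) \<partial>?M)
      = (\<Sum>k\<in>K. cnj (c k) * fourier_coeff LO v k)"
    unfolding fourier_coeff_def
    by (subst Bochner_Integration.integral_sum)
      (auto intro!: integrable_mult_right integrable_mult_wave v)
  moreover have "(\<integral>x. (\<Sum>k\<in>K. \<Sum>l\<in>K. c k * cnj (c l) * wave LO (k - l) x) \<partial>?M)
      = (\<Sum>k\<in>K. \<Sum>l\<in>K. c k * cnj (c l) * (if k = l then of_real (LO ^ 3) else 0))"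
    by (subst Bochner_Integration.integral_sum Bochner_Integration.integral_sum
       | intro Bochner_Integration.integrable_sum integrable_mult_right integrable_wave
         sum.cong refl
       | simp add: integral_wave[OF \<open>LO > 0\<close>])+
  moreover have "\<dots> = of_real (LO ^ 3 * (\<Sum>k\<in>K. (cmod (c k))\<^sup>2))"
    using K by (simp add: if_distrib sum_distrib_left complex_norm_square mult_ac
      cong: if_cong del: of_real_power)
  moreover have split: "(\<integral>x. (v x)\<^sup>2 - 2 * Re (P x) + Re (Q x) \<partial>?M)
      = (\<integral>x. (v x)\<^sup>2 \<partial>?M) - 2 * Re (\<integral>x. P x \<partial>?M) + Re (\<integral>x. Q x \<partial>?M)"
    if "integrable ?M P" "integrable ?M Q" for P Q
    using that v by simp
  ultimately show ?thesis
    unfolding pw split[OF i1 i2] by (simp only: Re_sum Re_complex_of_real)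
qed

lemma bessel_inequality:
  assumes "LO > 0" "finite K" "v \<in> borel_measurable (cube_measure LO)"
    "integrable (cube_measure LO) (\<lambda>x. (v x)\<^sup>2)"
  shows "(\<Sum>k\<in>K. (cmod (fourier_coeff LO v k))\<^sup>2) \<le> LO ^ 3 * (\<integral>x. (v x)\<^sup>2 \<partial>cube_measure LO)"
proof -
  \<comment> \<open>These are the coefficients of the orthogonal projection, which minimise the
    distance.\<close>
  define c where "c k = fourier_coeff LO v k / of_real (LO ^ 3)" for k
  have "0 \<le> (\<integral>x. (cmod (of_real (v x) - (\<Sum>k\<in>K. c k * wave LO k x)))\<^sup>2 \<partial>cube_measure LO)"
    by (intro integral_nonneg_AE) auto
  also have "\<dots> = (\<integral>x. (v x)\<^sup>2 \<partial>cube_measure LO)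
      - 2 * (\<Sum>k\<in>K. Re (cnj (c k) * fourier_coeff LO v k)) + LO ^ 3 * (\<Sum>k\<in>K. (cmod (c k))\<^sup>2)"
    by (rule square_distance_trig_poly[OF assms])
  also have "(\<Sum>k\<in>K. Re (cnj (c k) * fourier_coeff LO v k)) = (\<Sum>k\<in>K. (cmod (fourier_coeff LO v k))\<^sup>2) / LO ^ 3"
    unfolding sum_divide_distrib
  proof (rule sum.cong[OF refl])
    fix k
    have "cnj (c k) * fourier_coeff LO v k = of_real ((cmod (fourier_coeff LO v k))\<^sup>2 / LO ^ 3)"
      unfolding c_def of_real_divide complex_norm_square by simp
    then show "Re (cnj (c k) * fourier_coeff LO v k) = (cmod (fourier_coeff LO v k))\<^sup>2 / LO ^ 3"
      by (metis Re_complex_of_real)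
  qed
  also have "(\<Sum>k\<in>K. (cmod (c k))\<^sup>2) = (\<Sum>k\<in>K. (cmod (fourier_coeff LO v k))\<^sup>2) / (LO ^ 3)\<^sup>2"
    unfolding sum_divide_distrib using \<open>LO > 0\<close>
    by (intro sum.cong) (auto simp: c_def norm_divide power_divide norm_power)
  finally show ?thesis using \<open>LO > 0\<close> by (simp add: power2_eq_square field_simps)
qed

text \<open>An approximant with frequencies in \<open>K\<close> cannot beat the projection, so the
  part of the squared norm that the Bessel sum misses is at most \<open>e\<close>. The projection
  itself is avoided by completing a square at each frequency.\<close>

lemma trig_poly_approx_le_bessel_sum:
  assumes "LO > 0" "finite K" "v \<in> borel_measurable (cube_measure LO)"
    "integrable (cube_measure LO) (\<lambda>x. (v x)\<^sup>2)"
    and "(\<integral>x. (cmod (of_real (v x) - (\<Sum>k\<in>K. c k * wave LO k x)))\<^sup>2 \<partial>cube_measure LO) \<le> e"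
  shows "LO ^ 3 * (\<integral>x. (v x)\<^sup>2 \<partial>cube_measure LO)
    \<le> LO ^ 3 * e + (\<Sum>k\<in>K. (cmod (fourier_coeff LO v k))\<^sup>2)"
proof -
  have "2 * LO ^ 3 * Re (cnj (c k) * fourier_coeff LO v k)
      \<le> (LO ^ 3)\<^sup>2 * (cmod (c k))\<^sup>2 + (cmod (fourier_coeff LO v k))\<^sup>2" for k
  proof -
    have "0 \<le> (cmod (of_real (LO ^ 3) * c k - fourier_coeff LO v k))\<^sup>2" by simp
    also have "\<dots> = (LO ^ 3)\<^sup>2 * (cmod (c k))\<^sup>2 + (cmod (fourier_coeff LO v k))\<^sup>2
        - 2 * LO ^ 3 * Re (cnj (c k) * fourier_coeff LO v k)"
      unfolding cmod_power2 of_real_power[symmetric] by (simp add: power2_eq_square algebra_simps del: of_real_power)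
    finally show ?thesis by simp
  qed
  then have "(\<Sum>k\<in>K. 2 * LO ^ 3 * Re (cnj (c k) * fourier_coeff LO v k))
      \<le> (\<Sum>k\<in>K. (LO ^ 3)\<^sup>2 * (cmod (c k))\<^sup>2 + (cmod (fourier_coeff LO v k))\<^sup>2)"
    by (intro sum_mono)
  then have "2 * LO ^ 3 * (\<Sum>k\<in>K. Re (cnj (c k) * fourier_coeff LO v k))
      \<le> (LO ^ 3)\<^sup>2 * (\<Sum>k\<in>K. (cmod (c k))\<^sup>2) + (\<Sum>k\<in>K. (cmod (fourier_coeff LO v k))\<^sup>2)"
    unfolding sum.distrib sum_distrib_left .
  moreover have "LO ^ 3 * ((\<integral>x. (v x)\<^sup>2 \<partial>cube_measure LO)
      - 2 * (\<Sum>k\<in>K. Re (cnj (c k) * fourier_coeff LO v k)) + LO ^ 3 * (\<Sum>k\<in>K. (cmod (c k))\<^sup>2)) \<le> LO ^ 3 * e"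
    using assms(5) square_distance_trig_poly[OF assms(1-4), of c] \<open>LO > 0\<close>
    by (intro mult_left_mono) auto
  ultimately show ?thesis by (simp add: algebra_simps power2_eq_square)
qed

section \<open>Trigonometric polynomials and uniform approximation\<close>

definition trig_poly :: "real \<Rightarrow> (real^3 \<Rightarrow> real) \<Rightarrow> bool" where
  "trig_poly LO p \<longleftrightarrow> (\<exists>K c. finite K \<and> (\<forall>x. of_real (p x) = (\<Sum>k\<in>K. c k * wave LO k x)))"

lemma trig_poly_const: "trig_poly LO (\<lambda>x. a)"
  unfolding trig_poly_def by (rule exI[of _ "{0}"], rule exI[of _ "\<lambda>_. of_real a"]) simp

lemma trig_poly_add:
  assumes "trig_poly LO p" "trig_poly LO q"
  shows "trig_poly LO (\<lambda>x. p x + q x)"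
proof -
  from assms obtain K c L d where K: "finite K" "\<And>x. of_real (p x) = (\<Sum>k\<in>K. c k * wave LO k x)"
    and L: "finite L" "\<And>x. of_real (q x) = (\<Sum>k\<in>L. d k * wave LO k x)"
    unfolding trig_poly_def by blast
  have "of_real (p x + q x)
      = (\<Sum>k\<in>K \<union> L. ((if k \<in> K then c k else 0) + (if k \<in> L then d k else 0)) * wave LO k x)" for x
  proof -
    have "(\<Sum>k\<in>K. c k * wave LO k x) = (\<Sum>k\<in>K \<union> L. (if k \<in> K then c k else 0) * wave LO k x)"
      by (rule sum.mono_neutral_cong_left) (use K L in auto)
    moreover have "(\<Sum>k\<in>L. d k * wave LO k x) = (\<Sum>k\<in>K \<union> L. (if k \<in> L then d k else 0) * wave LO k x)"
      by (rule sum.mono_neutral_cong_left) (use K L in auto)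
    ultimately show ?thesis using K L by (simp add: sum.distrib distrib_right)
  qed
  then show ?thesis unfolding trig_poly_def using K L
    by (intro exI[of _ "K \<union> L"] exI conjI allI) auto
qed

lemma trig_poly_mult:
  assumes "trig_poly LO p" "trig_poly LO q"
  shows "trig_poly LO (\<lambda>x. p x * q x)"
proof -
  from assms obtain K c L d where K: "finite K" "\<And>x. of_real (p x) = (\<Sum>k\<in>K. c k * wave LO k x)"
    and L: "finite L" "\<And>x. of_real (q x) = (\<Sum>k\<in>L. d k * wave LO k x)"
    unfolding trig_poly_def by blast
  \<comment> \<open>The coefficients of a product are a convolution: \<open>e m\<close> collects the
    pairs of frequencies with sum \<open>m\<close>, and \<open>S\<close> is the set of all such
    sums.\<close>
  define S where "S = (\<lambda>(k, l). k + l) ` (K \<times> L)"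
  define e where "e m = (\<Sum>(k, l)\<in>{z \<in> K \<times> L. (\<lambda>(k, l). k + l) z = m}. c k * d l)" for m
  have "of_real (p x * q x) = (\<Sum>m\<in>S. e m * wave LO m x)" for x
  proof -
    have "of_real (p x * q x) = (\<Sum>(k, l)\<in>K \<times> L. c k * d l * wave LO (k + l) x)"
      using K L by (simp add: sum_product wave_add mult_ac sum.cartesian_product)
    also have "\<dots> = (\<Sum>m\<in>S. \<Sum>(k, l)\<in>{z \<in> K \<times> L. (\<lambda>(k, l). k + l) z = m}. c k * d l * wave LO (k + l) x)"
      unfolding S_def by (rule sum.image_gen) (use K L in auto)
    also have "\<dots> = (\<Sum>m\<in>S. e m * wave LO m x)"
      unfolding e_def sum_distrib_right by (intro sum.cong) auto
    finally show ?thesis .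
  qed
  moreover have "finite S" unfolding S_def using K L by auto
  ultimately show ?thesis unfolding trig_poly_def by blast
qed

lemma trig_poly_cos: "trig_poly LO (\<lambda>x. cos (wave_vector LO k \<bullet> x - a))"
proof -
  have e: "of_real (cos (wave_vector LO k \<bullet> x - a))
      = cis (- a) / 2 * wave LO k x + cis a / 2 * wave LO (- k) x" for x
    unfolding wave_minus unfolding wave_def
    by (simp add: complex_eq_iff cos_diff field_simps)
  show ?thesis
  \<comment> \<open>For \<open>k = 0\<close> the two frequencies coincide, and their coefficients
    have to be added on a one-point set.\<close>
  proof (cases "k = - k")
    case True
    then have "of_real (cos (wave_vector LO k \<bullet> x - a)) = (cis (- a) / 2 + cis a / 2) * wave LO k x" for x
      using e[of x] by (subst (asm) True[symmetric]) (simp add: distrib_right)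
    then show ?thesis
      unfolding trig_poly_def by (intro exI[of _ "{k}"] exI[of _ "\<lambda>_. cis (- a) / 2 + cis a / 2"]) simp
  next
    case False
    then show ?thesis using e unfolding trig_poly_def
      by (intro exI[of _ "{k, - k}"] exI[of _ "\<lambda>l. if l = k then cis (- a) / 2 else cis a / 2"]) auto
  qed
qed

lemma trig_poly_polynomial:
  assumes "trig_poly LO p" "real_polynomial_function q"
  shows "trig_poly LO (\<lambda>x. q (p x))"
  using assms(2)
proof (induction q rule: real_polynomial_function.induct)
  case (linear f)
  then obtain c where "f = (\<lambda>x. x * c)" by (auto simp: real_bounded_linear)
  then show ?case using trig_poly_mult[OF assms(1) trig_poly_const] by simp
qed (auto intro: trig_poly_const trig_poly_add trig_poly_mult)

lemma continuous_trig_poly: "trig_poly LO p \<Longrightarrow> continuous_on UNIV p"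
proof -
  assume "trig_poly LO p"
  then obtain K c where K: "finite K" "\<And>x. of_real (p x) = (\<Sum>k\<in>K. c k * wave LO k x)"
    unfolding trig_poly_def by blast
  have "p = (\<lambda>x. Re (\<Sum>k\<in>K. c k * wave LO k x))"
    by (rule ext) (simp flip: K(2))
  then show ?thesis by (auto intro!: continuous_intros continuous_wave)
qed

text \<open>The bound is carried along with the approximability because it controls the error of
  products.\<close>

definition uniform_trig :: "real \<Rightarrow> (real^3 \<Rightarrow> real) \<Rightarrow> bool" where
  "uniform_trig LO g \<longleftrightarrow> (\<exists>B. \<forall>x. \<bar>g x\<bar> \<le> B) \<and> (\<forall>e>0. \<exists>p. trig_poly LO p \<and> (\<forall>x. \<bar>g x - p x\<bar> \<le> e))"

lemma uniform_trig_mult: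
  assumes "uniform_trig LO g" "uniform_trig LO h"
  shows "uniform_trig LO (\<lambda>x. g x * h x)"
proof -
  obtain B where B: "\<And>x. \<bar>g x\<bar> \<le> B" using assms unfolding uniform_trig_def by blast
  obtain C where C: "\<And>x. \<bar>h x\<bar> \<le> C" using assms unfolding uniform_trig_def by blast
  have B0: "B \<ge> 0" "C \<ge> 0" using B[of 0] C[of 0] by linarith+
  have "\<exists>p. trig_poly LO p \<and> (\<forall>x. \<bar>g x * h x - p x\<bar> \<le> e)" if "e > 0" for e
  proof -
    \<comment> \<open>The product errs by at most \<open>B * d + d * (C + 1)\<close>, and
      \<open>d \<le> 1\<close> is what bounds the second approximant by
      \<open>C + 1\<close>.\<close>
    define d where "d = min 1 (e / (B + C + 1))"
    have d: "d > 0" "d \<le> 1" "d * (B + C + 1) \<le> e"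
    proof -
      show "d > 0" using that B0 by (simp add: d_def add_nonneg_pos)
      show "d \<le> 1" by (simp add: d_def)
      have "d * (B + C + 1) \<le> e / (B + C + 1) * (B + C + 1)"
        using B0 by (intro mult_right_mono) (auto simp: d_def)
      then show "d * (B + C + 1) \<le> e" using B0 by simp
    qed
    obtain p q where p: "trig_poly LO p" "\<And>x. \<bar>g x - p x\<bar> \<le> d"
      and q: "trig_poly LO q" "\<And>x. \<bar>h x - q x\<bar> \<le> d"
      using assms d(1) unfolding uniform_trig_def by metis
    have "\<bar>g x * h x - p x * q x\<bar> \<le> e" for x
    proof -
      have "\<bar>q x\<bar> \<le> C + 1" using q(2)[of x] C[of x] d by linarith
      have "\<bar>g x * h x - p x * q x\<bar> = \<bar>g x * (h x - q x) + (g x - p x) * q x\<bar>"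
        by (simp add: algebra_simps)
      also have "\<dots> \<le> \<bar>g x\<bar> * \<bar>h x - q x\<bar> + \<bar>g x - p x\<bar> * \<bar>q x\<bar>"
        by (metis abs_mult abs_triangle_ineq)
      also have "\<dots> \<le> B * d + d * (C + 1)"
        using B[of x] q(2)[of x] p(2)[of x] \<open>\<bar>q x\<bar> \<le> C + 1\<close> B0 d by (intro add_mono mult_mono) auto
      also have "\<dots> \<le> e" using d by (simp add: algebra_simps)
      finally show ?thesis .
    qed
    then show ?thesis using trig_poly_mult[OF p(1) q(1)] by blast
  qed
  moreover have "\<bar>g x * h x\<bar> \<le> B * C" for x
    using B[of x] C[of x] B0 by (simp add: abs_mult mult_mono)
  ultimately show ?thesis unfolding uniform_trig_def by blast
qed

lemma uniform_trig_const: "uniform_trig LO (\<lambda>x. a)"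
  unfolding uniform_trig_def using trig_poly_const[of LO a] by (auto intro!: exI[of _ "\<bar>a\<bar>"] exI[of _ "\<lambda>x. a"])

lemma uniform_trig_prod: "finite I \<Longrightarrow> (\<And>i. i \<in> I \<Longrightarrow> uniform_trig LO (g i)) \<Longrightarrow> uniform_trig LO (\<lambda>x. \<Prod>i\<in>I. g i x)"
  by (induction I rule: finite_induct) (auto intro: uniform_trig_const uniform_trig_mult)

text \<open>Weierstrass on an interval that contains all values of \<open>p\<close>: a polynomial in
  a trigonometric polynomial is again one. Applied to ramps \<open>h\<close>, this approximates
  superlevel sets of \<open>p\<close>.\<close>

lemma uniform_trig_continuous:
  assumes p: "trig_poly LO p" "\<And>x. \<bar>p x\<bar> \<le> B" and h: "continuous_on {-B..B} h"
  shows "uniform_trig LO (\<lambda>x. h (p x))"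
proof -
  have "\<exists>q. trig_poly LO q \<and> (\<forall>x. \<bar>h (p x) - q x\<bar> \<le> e)" if e: "e > 0" for e
  proof -
    obtain g where "real_polynomial_function g" "\<And>y. y \<in> {-B..B} \<Longrightarrow> \<bar>h y - g y\<bar> < e"
      using Stone_Weierstrass_real_polynomial_function[OF _ h e] by (auto simp: compact_Icc)
    moreover have "p x \<in> {-B..B}" for x using p(2)[of x] by (auto simp: abs_le_iff)
    ultimately show ?thesis
      using trig_poly_polynomial[OF p(1)] by (intro exI[of _ "\<lambda>x. g (p x)"]) (auto intro: less_imp_le)
  qed
  moreover have "\<exists>C. \<forall>x. \<bar>h (p x)\<bar> \<le> C"
  proof -
    have "bounded (h ` {-B..B})" by (intro compact_imp_bounded compact_continuous_image h) simp
    then obtain C where "\<forall>y\<in>{-B..B}. \<bar>h y\<bar> \<le> C" unfolding bounded_iff by auto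
    moreover have "p x \<in> {-B..B}" for x using p(2)[of x] by (auto simp: abs_le_iff)
    ultimately show ?thesis by blast
  qed
  ultimately show ?thesis unfolding uniform_trig_def by blast
qed

section \<open>Density of trigonometric polynomials in L^2\<close>

definition square_trig :: "real \<Rightarrow> (real^3 \<Rightarrow> real) \<Rightarrow> bool" where
  "square_trig LO g \<longleftrightarrow> g \<in> borel_measurable (cube_measure LO) \<and>
     integrable (cube_measure LO) (\<lambda>x. (g x)\<^sup>2) \<and>
     (\<forall>e>0. \<exists>p. trig_poly LO p \<and> (\<integral>x. (g x - p x)\<^sup>2 \<partial>cube_measure LO) \<le> e)"

lemma integrable_square_add:
  fixes g h :: "'a \<Rightarrow> real"
  assumes [measurable]: "g \<in> borel_measurable M" "h \<in> borel_measurable M"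
    and i: "integrable M (\<lambda>x. (g x)\<^sup>2)" "integrable M (\<lambda>x. (h x)\<^sup>2)"
  shows "integrable M (\<lambda>x. (g x + h x)\<^sup>2)"
    "(\<integral>x. (g x + h x)\<^sup>2 \<partial>M) \<le> 2 * (\<integral>x. (g x)\<^sup>2 \<partial>M) + 2 * (\<integral>x. (h x)\<^sup>2 \<partial>M)"
proof -
  have le: "(a + b)\<^sup>2 \<le> 2 * a\<^sup>2 + 2 * b\<^sup>2" for a b :: real
    using zero_le_power2[of "a - b"] by (simp add: power2_eq_square algebra_simps)
  have j: "integrable M (\<lambda>x. 2 * (g x)\<^sup>2 + 2 * (h x)\<^sup>2)" using i by auto
  show k: "integrable M (\<lambda>x. (g x + h x)\<^sup>2)"
    by (rule Bochner_Integration.integrable_bound[OF j]) (use le in auto)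
  have "(\<integral>x. (g x + h x)\<^sup>2 \<partial>M) \<le> (\<integral>x. 2 * (g x)\<^sup>2 + 2 * (h x)\<^sup>2 \<partial>M)"
    by (intro integral_mono k j le)
  then show "(\<integral>x. (g x + h x)\<^sup>2 \<partial>M) \<le> 2 * (\<integral>x. (g x)\<^sup>2 \<partial>M) + 2 * (\<integral>x. (h x)\<^sup>2 \<partial>M)"
    using i by simp
qed

lemma integrable_square_bounded:
  fixes g :: "real^3 \<Rightarrow> real"
  assumes "g \<in> borel_measurable (cube_measure LO)" "\<And>x. x \<in> cube LO \<Longrightarrow> \<bar>g x\<bar> \<le> B"
  shows "integrable (cube_measure LO) (\<lambda>x. (g x)\<^sup>2)"
proof -
  interpret finite_measure "cube_measure LO" by (rule finite_measure_cube)
  have "AE x in cube_measure LO. (g x)\<^sup>2 \<le> B\<^sup>2"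
    using assms(2) by (intro AE_I2) (metis abs_ge_zero order_trans power2_abs power_mono space_cube_measure)
  with assms(1) show ?thesis by (intro integrable_const_bound[where B="B\<^sup>2"]) auto
qed

lemma trig_poly_measurable: "trig_poly LO p \<Longrightarrow> p \<in> borel_measurable (cube_measure LO)"
  by (intro measurable_cube_measure borel_measurable_continuous_onI continuous_trig_poly)

lemma trig_poly_bounded: "trig_poly LO p \<Longrightarrow> \<exists>B. \<forall>x. \<bar>p x\<bar> \<le> B"
proof -
  assume "trig_poly LO p"
  then obtain K c where K: "finite K" "\<And>x. of_real (p x) = (\<Sum>k\<in>K. c k * wave LO k x)"
    unfolding trig_poly_def by blast
  have "\<bar>p x\<bar> \<le> (\<Sum>k\<in>K. cmod (c k))" for x
  proof -
    have "\<bar>p x\<bar> = cmod (\<Sum>k\<in>K. c k * wave LO k x)" by (simp flip: K(2))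
    also have "\<dots> \<le> (\<Sum>k\<in>K. cmod (c k * wave LO k x))" by (rule norm_sum)
    finally show ?thesis by (simp add: norm_mult)
  qed
  then show ?thesis by blast
qed

lemma trig_poly_integrable_square: "trig_poly LO p \<Longrightarrow> integrable (cube_measure LO) (\<lambda>x. (p x)\<^sup>2)"
  using trig_poly_bounded[of LO p] by (blast intro: integrable_square_bounded trig_poly_measurable)

text \<open>Two squared errors of \<open>e / 4\<close> combine to at most \<open>e\<close>, the
  square of a sum being at most twice the sum of the squares.\<close>

lemma square_trig_limit:
  assumes g: "g \<in> borel_measurable (cube_measure LO)" "integrable (cube_measure LO) (\<lambda>x. (g x)\<^sup>2)"
    and h: "\<And>e. e > 0 \<Longrightarrow> \<exists>h. square_trig LO h \<and> (\<integral>x. (g x - h x)\<^sup>2 \<partial>cube_measure LO) \<le> e"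
  shows "square_trig LO g"
proof -
  have "\<exists>p. trig_poly LO p \<and> (\<integral>x. (g x - p x)\<^sup>2 \<partial>cube_measure LO) \<le> e" if "e > 0" for e
  proof -
    have "e / 4 > 0" using that by simp
    from h[OF this] obtain h where h: "square_trig LO h" "(\<integral>x. (g x - h x)\<^sup>2 \<partial>cube_measure LO) \<le> e / 4"
      by blast
    then obtain p where p: "trig_poly LO p" "(\<integral>x. (h x - p x)\<^sup>2 \<partial>cube_measure LO) \<le> e / 4"
      using \<open>e / 4 > 0\<close> unfolding square_trig_def by blast
    have hm: "h \<in> borel_measurable (cube_measure LO)" "integrable (cube_measure LO) (\<lambda>x. (h x)\<^sup>2)"
      using h unfolding square_trig_def by auto
    note pm = trig_poly_measurable[OF p(1)] trig_poly_integrable_square[OF p(1)]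
    have "integrable (cube_measure LO) (\<lambda>x. (g x + - h x)\<^sup>2)" "integrable (cube_measure LO) (\<lambda>x. (h x + - p x)\<^sup>2)"
      using g hm pm by (intro integrable_square_add; simp)+
    then have "(\<integral>x. ((g x - h x) + (h x - p x))\<^sup>2 \<partial>cube_measure LO)
        \<le> 2 * (\<integral>x. (g x - h x)\<^sup>2 \<partial>cube_measure LO) + 2 * (\<integral>x. (h x - p x)\<^sup>2 \<partial>cube_measure LO)"
      using g hm pm by (intro integrable_square_add) auto
    then show ?thesis using h p by (intro exI[of _ p]) auto
  qed
  then show ?thesis using g unfolding square_trig_def by blast
qed

text \<open>Dominated convergence for the squared errors, with one majorant \<open>w\<close> for the
  limit and for all errors. The limits of ramps, of disjoint unions and of simple functions all pass
  through here.\<close>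

lemma square_trig_dominated:
  assumes g: "g \<in> borel_measurable (cube_measure LO)" and h: "\<And>n. square_trig LO (h n)"
    and lim: "\<And>x. x \<in> cube LO \<Longrightarrow> (\<lambda>n. h n x) \<longlonglongrightarrow> g x"
    and w: "integrable (cube_measure LO) w" "\<And>x. x \<in> cube LO \<Longrightarrow> (g x)\<^sup>2 \<le> w x"
      "\<And>n x. x \<in> cube LO \<Longrightarrow> (g x - h n x)\<^sup>2 \<le> w x"
  shows "square_trig LO g"
proof (rule square_trig_limit[OF g])
  have hm: "h n \<in> borel_measurable (cube_measure LO)" for n using h unfolding square_trig_def by auto
  show "integrable (cube_measure LO) (\<lambda>x. (g x)\<^sup>2)"
    by (rule Bochner_Integration.integrable_bound[OF w(1)]) (use g w(2) in \<open>force+\<close>)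
  have tend: "(\<lambda>n. \<integral>x. (g x - h n x)\<^sup>2 \<partial>cube_measure LO) \<longlonglongrightarrow> (\<integral>x. 0 \<partial>cube_measure LO)"
  proof (rule integral_dominated_convergence[where w=w])
    show "AE x in cube_measure LO. (\<lambda>n. (g x - h n x)\<^sup>2) \<longlonglongrightarrow> 0"
    proof (rule AE_I2)
      fix x assume "x \<in> space (cube_measure LO)"
      then have "(\<lambda>n. (g x - h n x)\<^sup>2) \<longlonglongrightarrow> (g x - g x)\<^sup>2"
        by (intro tendsto_intros lim) simp
      then show "(\<lambda>n. (g x - h n x)\<^sup>2) \<longlonglongrightarrow> 0" by simp
    qed
  qed (use g hm w in auto)
  then show "\<exists>h. square_trig LO h \<and> (\<integral>x. (g x - h x)\<^sup>2 \<partial>cube_measure LO) \<le> e" if "e > 0" for e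
  proof -
    have "\<forall>\<^sub>F n in sequentially. (\<integral>x. (g x - h n x)\<^sup>2 \<partial>cube_measure LO) < e"
      using tend that by (intro order_tendstoD(2)) auto
    then obtain n where "(\<integral>x. (g x - h n x)\<^sup>2 \<partial>cube_measure LO) < e"
      by (auto simp: eventually_sequentially)
    then show ?thesis using h by (intro exI[of _ "h n"]) auto
  qed
qed

lemma square_trig_add:
  assumes "square_trig LO g" "square_trig LO h" shows "square_trig LO (\<lambda>x. g x + h x)"
proof -
  have m: "g \<in> borel_measurable (cube_measure LO)" "integrable (cube_measure LO) (\<lambda>x. (g x)\<^sup>2)"
    "h \<in> borel_measurable (cube_measure LO)" "integrable (cube_measure LO) (\<lambda>x. (h x)\<^sup>2)"
    using assms unfolding square_trig_def by auto
  have "\<exists>p. trig_poly LO p \<and> (\<integral>x. (g x + h x - p x)\<^sup>2 \<partial>cube_measure LO) \<le> e" if "e > 0" for e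
  proof -
    have "e / 4 > 0" using that by simp
    with assms obtain p q where p: "trig_poly LO p" "(\<integral>x. (g x - p x)\<^sup>2 \<partial>cube_measure LO) \<le> e / 4"
      and q: "trig_poly LO q" "(\<integral>x. (h x - q x)\<^sup>2 \<partial>cube_measure LO) \<le> e / 4"
      unfolding square_trig_def by blast
    note pm = trig_poly_measurable[OF p(1)] trig_poly_integrable_square[OF p(1)]
      trig_poly_measurable[OF q(1)] trig_poly_integrable_square[OF q(1)]
    have "integrable (cube_measure LO) (\<lambda>x. (g x + - p x)\<^sup>2)" "integrable (cube_measure LO) (\<lambda>x. (h x + - q x)\<^sup>2)"
      using m pm by (intro integrable_square_add; simp)+
    then have "(\<integral>x. ((g x - p x) + (h x - q x))\<^sup>2 \<partial>cube_measure LO)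
        \<le> 2 * (\<integral>x. (g x - p x)\<^sup>2 \<partial>cube_measure LO) + 2 * (\<integral>x. (h x - q x)\<^sup>2 \<partial>cube_measure LO)"
      using m pm by (intro integrable_square_add) auto
    then show ?thesis using p q trig_poly_add[OF p(1) q(1)]
      by (intro exI[of _ "\<lambda>x. p x + q x"]) (auto simp: algebra_simps)
  qed
  then show ?thesis using m integrable_square_add(1)[OF m(1,3,2,4)] unfolding square_trig_def by auto
qed

lemma square_trig_mult:
  assumes "square_trig LO g" shows "square_trig LO (\<lambda>x. c * g x)"
proof -
  have m: "g \<in> borel_measurable (cube_measure LO)" "integrable (cube_measure LO) (\<lambda>x. (g x)\<^sup>2)"
    using assms unfolding square_trig_def by auto
  have "\<exists>p. trig_poly LO p \<and> (\<integral>x. (c * g x - p x)\<^sup>2 \<partial>cube_measure LO) \<le> e" if "e > 0" for e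
  proof -
    have "e / (c\<^sup>2 + 1) > 0" using that by (simp add: add_nonneg_pos)
    then obtain p where p: "trig_poly LO p" "(\<integral>x. (g x - p x)\<^sup>2 \<partial>cube_measure LO) \<le> e / (c\<^sup>2 + 1)"
      using assms unfolding square_trig_def by blast
    have "(\<integral>x. (c * g x - c * p x)\<^sup>2 \<partial>cube_measure LO) = c\<^sup>2 * (\<integral>x. (g x - p x)\<^sup>2 \<partial>cube_measure LO)"
      by (simp flip: right_diff_distrib add: power_mult_distrib)
    also have "\<dots> \<le> (c\<^sup>2 + 1) * (e / (c\<^sup>2 + 1))"
      using p by (intro mult_mono) auto
    also have "\<dots> = e" using add_nonneg_pos[of "c\<^sup>2" 1] by simp
    finally show ?thesis using trig_poly_mult[OF trig_poly_const p(1)] by blast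
  qed
  then show ?thesis using m unfolding square_trig_def by (simp add: power_mult_distrib)
qed

lemma uniform_trig_measurable:
  assumes "uniform_trig LO g" shows "g \<in> borel_measurable (cube_measure LO)"
proof -
  have "\<exists>p. trig_poly LO p \<and> (\<forall>x. \<bar>g x - p x\<bar> \<le> 1 / real (Suc n))" for n
    using assms unfolding uniform_trig_def by simp
  then obtain p where p: "\<And>n. trig_poly LO (p n)" "\<And>n x. \<bar>g x - p n x\<bar> \<le> 1 / real (Suc n)" by metis
  show ?thesis
  proof (rule borel_measurable_LIMSEQ_real)
    show "(\<lambda>n. p n x) \<longlonglongrightarrow> g x" for x
    proof (rule LIM_zero_cancel, rule Lim_null_comparison)
      show "(\<lambda>n. 1 / real (Suc n)) \<longlonglongrightarrow> 0" by (rule lim_1_over_n[THEN LIMSEQ_Suc])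
      show "\<forall>\<^sub>F n in sequentially. norm (p n x - g x) \<le> 1 / real (Suc n)"
        using p(2)[of x] by (simp add: abs_minus_commute)
    qed
  qed (rule trig_poly_measurable[OF p(1)])
qed

lemma uniform_trig_imp_square_trig:
  assumes "LO > 0" "uniform_trig LO g" shows "square_trig LO g"
proof -
  interpret finite_measure "cube_measure LO" by (rule finite_measure_cube)
  have m: "g \<in> borel_measurable (cube_measure LO)" by (rule uniform_trig_measurable[OF assms(2)])
  obtain B where B: "\<And>x. \<bar>g x\<bar> \<le> B" using assms unfolding uniform_trig_def by blast
  have "\<exists>p. trig_poly LO p \<and> (\<integral>x. (g x - p x)\<^sup>2 \<partial>cube_measure LO) \<le> e" if "e > 0" for e
  proof -
    \<comment> \<open>The volume is \<open>LO ^ 3\<close>, so a uniform error of this size has a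
      squared integral of at most \<open>e\<close>.\<close>
    have "sqrt (e / LO ^ 3) > 0" using that assms by simp
    then obtain p where p: "trig_poly LO p" "\<And>x. \<bar>g x - p x\<bar> \<le> sqrt (e / LO ^ 3)"
      using assms unfolding uniform_trig_def by blast
    have le: "(g x - p x)\<^sup>2 \<le> e / LO ^ 3" for x
      using power_mono[OF p(2)[of x], of 2] that assms by simp
    have "(\<integral>x. (g x - p x)\<^sup>2 \<partial>cube_measure LO) \<le> (\<integral>x. e / LO ^ 3 \<partial>cube_measure LO)"
      using le by (intro integral_mono integrable_const integrable_const_bound[where B="e / LO ^ 3"]
          borel_measurable_power borel_measurable_diff m trig_poly_measurable p(1)) auto
    also have "\<dots> = e" using assms by (simp add: measure_restrict_space measure_cube)
    finally show ?thesis using p(1) by blast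
  qed
  then show ?thesis unfolding square_trig_def using m integrable_square_bounded[OF m B] by blast
qed

text \<open>On the period from \<open>- b\<close> to \<open>2 * pi - b\<close> the cosine exceeds
  \<open>cos b\<close> exactly on the arc of radius \<open>b\<close> about 0. Beyond
  \<open>pi\<close>, the reflection \<open>2 * pi - y\<close> brings the angle back to where the
  cosine decreases.\<close>

lemma cos_gt_cos_iff:
  fixes y b :: real
  assumes "0 \<le> b" "b \<le> pi" "- b < y" "y < 2 * pi - b"
  shows "cos y > cos b \<longleftrightarrow> y < b"
proof (cases "y \<le> pi")
  case True
  have "cos y = cos \<bar>y\<bar>" by (simp add: abs_if)
  then have "cos y > cos b \<longleftrightarrow> \<bar>y\<bar> < b"
    using cos_mono_less_eq[of b "\<bar>y\<bar>"] assms True by auto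
  then show ?thesis using assms by auto
next
  case False
  have "cos y = cos (2 * pi - y)" by (simp add: cos_diff)
  then have "cos y > cos b \<longleftrightarrow> 2 * pi - y < b"
    using cos_mono_less_eq[of b "2 * pi - y"] assms False by auto
  then show ?thesis using assms False by auto
qed

text \<open>Inside the cube, a lower orthant is cut out by three arcs of circles, and every arc is a
  superlevel set of a trigonometric polynomial.\<close>

lemma square_trig_orthant:
  assumes "LO > 0"
  shows "square_trig LO (indicator {x. \<forall>i. x $ i < a $ i})"
proof -
  \<comment> \<open>In the angle \<open>2 * pi / LO * x $ i\<close> the condition
    \<open>x $ i < a $ i\<close> describes the arc from 0 to \<open>2 * b i\<close>, so
    \<open>p i\<close> is centred at \<open>b i\<close>. Clamping covers bounds \<open>a $ i\<close>
    that lie outside the cube.\<close>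
  define b where "b i = pi / LO * max 0 (min LO (a $ i))" for i
  define p where "p i x = cos (wave_vector LO (axis i 1) \<bullet> x - b i)" for i and x :: "real^3"
  \<comment> \<open>Continuous ramps that converge pointwise to the indicator of the values above
    \<open>cos (b i)\<close>.\<close>
  define h where "h n i y = max 0 (min 1 (real n * (y - cos (b i))))" for n :: nat and i y
  have p: "trig_poly LO (p i)" "\<bar>p i x\<bar> \<le> 1" for i x
    unfolding p_def by (rule trig_poly_cos) simp
  have b: "0 \<le> b i" "b i \<le> pi" for i
  proof -
    have "pi / LO * max 0 (min LO (a $ i)) \<le> pi / LO * LO"
      using assms by (intro mult_left_mono) auto
    then show "0 \<le> b i" "b i \<le> pi" using assms by (auto simp: b_def)
  qed
  have wv: "wave_vector LO (axis i 1) \<bullet> x = 2 * pi / LO * x $ i" for i x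
  proof -
    have "wave_vector LO (axis i 1) = axis i (2 * pi / LO)"
      by (simp add: wave_vector_def axis_def vec_eq_iff)
    then show ?thesis by (simp add: inner_axis' )
  qed
  have lev: "p i x > cos (b i) \<longleftrightarrow> x $ i < a $ i" if "x \<in> cube LO" for x i
  proof -
    have x: "0 < x $ i" "x $ i < LO" using that by (auto simp: mem_cube)
    have "2 * pi / LO * x $ i < 2 * pi" "2 * pi / LO * x $ i > 0"
      using x assms mult_strict_left_mono[OF x(2), of "2 * pi / LO"] by auto
    then have "p i x > cos (b i) \<longleftrightarrow> 2 * pi / LO * x $ i - b i < b i"
      unfolding p_def wv using assms b[of i] by (intro cos_gt_cos_iff) auto
    also have "\<dots> \<longleftrightarrow> pi / LO * x $ i < pi / LO * max 0 (min LO (a $ i))"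
      unfolding b_def by auto
    also have "\<dots> \<longleftrightarrow> x $ i < max 0 (min LO (a $ i))"
      using assms by (subst mult_less_cancel_left_pos) auto
    also have "\<dots> \<longleftrightarrow> x $ i < a $ i" using x by auto
    finally show ?thesis .
  qed
  have u: "uniform_trig LO (\<lambda>x. \<Prod>i\<in>UNIV. h n i (p i x))" for n
    by (intro uniform_trig_prod uniform_trig_continuous[OF p(1), where B=1 and h="h n _"])
      (use p(2) in \<open>auto simp: h_def intro!: continuous_intros\<close>)
  have h01: "0 \<le> h n i y" "h n i y \<le> 1" for n i y by (auto simp: h_def)
  have hlim: "(\<lambda>n. h n i y) \<longlonglongrightarrow> (if y > cos (b i) then 1 else 0)" for i y
  proof (cases "y > cos (b i)")
    case True
    obtain N :: nat where N: "real N * (y - cos (b i)) > 1"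
      using True reals_Archimedean3[of "y - cos (b i)"] by auto
    have "h n i y = 1" if "n \<ge> N" for n
    proof -
      have "real N * (y - cos (b i)) \<le> real n * (y - cos (b i))"
        using that True by (intro mult_right_mono) auto
      with N show ?thesis by (auto simp: h_def)
    qed
    then have "\<forall>\<^sub>F n in sequentially. h n i y = 1" by (auto simp: eventually_sequentially)
    then show ?thesis using True by (simp add: tendsto_eventually)
  next
    case False
    then have "real n * (y - cos (b i)) \<le> 0" for n by (intro mult_nonneg_nonpos) auto
    then have "h n i y = 0" for n unfolding h_def by (meson max.absorb1 min.coboundedI2)
    then show ?thesis using False by simp
  qed
  have hp: "0 \<le> (\<Prod>i\<in>UNIV. h n i (p i x))" "(\<Prod>i\<in>UNIV. h n i (p i x)) \<le> 1" for n x
    using h01 by (auto intro: prod_nonneg prod_le_1)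
  interpret finite_measure "cube_measure LO" by (rule finite_measure_cube)
  show ?thesis
  proof (rule square_trig_dominated[where w="\<lambda>_. 1" and h="\<lambda>n x. \<Prod>i\<in>UNIV. h n i (p i x)"])
    have "{x::real^3. \<forall>i. x $ i < a $ i} \<in> sets borel" by measurable
    then show "indicator {x. \<forall>i. x $ i < a $ i} \<in> borel_measurable (cube_measure LO)"
      by (intro measurable_cube_measure) simp
    show "square_trig LO (\<lambda>x. \<Prod>i\<in>UNIV. h n i (p i x))" for n
      by (rule uniform_trig_imp_square_trig[OF assms u])
    show "(\<lambda>n. \<Prod>i\<in>UNIV. h n i (p i x)) \<longlonglongrightarrow> indicator {x. \<forall>i. x $ i < a $ i} x" if "x \<in> cube LO" for x
    proof -
      have "(\<lambda>n. \<Prod>i\<in>UNIV. h n i (p i x)) \<longlonglongrightarrow> (\<Prod>i\<in>UNIV. if p i x > cos (b i) then 1 else 0)"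
        by (intro tendsto_prod hlim)
      also have "(\<Prod>i\<in>UNIV. if p i x > cos (b i) then 1 else 0) = (indicator {x. \<forall>i. x $ i < a $ i} x :: real)"
        using lev[OF that] by (auto simp: indicator_def prod_zero_iff intro!: prod.neutral)
      finally show ?thesis .
    qed
    show "(indicator {x. \<forall>i. x $ i < a $ i} x)\<^sup>2 \<le> (1::real)" for x
      by (simp add: indicator_def)
    show "(indicator {x. \<forall>i. x $ i < a $ i} x - (\<Prod>i\<in>UNIV. h n i (p i x)))\<^sup>2 \<le> (1::real)" for n x
      using hp[of n x] by (auto simp: indicator_def power_le_one abs_square_le_1)
  qed simp
qed

lemma sets_borel_orthants:
  "sets (borel :: (real^3) measure) = sigma_sets UNIV (range (\<lambda>a. {x. \<forall>i. x $ i < a $ i}))"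
proof -
  have "(\<lambda>a::real^3. {x. eucl_less x a}) = (\<lambda>a. {x. \<forall>i. x $ i < a $ i})"
    by (auto simp: eucl_less_def Basis_vec_def inner_axis)
  then have "borel = sigma UNIV (range (\<lambda>a::real^3. {x. \<forall>i. x $ i < a $ i}))"
    using borel_eq_lessThan[where 'a="real^3"] by (simp only:)
  then have "sets borel = sets (sigma UNIV (range (\<lambda>a::real^3. {x. \<forall>i. x $ i < a $ i})))"
    by (rule arg_cong)
  also have "\<dots> = sigma_sets UNIV (range (\<lambda>a. {x. \<forall>i. x $ i < a $ i}))"
    by (rule sets_measure_of) simp
  finally show ?thesis .
qed

text \<open>Dynkin's theorem: the lower orthants form an intersection stable generator, and the sets
  with approximable indicator are closed under complements and, by dominated convergence, under
  countable disjoint unions.\<close>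

lemma square_trig_indicator:
  assumes "LO > 0" "A \<in> sets borel"
  shows "square_trig LO (indicator A)"
proof -
  interpret finite_measure "cube_measure LO" by (rule finite_measure_cube)
  have A: "A \<in> sigma_sets UNIV (range (\<lambda>a. {x::real^3. \<forall>i. x $ i < a $ i}))"
    using assms(2) unfolding sets_borel_orthants .
  have borel: "B \<in> sets borel" if "B \<in> sigma_sets UNIV (range (\<lambda>a. {x::real^3. \<forall>i. x $ i < a $ i}))" for B
    using that unfolding sets_borel_orthants .
  have im: "indicator B \<in> borel_measurable (cube_measure LO)" if "B \<in> sets borel" for B :: "(real^3) set"
    using that by (intro measurable_cube_measure) simp
  show ?thesis
  proof (rule sigma_sets_induct_disjoint[OF _ _ A, where P="\<lambda>A. square_trig LO (indicator A)"])
    show "Int_stable (range (\<lambda>a. {x::real^3. \<forall>i. x $ i < a $ i}))"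
    proof (rule Int_stableI_image)
      fix a c :: "real^3"
      show "\<exists>k\<in>UNIV. {x. \<forall>i. x $ i < a $ i} \<inter> {x. \<forall>i. x $ i < c $ i} = {x. \<forall>i. x $ i < k $ i}"
        by (rule bexI[of _ "\<chi> i. min (a $ i) (c $ i)"]) auto
    qed
    show "square_trig LO (indicator B)" if "B \<in> range (\<lambda>a. {x::real^3. \<forall>i. x $ i < a $ i})" for B
      using that square_trig_orthant[OF assms(1)] by auto
    have "(indicator {} :: real^3 \<Rightarrow> real) = (\<lambda>x. 0)" by auto
    then show empty: "square_trig LO (indicator {})"
      using uniform_trig_imp_square_trig[OF assms(1) uniform_trig_const[of LO 0]] by metis
    show "square_trig LO (indicator (UNIV - B))" if "square_trig LO (indicator B)" for B
    proof -
      have "square_trig LO (\<lambda>x. 1 + (- 1) * indicator B x)"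
        by (intro square_trig_add square_trig_mult that uniform_trig_imp_square_trig[OF assms(1)] uniform_trig_const)
      moreover have "(\<lambda>x. 1 + (- 1) * indicator B x) = (indicator (UNIV - B) :: _ \<Rightarrow> real)"
        by (rule ext) (auto simp: indicator_def)
      ultimately show ?thesis by (simp only:)
    qed
    fix B :: "nat \<Rightarrow> (real^3) set"
    assume disj: "disjoint_family B" and B: "range B \<subseteq> sigma_sets UNIV (range (\<lambda>a. {x::real^3. \<forall>i. x $ i < a $ i}))"
      and sq: "\<And>i. square_trig LO (indicator (B i))"
    have part: "square_trig LO (indicator (\<Union>i<n. B i))" for n
    proof (induction n)
      case 0
      have "(\<Union>i<0. B i) = {}" by simp
      then show ?case using empty by (simp only:)
    next
      case (Suc n)
      have "B n \<inter> B i = {}" if "i < n" for i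
        using disjoint_family_onD[OF disj, of n i] that by simp
      then have "B n \<inter> (\<Union>i<n. B i) = {}" by blast
      then have "indicator (\<Union>i<Suc n. B i) x = (indicator (\<Union>i<n. B i) x + indicator (B n) x :: real)" for x
        by (simp add: indicator_def lessThan_Suc) blast
      then have "indicator (\<Union>i<Suc n. B i) = (\<lambda>x. indicator (\<Union>i<n. B i) x + indicator (B n) x :: real)"
        by (rule ext)
      then show ?case using square_trig_add[OF Suc sq[of n]] by (simp only:)
    qed
    show "square_trig LO (indicator (\<Union>i. B i))"
    proof (rule square_trig_dominated[where w="\<lambda>_. 1" and h="\<lambda>n. indicator (\<Union>i<n. B i)"])
      have "B i \<in> sets borel" for i using B borel by blast
      then have "(\<Union>i. B i) \<in> sets borel" by (intro sets.countable_UN) blast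
      then show "indicator (\<Union>i. B i) \<in> borel_measurable (cube_measure LO)" by (rule im)
      show "(\<lambda>n. indicator (\<Union>i<n. B i) x) \<longlonglongrightarrow> (indicator (\<Union>i. B i) x :: real)" for x
        by (rule LIMSEQ_indicator_UN)
      show "square_trig LO (indicator (\<Union>i<n. B i))" for n by (rule part)
    qed (simp_all add: indicator_def)
  qed simp
qed

text \<open>Square integrability stands in the conclusion because the induction has to supply it
  anew for every summand and every approximant. Nonnegativity makes this possible: the parts are
  dominated by the whole.\<close>

lemma square_trig_nonneg:
  assumes "LO > 0" and g: "g \<in> borel_measurable borel" "\<And>x. 0 \<le> g x"
  shows "integrable (cube_measure LO) (\<lambda>x. (g x)\<^sup>2) \<Longrightarrow> square_trig LO g"
  using g
proof (induction rule: borel_measurable_induct_real)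
  case (set A)
  then show ?case using square_trig_indicator[OF assms(1), of A] by simp
next
  case (mult u c)
  \<comment> \<open>For \<open>c = 0\<close> the square integrability of the product says nothing
    about \<open>u\<close>.\<close>
  show ?case
  proof (cases "c = 0")
    case True
    then show ?thesis using uniform_trig_imp_square_trig[OF assms(1) uniform_trig_const[of LO 0]] by simp
  next
    case False
    then have "integrable (cube_measure LO) (\<lambda>x. (u x)\<^sup>2)"
      using mult.prems by (simp add: power_mult_distrib)
    then show ?thesis by (rule square_trig_mult[OF mult.IH])
  qed
next
  case (add u v)
  have [measurable]: "u \<in> borel_measurable (cube_measure LO)" "v \<in> borel_measurable (cube_measure LO)"
    using add.hyps by (auto intro: measurable_cube_measure)
  have le: "(u x)\<^sup>2 \<le> (v x + u x)\<^sup>2" "(v x)\<^sup>2 \<le> (v x + u x)\<^sup>2" for x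
    using add.hyps(2,4)[of x] by (auto intro: power_mono)
  have "integrable (cube_measure LO) (\<lambda>x. (u x)\<^sup>2)"
    by (rule Bochner_Integration.integrable_bound[OF add.prems]) (use le(1) in auto)
  moreover have "integrable (cube_measure LO) (\<lambda>x. (v x)\<^sup>2)"
    by (rule Bochner_Integration.integrable_bound[OF add.prems]) (use le(2) in auto)
  ultimately show ?case by (intro square_trig_add add.IH)
next
  case (seq U)
  have [measurable]: "U i \<in> borel_measurable (cube_measure LO)" "g \<in> borel_measurable (cube_measure LO)" for i
    using seq.hyps g by (auto intro: measurable_cube_measure)
  have le: "0 \<le> U i x" "U i x \<le> g x" for i x
  proof -
    have "incseq (\<lambda>i. U i x)" using seq.hyps(3) by (simp add: incseq_def le_fun_def)
    moreover have "(\<lambda>i. U i x) \<longlonglongrightarrow> g x" using seq.hyps(4)[of x] by simp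
    ultimately show "U i x \<le> g x" by (rule incseq_le)
  qed (rule seq.hyps(2))
  have sq: "(U i x)\<^sup>2 \<le> (g x)\<^sup>2" for i x using le[of i x] by (intro power_mono)
  show ?case
  proof (rule square_trig_dominated[where w="\<lambda>x. (g x)\<^sup>2" and h=U])
    have "integrable (cube_measure LO) (\<lambda>x. (U i x)\<^sup>2)" for i
      by (rule Bochner_Integration.integrable_bound[OF seq.prems]) (use sq in auto)
    then show "square_trig LO (U i)" for i using seq.IH by blast
    show "(g x - U i x)\<^sup>2 \<le> (g x)\<^sup>2" for i x
      using le[of i x] by (intro power_mono) auto
    show "(\<lambda>n. U n x) \<longlonglongrightarrow> g x" for x using seq.hyps(4)[of x] by simp
  qed (use seq.prems in auto)
qed

lemma square_trig_L2:
  assumes "LO > 0" and g: "g \<in> borel_measurable (cube_measure LO)" "integrable (cube_measure LO) (\<lambda>x. (g x)\<^sup>2)"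
  shows "square_trig LO g"
proof -
  \<comment> \<open>Extension by zero gives a Borel function on the whole space, which the induction
    over Borel functions requires, and leaves integrals over the cube unchanged.\<close>
  define g1 where "g1 x = indicator (cube LO) x * g x" for x
  have g1: "g1 \<in> borel_measurable borel"
    using g(1) by (simp add: borel_measurable_restrict_space_iff g1_def[abs_def])
  have eq: "x \<in> cube LO \<Longrightarrow> g1 x = g x" for x by (simp add: g1_def)
  have i1: "integrable (cube_measure LO) (\<lambda>x. (g1 x)\<^sup>2)"
    using g(2) by (rule Bochner_Integration.integrable_cong[OF refl, THEN iffD1, rotated]) (simp add: eq)
  have i: "integrable (cube_measure LO) (\<lambda>x. (max 0 (g1 x))\<^sup>2)" "integrable (cube_measure LO) (\<lambda>x. (max 0 (- g1 x))\<^sup>2)"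
    by (rule Bochner_Integration.integrable_bound[OF i1];
        use g1 in \<open>auto simp: max_def intro!: measurable_cube_measure borel_measurable_power\<close>)+
  have "square_trig LO (\<lambda>x. max 0 (g1 x) + (- 1) * max 0 (- g1 x))"
    using g1 i assms by (intro square_trig_add square_trig_mult square_trig_nonneg) auto
  also have "(\<lambda>x. max 0 (g1 x) + (- 1) * max 0 (- g1 x)) = g1" by (auto simp: fun_eq_iff max_def)
  finally have "square_trig LO g1" .
  then show ?thesis
  proof (rule square_trig_limit[OF g, rotated, OF exI, OF conjI])
    have "(\<integral>x. (g x - g1 x)\<^sup>2 \<partial>cube_measure LO) = (\<integral>x. 0 \<partial>cube_measure LO)"
      by (rule Bochner_Integration.integral_cong) (auto simp: eq)
    then show "e > 0 \<Longrightarrow> (\<integral>x. (g x - g1 x)\<^sup>2 \<partial>cube_measure LO) \<le> e" for e by simp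
  qed
qed

text \<open>One half of Parseval's identity, up to \<open>e\<close>: density supplies an
  approximant, and \<open>K\<close> is its set of frequencies.\<close>

lemma L2_le_bessel_sum:
  assumes "LO > 0" and v: "v \<in> borel_measurable (cube_measure LO)" "integrable (cube_measure LO) (\<lambda>x. (v x)\<^sup>2)"
    and "e > 0"
  shows "\<exists>K. finite K \<and> LO ^ 3 * (\<integral>x. (v x)\<^sup>2 \<partial>cube_measure LO) \<le> e + (\<Sum>k\<in>K. (cmod (fourier_coeff LO v k))\<^sup>2)"
proof -
  have "e / LO ^ 3 > 0" using assms by simp
  then obtain p where p: "trig_poly LO p" "(\<integral>x. (v x - p x)\<^sup>2 \<partial>cube_measure LO) \<le> e / LO ^ 3"
    using square_trig_L2[OF assms(1) v] unfolding square_trig_def by blast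
  then obtain K c where K: "finite K" "\<And>x. of_real (p x) = (\<Sum>k\<in>K. c k * wave LO k x)"
    unfolding trig_poly_def by blast
  have "(cmod (of_real (v x) - (\<Sum>k\<in>K. c k * wave LO k x)))\<^sup>2 = (v x - p x)\<^sup>2" for x
    unfolding K(2)[symmetric] of_real_diff[symmetric] norm_of_real by simp
  then have "LO ^ 3 * (\<integral>x. (v x)\<^sup>2 \<partial>cube_measure LO)
      \<le> LO ^ 3 * (e / LO ^ 3) + (\<Sum>k\<in>K. (cmod (fourier_coeff LO v k))\<^sup>2)"
    using p by (intro trig_poly_approx_le_bessel_sum[OF assms(1) K(1) v, where c=c]) simp
  then show ?thesis using K assms by auto
qed

section \<open>The Poincare inequality for weak gradients\<close>

lemma L2_iff:
  "L2 LO v \<longleftrightarrow> v \<in> borel_measurable (cube_measure LO) \<and> integrable (cube_measure LO) (\<lambda>x. (norm (v x))\<^sup>2)"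
  by (simp add: L2_def set_borel_measurable_def set_integrable_def integrable_restrict_space
      borel_measurable_restrict_space_iff)

lemma L2_norm_square: "(L2_norm LO v)\<^sup>2 = (\<integral>x. (norm (v x))\<^sup>2 \<partial>cube_measure LO)"
  unfolding L2_norm_def set_integral_cube by simp

lemma borel_measurable_vec_nth [measurable (raw)]:
  fixes v :: "'a \<Rightarrow> 'b::euclidean_space^'n"
  assumes "v \<in> borel_measurable M" shows "(\<lambda>x. v x $ i) \<in> borel_measurable M"
  by (rule borel_measurable_continuous_on[OF _ assms]) (intro continuous_intros)

lemma integrable_square_nth:
  fixes v :: "'a \<Rightarrow> 'b::euclidean_space^'n"
  assumes "v \<in> borel_measurable M" "integrable M (\<lambda>x. (norm (v x))\<^sup>2)"
  shows "integrable M (\<lambda>x. (norm (v x $ i))\<^sup>2)"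
proof (rule Bochner_Integration.integrable_bound[OF assms(2)])
  show "(\<lambda>x. (norm (v x $ i))\<^sup>2) \<in> borel_measurable M" using assms(1) by measurable
  have "(norm (v x $ i))\<^sup>2 \<le> (norm (v x))\<^sup>2" for x
    by (intro power_mono Finite_Cartesian_Product.norm_nth_le) auto
  then show "AE x in M. norm ((norm (v x $ i))\<^sup>2) \<le> norm ((norm (v x))\<^sup>2)" by simp
qed

lemma integrable_square_nth2:
  fixes G :: "'a \<Rightarrow> real^'n^'m"
  assumes "G \<in> borel_measurable M" "integrable M (\<lambda>x. (norm (G x))\<^sup>2)"
  shows "integrable M (\<lambda>x. (G x $ i $ m)\<^sup>2)"
  using integrable_square_nth[OF borel_measurable_vec_nth[OF assms(1)] integrable_square_nth[OF assms]]
  by simp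

text \<open>A derivative along \<open>v\<close> multiplies by \<open>w \<bullet> v\<close> and
  shifts the phase by \<open>pi / 2\<close>. The family with free \<open>c\<close> and
  \<open>a\<close> is thus closed under derivatives, which is why both vary in the
  induction.\<close>

lemma Ck_on_cos: "Ck_on n S (\<lambda>x. c * cos (w \<bullet> x - a))"
proof (induction n arbitrary: c a)
  case 0
  show ?case by (auto intro!: continuous_intros)
next
  case (Suc n)
  have "((\<lambda>x. c * cos (w \<bullet> x - a)) has_derivative (\<lambda>v. c * (- sin (w \<bullet> x - a) * (w \<bullet> v)))) (at x within S)" for x
    by (auto intro!: derivative_eq_intros)
  moreover have "c * (- sin (w \<bullet> x - a) * (w \<bullet> v)) = c * (w \<bullet> v) * cos (w \<bullet> x - (a - pi / 2))" for x v
  proof -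
    have "w \<bullet> x - (a - pi / 2) = (w \<bullet> x - a) + pi / 2" by simp
    then show ?thesis by (simp only: cos_add) simp
  qed
  ultimately show ?case using Suc
    by (auto intro!: exI[of _ "\<lambda>x v. c * (- sin (w \<bullet> x - a) * (w \<bullet> v))"])
qed

lemma smooth_on_cos: "smooth_on S (\<lambda>x. cos (w \<bullet> x - a))"
  unfolding smooth_on_def using Ck_on_cos[of _ S 1] by simp

lemma periodic_cos_wave: "LO > 0 \<Longrightarrow> periodic LO (\<lambda>x. cos (wave_vector LO k \<bullet> x - a))"
proof -
  assume "LO > 0"
  have "cos (wave_vector LO k \<bullet> (x + LO *\<^sub>R axis i 1) - a) = cos (wave_vector LO k \<bullet> x - a)" for x i
  proof -
    have "wave_vector LO k \<bullet> (x + LO *\<^sub>R axis i 1) - a = (wave_vector LO k \<bullet> x - a) + 2 * pi * of_int (k $ i)"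
      using \<open>LO > 0\<close> by (simp add: inner_add_right inner_axis wave_vector_def)
    then show ?thesis by (simp only: cos_add) simp
  qed
  then show ?thesis unfolding periodic_def by blast
qed

lemma frechet_derivative_cos:
  "frechet_derivative (\<lambda>x. cos (w \<bullet> x - a)) (at x) (axis m 1) = - (w $ m) * sin (w \<bullet> x - a)"
    for w :: "real^'n"
proof -
  have "((\<lambda>x. cos (w \<bullet> x - a)) has_derivative (\<lambda>v. - sin (w \<bullet> x - a) * (w \<bullet> v))) (at x)"
    by (auto intro!: derivative_eq_intros)
  then show ?thesis by (simp flip: frechet_derivative_at add: inner_axis)
qed

text \<open>The real form of the coefficient is needed because weak gradients are tested with real
  functions.\<close>

lemma fourier_coeff_square:
  assumes "v \<in> borel_measurable (cube_measure LO)" "integrable (cube_measure LO) (\<lambda>x. (v x)\<^sup>2)"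
  shows "(cmod (fourier_coeff LO v k))\<^sup>2
    = (\<integral>x. v x * cos (wave_vector LO k \<bullet> x) \<partial>cube_measure LO)\<^sup>2
    + (\<integral>x. v x * sin (wave_vector LO k \<bullet> x) \<partial>cube_measure LO)\<^sup>2"
  using integrable_mult_wave[OF assms, of k] unfolding fourier_coeff_def cmod_power2
  by (simp flip: integral_Re integral_Im add: wave_def)

text \<open>Integration by parts exchanges the sine and the cosine integrals, up to sign and the
  factor \<open>w $ m\<close>; the squared modulus does not distinguish them.\<close>

lemma fourier_coeff_weak_gradient:
  assumes "LO > 0" and G: "weak_gradient LO v G"
  shows "(wave_vector LO k $ m)\<^sup>2 * (cmod (fourier_coeff LO (\<lambda>x. v x $ i) k))\<^sup>2
    = (cmod (fourier_coeff LO (\<lambda>x. G x $ i $ m) k))\<^sup>2"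
proof -
  have L: "L2 LO v" "L2 LO G" using G by (auto simp: weak_gradient_def)
  have m: "(\<lambda>x. v x $ i) \<in> borel_measurable (cube_measure LO)" "(\<lambda>x. G x $ i $ m) \<in> borel_measurable (cube_measure LO)"
    using L by (auto simp: L2_iff intro!: borel_measurable_vec_nth)
  have i: "integrable (cube_measure LO) (\<lambda>x. (v x $ i)\<^sup>2)" "integrable (cube_measure LO) (\<lambda>x. (G x $ i $ m)\<^sup>2)"
    using L integrable_square_nth[of v "cube_measure LO" i] integrable_square_nth2[of G "cube_measure LO" i m]
    unfolding L2_iff by (simp_all only: real_norm_def power2_abs)
  define w where "w = wave_vector LO k"
  have "(\<integral>x. v x $ i * (- (w $ m) * sin (w \<bullet> x - a)) \<partial>cube_measure LO)
      = - (\<integral>x. G x $ i $ m * cos (w \<bullet> x - a) \<partial>cube_measure LO)" for a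
  proof -
    have "(LINT x:cube LO|lborel. v x $ i * frechet_derivative (\<lambda>x. cos (w \<bullet> x - a)) (at x) (axis m 1))
        = - (LINT x:cube LO|lborel. G x $ i $ m * cos (w \<bullet> x - a))"
      using G smooth_on_cos[of UNIV w a] periodic_cos_wave[OF assms(1), of k a]
      unfolding weak_gradient_def w_def by blast
    then show ?thesis unfolding frechet_derivative_cos set_integral_cube .
  qed
  \<comment> \<open>The phases 0 and \<open>pi / 2\<close> test with the cosine and the sine of the
    same frequency.\<close>
  from this[of 0] this[of "pi / 2"]
  have "w $ m * (\<integral>x. v x $ i * sin (w \<bullet> x) \<partial>cube_measure LO) = (\<integral>x. G x $ i $ m * cos (w \<bullet> x) \<partial>cube_measure LO)"
    "w $ m * (\<integral>x. v x $ i * cos (w \<bullet> x) \<partial>cube_measure LO) = - (\<integral>x. G x $ i $ m * sin (w \<bullet> x) \<partial>cube_measure LO)"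
    by (simp_all add: sin_diff cos_diff mult.left_commute)
  then show ?thesis
    unfolding fourier_coeff_square[OF m(1) i(1)] fourier_coeff_square[OF m(2) i(2)] w_def[symmetric]
    by (simp add: distrib_left flip: power_mult_distrib)
qed

text \<open>The smallest nonzero frequency has length \<open>2 * pi / LO\<close>, whence the
  constant; zero mean removes the frequency 0.\<close>

theorem poincare_inequality:
  assumes "LO > 0" and G: "weak_gradient LO v G" and v0: "mean_zero LO v"
  shows "(L2_norm LO v)\<^sup>2 \<le> (LO / (2 * pi))\<^sup>2 * (L2_norm LO G)\<^sup>2"
proof -
  define M where "M = cube_measure LO"
  have L: "v \<in> borel_measurable M" "integrable M (\<lambda>x. (norm (v x))\<^sup>2)"
     "G \<in> borel_measurable M" "integrable M (\<lambda>x. (norm (G x))\<^sup>2)"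
    using G by (auto simp: weak_gradient_def L2_iff M_def)
  have m: "(\<lambda>x. v x $ i) \<in> borel_measurable M" "(\<lambda>x. G x $ i $ m) \<in> borel_measurable M" for i m
    using L by (auto intro!: borel_measurable_vec_nth)
  have i: "integrable M (\<lambda>x. (v x $ i)\<^sup>2)" "integrable M (\<lambda>x. (G x $ i $ m)\<^sup>2)" for i m
    using integrable_square_nth[OF L(1,2)] integrable_square_nth2[OF L(3,4)]
    by (simp_all only: real_norm_def power2_abs)
  have comp: "(\<integral>x. (v x $ i)\<^sup>2 \<partial>M) \<le> (LO / (2 * pi))\<^sup>2 * (\<Sum>m\<in>UNIV. \<integral>x. (G x $ i $ m)\<^sup>2 \<partial>M)" for i
  proof -
    define c where "c k = (cmod (fourier_coeff LO (\<lambda>x. v x $ i) k))\<^sup>2" for k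
    define d where "d m k = (cmod (fourier_coeff LO (\<lambda>x. G x $ i $ m) k))\<^sup>2" for m k
    have cd: "c k \<le> (LO / (2 * pi))\<^sup>2 * (\<Sum>m\<in>UNIV. d m k)" for k
    proof (cases "k = 0")
      case True
      have "integrable M v"
      proof (rule Bochner_Integration.integrable_bound[where f="\<lambda>x. 1 + (norm (v x))\<^sup>2"])
        interpret finite_measure M unfolding M_def by (rule finite_measure_cube)
        show "integrable M (\<lambda>x. 1 + (norm (v x))\<^sup>2)" using L by simp
        have "a \<le> 1 + a\<^sup>2" for a :: real
          using zero_le_power2[of "a - 1 / 2"] by (simp add: power2_eq_square algebra_simps)
        then show "AE x in M. norm (v x) \<le> norm (1 + (norm (v x))\<^sup>2)" by simp
      qed (rule L)
      then have "(\<integral>x. v x $ i \<partial>M) = (\<integral>x. v x \<partial>M) $ i"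
        by (rule integral_bounded_linear[OF bounded_linear_vec_nth])
      also have "\<dots> = 0" using v0 unfolding mean_zero_def set_integral_cube M_def by simp
      finally have "fourier_coeff LO (\<lambda>x. v x $ i) k = 0"
        unfolding fourier_coeff_def M_def True by simp
      then show ?thesis by (simp add: c_def d_def sum_nonneg)
    next
      case False
      then obtain m where "k $ m \<noteq> 0" by (auto simp: vec_eq_iff)
      \<comment> \<open>The spectral gap: a nonzero integer has modulus at least 1.\<close>
      then have "1 \<le> \<bar>k $ m\<bar>" by linarith
      then have "1 \<le> \<bar>real_of_int (k $ m)\<bar>" by linarith
      then have "1 \<le> (real_of_int (k $ m))\<^sup>2" by (metis one_le_power power2_abs)
      moreover have "(wave_vector LO k $ m)\<^sup>2 = (2 * pi / LO)\<^sup>2 * (real_of_int (k $ m))\<^sup>2"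
        unfolding wave_vector_def by (simp add: power_mult_distrib power_divide)
      ultimately have "(2 * pi / LO)\<^sup>2 \<le> (wave_vector LO k $ m)\<^sup>2"
        using mult_left_mono[of 1 "(real_of_int (k $ m))\<^sup>2" "(2 * pi / LO)\<^sup>2"] by simp
      then have "(2 * pi / LO)\<^sup>2 * c k \<le> (wave_vector LO k $ m)\<^sup>2 * c k"
        by (intro mult_right_mono) (auto simp: c_def)
      also have "\<dots> = d m k" unfolding c_def d_def by (rule fourier_coeff_weak_gradient[OF assms(1) G])
      also have "\<dots> \<le> (\<Sum>m\<in>UNIV. d m k)" by (rule member_le_sum) (auto simp: d_def)
      finally have "(LO / (2 * pi))\<^sup>2 * ((2 * pi / LO)\<^sup>2 * c k) \<le> (LO / (2 * pi))\<^sup>2 * (\<Sum>m\<in>UNIV. d m k)"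
        by (intro mult_left_mono) auto
      also have "(LO / (2 * pi))\<^sup>2 * ((2 * pi / LO)\<^sup>2 * c k) = c k"
        using assms(1) by (simp add: power_divide)
      finally show ?thesis .
    qed
    \<comment> \<open>Bessel's inequality bounds the gradient sums uniformly over finite
      \<open>K\<close>, so \<open>K\<close> may depend on the error \<open>e\<close>.\<close>
    have "LO ^ 3 * (\<integral>x. (v x $ i)\<^sup>2 \<partial>M)
        \<le> (LO / (2 * pi))\<^sup>2 * (LO ^ 3 * (\<Sum>m\<in>UNIV. \<integral>x. (G x $ i $ m)\<^sup>2 \<partial>M)) + e" if e: "e > 0" for e
    proof -
      obtain K where K: "finite K" "LO ^ 3 * (\<integral>x. (v x $ i)\<^sup>2 \<partial>M) \<le> e + (\<Sum>k\<in>K. c k)"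
        using L2_le_bessel_sum[OF assms(1) m(1)[of i, unfolded M_def] i(1)[of i, unfolded M_def] e]
        unfolding c_def M_def by blast
      have "(\<Sum>k\<in>K. c k) \<le> (\<Sum>k\<in>K. (LO / (2 * pi))\<^sup>2 * (\<Sum>m\<in>UNIV. d m k))"
        by (intro sum_mono cd)
      also have "\<dots> = (LO / (2 * pi))\<^sup>2 * (\<Sum>m\<in>UNIV. \<Sum>k\<in>K. d m k)"
        by (subst sum.swap) (simp add: sum_distrib_left)
      also have "\<dots> \<le> (LO / (2 * pi))\<^sup>2 * (\<Sum>m\<in>UNIV. LO ^ 3 * (\<integral>x. (G x $ i $ m)\<^sup>2 \<partial>M))"
        unfolding d_def M_def
        by (intro mult_left_mono sum_mono bessel_inequality assms(1) K(1)
            m(2)[unfolded M_def] i(2)[unfolded M_def]) simp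
      finally show ?thesis using K by (simp add: sum_distrib_left)
    qed
    then have "LO ^ 3 * (\<integral>x. (v x $ i)\<^sup>2 \<partial>M)
        \<le> (LO / (2 * pi))\<^sup>2 * (LO ^ 3 * (\<Sum>m\<in>UNIV. \<integral>x. (G x $ i $ m)\<^sup>2 \<partial>M))"
      by (rule field_le_epsilon)
    then have "LO ^ 3 * (\<integral>x. (v x $ i)\<^sup>2 \<partial>M)
        \<le> LO ^ 3 * ((LO / (2 * pi))\<^sup>2 * (\<Sum>m\<in>UNIV. \<integral>x. (G x $ i $ m)\<^sup>2 \<partial>M))"
      by (simp only: mult.left_commute)
    then show ?thesis using assms(1) by (simp only: mult_le_cancel_left_pos zero_less_power)
  qed
  have nv: "(norm (v x))\<^sup>2 = (\<Sum>i\<in>UNIV. (v x $ i)\<^sup>2)" for x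
    unfolding power2_norm_eq_inner by (simp only: inner_vec_def power2_eq_square inner_real_def)
  have nG: "(norm (G x))\<^sup>2 = (\<Sum>i\<in>UNIV. \<Sum>m\<in>UNIV. (G x $ i $ m)\<^sup>2)" for x
    unfolding power2_norm_eq_inner by (simp only: inner_vec_def power2_eq_square inner_real_def)
  have "(L2_norm LO v)\<^sup>2 = (\<Sum>i\<in>UNIV. \<integral>x. (v x $ i)\<^sup>2 \<partial>M)"
    unfolding L2_norm_square M_def[symmetric] nv by (rule Bochner_Integration.integral_sum) (rule i)
  also have "\<dots> \<le> (\<Sum>i\<in>UNIV. (LO / (2 * pi))\<^sup>2 * (\<Sum>m\<in>UNIV. \<integral>x. (G x $ i $ m)\<^sup>2 \<partial>M))"
    by (intro sum_mono comp)
  also have "\<dots> = (LO / (2 * pi))\<^sup>2 * (\<Sum>i\<in>UNIV. \<Sum>m\<in>UNIV. \<integral>x. (G x $ i $ m)\<^sup>2 \<partial>M)"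
    by (rule sum_distrib_left[symmetric])
  also have "(\<Sum>i\<in>UNIV. \<Sum>m\<in>UNIV. \<integral>x. (G x $ i $ m)\<^sup>2 \<partial>M) = (\<Sum>i\<in>UNIV. \<integral>x. (\<Sum>m\<in>UNIV. (G x $ i $ m)\<^sup>2) \<partial>M)"
    by (intro sum.cong refl Bochner_Integration.integral_sum[symmetric] i)
  also have "\<dots> = (L2_norm LO G)\<^sup>2"
    unfolding L2_norm_square M_def[symmetric] nG
    by (intro Bochner_Integration.integral_sum[symmetric] Bochner_Integration.integrable_sum i)
  finally show ?thesis .
qed

section \<open>Smooth data\<close>

lemma smooth_on_has_derivative:
  assumes "smooth_on UNIV v"
  obtains v' where "\<And>x. (v has_derivative v' x) (at x)" "\<And>w. continuous_on UNIV (\<lambda>x. v' x w)"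
proof -
  have "Ck_on (Suc 0) UNIV v" using assms unfolding smooth_on_def by blast
  then show ?thesis using that by auto
qed

lemma continuous_grad:
  assumes "smooth_on UNIV v" shows "continuous_on UNIV (grad v)"
proof -
  obtain v' where v': "\<And>x. (v has_derivative v' x) (at x)" "\<And>w. continuous_on UNIV (\<lambda>x. v' x w)"
    using smooth_on_has_derivative[OF assms] by blast
  have "grad v = (\<lambda>x. \<chi> i k. v' x (axis k 1) $ i)"
    by (rule ext) (simp add: grad_def jacobian_def matrix_def frechet_derivative_at[OF v'(1), symmetric])
  then show ?thesis by (auto intro!: continuous_on_vec_lambda continuous_intros v')
qed

text \<open>The derivative sees only the spatial part \<open>snd w\<close> of a direction, so each
  directional derivative is again constant in time and the induction applies to it.\<close>

lemma Ck_on_snd: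
  "Ck_on k UNIV v \<Longrightarrow> Ck_on k (S \<times> UNIV) (\<lambda>(t, x). v x)"
proof (induction k arbitrary: v)
  case 0
  then have "continuous_on (S \<times> UNIV) (\<lambda>z. v (snd z))"
    by (auto intro!: continuous_on_compose2[OF _ continuous_on_snd[OF continuous_on_id]])
  then show ?case by (simp add: case_prod_unfold)
next
  case (Suc k)
  then obtain v' where v': "\<And>x. (v has_derivative v' x) (at x)" "\<And>w. Ck_on k UNIV (\<lambda>x. v' x w)"
    by auto
  have "((\<lambda>(t, x). v x) has_derivative (\<lambda>w. v' (snd z) (snd w))) (at z within S \<times> UNIV)" for z
  proof -
    have "((\<lambda>z. v (snd z)) has_derivative (\<lambda>w. v' (snd z) (snd w))) (at z within S \<times> UNIV)"
      by (rule has_derivative_compose[OF has_derivative_snd[OF has_derivative_ident] v'(1)])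
    then show ?thesis by (simp add: case_prod_unfold)
  qed
  moreover have "Ck_on k (S \<times> UNIV) (\<lambda>z. v' (snd z) (snd w))" for w
    using Suc.IH[OF v'(2)[of "snd w"]] by (simp add: case_prod_unfold)
  ultimately show ?case by (auto intro!: exI[of _ "\<lambda>z w. v' (snd z) (snd w)"])
qed

text \<open>Lets a force serve as its own test field; this needs it to be divergence free, as the
  weak form contains no pressure.\<close>

lemma test_field_const: "admissible_data LO v \<Longrightarrow> test_field LO T (\<lambda>t. v)"
  unfolding test_field_def admissible_data_def smooth_on_def by (auto intro: Ck_on_snd)

lemma bounded_on_cube:
  fixes g :: "real^3 \<Rightarrow> 'b::real_normed_vector"
  assumes "continuous_on UNIV g" shows "\<exists>B. \<forall>x\<in>cube LO. norm (g x) \<le> B"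
proof -
  have "compact (g ` cbox 0 (vec LO))"
    by (intro compact_continuous_image compact_cbox continuous_on_subset[OF assms]) auto
  then obtain B where "\<forall>x\<in>cbox 0 (vec LO). norm (g x) \<le> B"
    using compact_imp_bounded by (force simp: bounded_iff)
  moreover have "cube LO \<subseteq> cbox 0 (vec LO)" by (simp add: cube_def box_subset_cbox)
  ultimately show ?thesis by blast
qed

lemma L2_continuous:
  fixes g :: "real^3 \<Rightarrow> 'b::euclidean_space"
  assumes "continuous_on UNIV g" shows "L2 LO g"
proof -
  interpret finite_measure "cube_measure LO" by (rule finite_measure_cube)
  have m: "g \<in> borel_measurable (cube_measure LO)"
    by (intro measurable_cube_measure borel_measurable_continuous_onI assms)
  obtain B where "\<forall>x\<in>cube LO. norm (g x) \<le> B" using bounded_on_cube[OF assms] by blast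
  then have "AE x in cube_measure LO. norm ((norm (g x))\<^sup>2) \<le> B\<^sup>2"
    by (intro AE_I2) (auto intro: power_mono)
  then show ?thesis unfolding L2_iff using m by (auto intro!: integrable_const_bound)
qed

text \<open>Where a continuous function is nonzero inside the cube, it is nonzero on a nonempty open
  set, and such a set is not negligible.\<close>

lemma AE_eq_0_imp_eq_0_on_cube:
  fixes g :: "real^3 \<Rightarrow> 'b::real_normed_vector"
  assumes g: "continuous_on UNIV g" and ae: "AE x in cube_measure LO. g x = 0" and "x \<in> cube LO"
  shows "g x = 0"
proof (rule ccontr)
  assume "g x \<noteq> 0"
  define S where "S = cube LO \<inter> (g -` (- {0}))"
  have "open S" unfolding S_def cube_def
    by (intro open_Int open_box open_vimage g) auto
  moreover have "x \<in> S" using assms(3) \<open>g x \<noteq> 0\<close> by (simp add: S_def)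
  ultimately have "\<not> negligible S" using open_not_negligible by blast
  moreover have "AE x in lborel. x \<notin> S"
    using ae by (simp add: AE_restrict_space_iff S_def)
  then have "S \<in> null_sets lborel"
    using AE_iff_null_sets[of S lborel] \<open>open S\<close> by simp
  then have "negligible S" unfolding negligible_iff_null_sets by (rule null_sets_completionI)
  ultimately show False by blast
qed

text \<open>A vanishing gradient on the open convex cube forces a constant, and zero mean forces
  this constant to be 0. It is the reason why the denominators of the length scale do not
  vanish.\<close>

lemma admissible_grad_zero:
  assumes "LO > 0" "admissible_data LO v" and ae: "AE x in cube_measure LO. grad v x = 0"
  shows "L2_norm LO v = 0"
proof -
  have sm: "smooth_on UNIV v" and mz: "mean_zero LO v" using assms by (auto simp: admissible_data_def)
  have "(v has_derivative (\<lambda>w. 0)) (at x within cube LO)" if "x \<in> cube LO" for x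
  proof -
    obtain v' where "(v has_derivative v') (at x)" using smooth_on_has_derivative[OF sm] by metis
    then have "(v has_derivative (\<lambda>w. grad v x *v w)) (at x)"
      unfolding grad_def using jacobian_works differentiableI by blast
    then show ?thesis
      using AE_eq_0_imp_eq_0_on_cube[OF continuous_grad[OF sm] ae that]
      by (simp add: has_derivative_at_withinI)
  qed
  then obtain c where c: "\<And>x. x \<in> cube LO \<Longrightarrow> v x = c"
    using has_derivative_zero_constant[of "cube LO" v] by (auto simp: cube_def)
  have "(\<integral>x. v x \<partial>cube_measure LO) = (\<integral>x. c \<partial>cube_measure LO)"
    by (rule Bochner_Integration.integral_cong) (auto simp: c)
  also have "\<dots> = LO ^ 3 *\<^sub>R c" using assms(1) by (simp add: measure_restrict_space measure_cube)
  finally have "c = 0" using mz assms(1) by (simp add: mean_zero_def set_integral_cube)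
  then have "(\<integral>x. (norm (v x))\<^sup>2 \<partial>cube_measure LO) = (\<integral>x. 0 \<partial>cube_measure LO)"
    by (intro Bochner_Integration.integral_cong) (auto simp: c)
  then show ?thesis by (simp add: L2_norm_def set_integral_cube)
qed

text \<open>\<open>real_of_ereal\<close> would send an infinite essential supremum to 0. Boundedness
  on the cube excludes the value \<open>\<infinity>\<close>, and positive volume excludes
  \<open>-\<infinity>\<close>.\<close>

lemma AE_norm_le_Linf_norm:
  fixes g :: "real^3 \<Rightarrow> 'b::euclidean_space"
  assumes "LO > 0" "continuous_on UNIV g"
  shows "AE x in cube_measure LO. norm (g x) \<le> Linf_norm LO g" "0 \<le> Linf_norm LO g"
proof -
  define e where "e = esssup (cube_measure LO) (\<lambda>x. ereal (norm (g x)))"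
  have m: "(\<lambda>x. ereal (norm (g x))) \<in> borel_measurable (cube_measure LO)"
    by (intro measurable_cube_measure borel_measurable_ereal borel_measurable_continuous_onI
        continuous_on_norm assms(2))
  obtain B where "\<forall>x\<in>cube LO. norm (g x) \<le> B" using bounded_on_cube[OF assms(2)] by blast
  then have "e \<le> ereal B" unfolding e_def by (intro esssup_I m AE_I2) simp
  moreover have "esssup (cube_measure LO) (\<lambda>x. 0 :: ereal) \<le> e"
    unfolding e_def by (intro esssup_AE_mono) auto
  then have "0 \<le> e" using assms(1)
    by (subst (asm) esssup_const) (auto simp: emeasure_restrict_space emeasure_cube)
  ultimately have e: "ereal (Linf_norm LO g) = e"
    unfolding Linf_norm_def e_def[symmetric] by (cases e) auto
  show "AE x in cube_measure LO. norm (g x) \<le> Linf_norm LO g"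
    using esssup_AE[of "\<lambda>x. ereal (norm (g x))" "cube_measure LO"] unfolding e_def[symmetric] e[symmetric] by simp
  show "0 \<le> Linf_norm LO g" using \<open>0 \<le> e\<close> unfolding e[symmetric] by simp
qed

lemma norm_tensor: "norm (tensor a b) = norm a * norm b"
proof -
  have "(norm (tensor a b))\<^sup>2 = (norm a * norm b)\<^sup>2"
    unfolding power_mult_distrib power2_norm_eq_inner
    by (simp add: tensor_def inner_vec_def sum_product mult_ac)
  then show ?thesis by simp
qed

section \<open>Algebra of ensemble averages\<close>

lemma ens_real: "ens J (\<phi> :: nat \<Rightarrow> real) = (\<Sum>j=1..J. \<phi> j) / real J"
  by (simp add: ens_def)

lemma ens_mono: "(\<And>j. j \<in> {1..J} \<Longrightarrow> \<phi> j \<le> \<psi> j) \<Longrightarrow> ens J \<phi> \<le> ens J (\<psi> :: nat \<Rightarrow> real)"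
  unfolding ens_real by (intro divide_right_mono sum_mono) auto

lemma ens_nonneg: "(\<And>j. j \<in> {1..J} \<Longrightarrow> 0 \<le> \<phi> j) \<Longrightarrow> 0 \<le> ens J (\<phi> :: nat \<Rightarrow> real)"
  unfolding ens_real by (intro divide_nonneg_nonneg sum_nonneg) auto

lemma ens_add: "ens J (\<lambda>j. \<phi> j + \<psi> j) = ens J \<phi> + ens J (\<psi> :: nat \<Rightarrow> real)"
  unfolding ens_real by (simp add: sum.distrib add_divide_distrib)

lemma ens_mult: "ens J (\<lambda>j. c * \<phi> j) = c * ens J (\<phi> :: nat \<Rightarrow> real)"
  unfolding ens_real by (simp add: sum_distrib_left)

lemma ens_const: "J \<ge> 1 \<Longrightarrow> ens J (\<lambda>j. c :: real) = c"
  unfolding ens_real by simp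

lemma fluct_magnitude_sq_nonneg: "0 \<le> fluct_magnitude_sq J u t x"
  unfolding fluct_magnitude_sq_def by (intro ens_nonneg) auto

text \<open>The variance is the second moment minus the square of the mean.\<close>

lemma fluct_magnitude_sq_le:
  assumes "J \<ge> 1"
  shows "fluct_magnitude_sq J u t x \<le> ens J (\<lambda>j. (norm (u j t x))\<^sup>2)"
proof -
  define m where "m = ens J (\<lambda>k. u k t x)"
  have sm: "(\<Sum>j=1..J. u j t x) = real J *\<^sub>R m" using assms by (simp add: m_def ens_def)
  have "(\<Sum>j=1..J. (norm (u j t x - m))\<^sup>2) = (\<Sum>j=1..J. (norm (u j t x))\<^sup>2) - 2 * ((\<Sum>j=1..J. u j t x) \<bullet> m) + real J * (m \<bullet> m)"
  proof -
    have "(norm (w - m))\<^sup>2 = (norm w)\<^sup>2 + m \<bullet> m - 2 * (w \<bullet> m)" for w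
      by (simp add: power2_norm_eq_inner inner_diff inner_commute)
    then show ?thesis by (simp add: sum.distrib sum_subtractf inner_sum_left sum_distrib_left)
  qed
  also have "\<dots> = (\<Sum>j=1..J. (norm (u j t x))\<^sup>2) - real J * (m \<bullet> m)" unfolding sm by simp
  also have "\<dots> \<le> (\<Sum>j=1..J. (norm (u j t x))\<^sup>2)" by simp
  finally show ?thesis
    unfolding fluct_magnitude_sq_def fluct_def m_def[symmetric] ens_real by (intro divide_right_mono) auto
qed

section \<open>Energy estimates\<close>

abbreviation time_measure :: "real \<Rightarrow> real measure" where
  "time_measure T \<equiv> restrict_space lborel {0..T}"

lemma set_integral_time:
  fixes g :: "real \<Rightarrow> 'b::{banach, second_countable_topology}"
  shows "(LINT t:{0..T}|lborel. g t) = integral\<^sup>L (time_measure T) g"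
  by (simp add: set_lebesgue_integral_def integral_restrict_space)

lemma space_time_measure [simp]: "space (time_measure T) = {0..T}"
  by (simp add: space_restrict_space)

lemma finite_measure_time: "finite_measure (time_measure T)"
  by (rule finite_measureI)
    (simp add: space_restrict_space emeasure_restrict_space emeasure_lborel_Icc_eq)

lemma measure_time: "T \<ge> 0 \<Longrightarrow> measure (time_measure T) {0..T} = T"
  by (simp add: measure_restrict_space)

lemma AE_time_measure: "(AE t in time_measure T. P t) \<longleftrightarrow> (AE t in lborel. t \<in> {0..T} \<longrightarrow> P t)"
  by (simp add: AE_restrict_space_iff)

lemma joint_measurable:
  fixes w :: "real \<Rightarrow> real^3 \<Rightarrow> 'b::euclidean_space"
  assumes "set_borel_measurable borel ({0..} \<times> UNIV) (\<lambda>(t, x). w t x)"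
  shows "(\<lambda>z. w (fst z) (snd z)) \<in> borel_measurable (time_measure T \<Otimes>\<^sub>M cube_measure LO)"
proof -
  have "(\<lambda>z. indicator ({0..} \<times> UNIV) z *\<^sub>R w (fst z) (snd z)) \<in> borel_measurable (borel :: (real \<times> (real^3)) measure)"
    using assms by (simp add: set_borel_measurable_def case_prod_unfold)
  moreover have "(\<lambda>z. (fst z, snd z)) \<in> time_measure T \<Otimes>\<^sub>M cube_measure LO \<rightarrow>\<^sub>M borel \<Otimes>\<^sub>M borel"
  proof (rule measurable_Pair)
    have "(\<lambda>x. x) \<in> time_measure T \<rightarrow>\<^sub>M borel" "(\<lambda>x. x) \<in> cube_measure LO \<rightarrow>\<^sub>M borel"
      by (rule measurable_restrict_space1, simp)+
    from measurable_compose[OF measurable_fst this(1)] measurable_compose[OF measurable_snd this(2)]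
    show "fst \<in> time_measure T \<Otimes>\<^sub>M cube_measure LO \<rightarrow>\<^sub>M borel"
      "snd \<in> time_measure T \<Otimes>\<^sub>M cube_measure LO \<rightarrow>\<^sub>M borel" .
  qed
  ultimately have "(\<lambda>z. indicator ({0..} \<times> UNIV) z *\<^sub>R w (fst z) (snd z))
      \<in> borel_measurable (time_measure T \<Otimes>\<^sub>M cube_measure LO)"
    unfolding prod.collapse borel_prod by (rule measurable_compose[rotated])
  then show ?thesis
    by (rule measurable_cong[THEN iffD1, rotated]) (auto simp: space_pair_measure)
qed

text \<open>The bridge from the extended-valued dissipation in the energy inequality to ordinary
  integrals. Finiteness leaves a null set of times at which the inner integral may take its default
  value 0.\<close>

lemma iterated_integral:
  fixes g :: "real \<Rightarrow> real^3 \<Rightarrow> real"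
  assumes m: "(\<lambda>z. g (fst z) (snd z)) \<in> borel_measurable (time_measure T \<Otimes>\<^sub>M cube_measure LO)"
    and nn: "\<And>t x. 0 \<le> g t x"
    and fin: "(\<integral>\<^sup>+t. (\<integral>\<^sup>+x. ennreal (g t x) \<partial>cube_measure LO) \<partial>time_measure T) < \<infinity>"
  shows "AE t in time_measure T. integrable (cube_measure LO) (g t)"
    and "integrable (time_measure T) (\<lambda>t. \<integral>x. g t x \<partial>cube_measure LO)"
    and "ennreal (\<integral>t. \<integral>x. g t x \<partial>cube_measure LO \<partial>time_measure T)
      = (\<integral>\<^sup>+t. (\<integral>\<^sup>+x. ennreal (g t x) \<partial>cube_measure LO) \<partial>time_measure T)"
proof -
  interpret M: finite_measure "cube_measure LO" by (rule finite_measure_cube)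
  have m': "case_prod g \<in> borel_measurable (time_measure T \<Otimes>\<^sub>M cube_measure LO)"
    using m by (simp add: case_prod_unfold)
  have gt: "g t \<in> borel_measurable (cube_measure LO)" if "t \<in> {0..T}" for t
    using measurable_compose[OF measurable_Pair1'[of t "time_measure T" "cube_measure LO"] m'] that by simp
  have mn: "(\<lambda>t. \<integral>\<^sup>+x. ennreal (g t x) \<partial>cube_measure LO) \<in> borel_measurable (time_measure T)"
    by (rule M.borel_measurable_nn_integral) (use m' in \<open>simp add: case_prod_unfold\<close>)
  have "AE t in time_measure T. (\<integral>\<^sup>+x. ennreal (g t x) \<partial>cube_measure LO) \<noteq> \<infinity>"
    by (rule nn_integral_PInf_AE[OF mn]) (use fin in auto)
  then have "AE t in time_measure T. integrable (cube_measure LO) (g t) \<and> 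
      (\<integral>\<^sup>+x. ennreal (g t x) \<partial>cube_measure LO) = ennreal (\<integral>x. g t x \<partial>cube_measure LO)"
  proof (rule AE_mp, intro AE_I2 impI)
    fix t assume t: "t \<in> space (time_measure T)" and "(\<integral>\<^sup>+x. ennreal (g t x) \<partial>cube_measure LO) \<noteq> \<infinity>"
    then have "integrable (cube_measure LO) (g t)"
      using gt nn by (intro integrableI_nonneg) (auto simp: less_top)
    then show "integrable (cube_measure LO) (g t) \<and> 
      (\<integral>\<^sup>+x. ennreal (g t x) \<partial>cube_measure LO) = ennreal (\<integral>x. g t x \<partial>cube_measure LO)"
      using nn by (simp add: nn_integral_eq_integral)
  qed
  then have i: "AE t in time_measure T. integrable (cube_measure LO) (g t)" 
    and eq: "AE t in time_measure T. (\<integral>\<^sup>+x. ennreal (g t x) \<partial>cube_measure LO) = ennreal (\<integral>x. g t x \<partial>cube_measure LO)"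
    by auto
  from i show "AE t in time_measure T. integrable (cube_measure LO) (g t)" .
  have nneq: "(\<integral>\<^sup>+t. (\<integral>\<^sup>+x. ennreal (g t x) \<partial>cube_measure LO) \<partial>time_measure T)
      = (\<integral>\<^sup>+t. ennreal (\<integral>x. g t x \<partial>cube_measure LO) \<partial>time_measure T)"
    by (rule nn_integral_cong_AE[OF eq])
  have mi: "(\<lambda>t. \<integral>x. g t x \<partial>cube_measure LO) \<in> borel_measurable (time_measure T)"
    by (rule M.borel_measurable_lebesgue_integral[OF m'])
  have nni: "0 \<le> (\<integral>x. g t x \<partial>cube_measure LO)" for t by (intro integral_nonneg_AE AE_I2 nn)
  show I: "integrable (time_measure T) (\<lambda>t. \<integral>x. g t x \<partial>cube_measure LO)"
    using fin nni unfolding nneq by (intro integrableI_nonneg mi) auto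
  show "ennreal (\<integral>t. \<integral>x. g t x \<partial>cube_measure LO \<partial>time_measure T)
      = (\<integral>\<^sup>+t. (\<integral>\<^sup>+x. ennreal (g t x) \<partial>cube_measure LO) \<partial>time_measure T)"
    unfolding nneq using nni by (intro nn_integral_eq_integral[symmetric] I) auto
qed

text \<open>Cauchy-Schwarz combined with Young's inequality of weight \<open>s\<close>, which comes
  from the square of \<open>s * norm a - norm b\<close>.\<close>

lemma L2_inner_le:
  assumes "L2 LO v" "L2 LO w" "s > 0"
  shows "\<bar>L2_inner LO v w\<bar> \<le> s / 2 * (L2_norm LO v)\<^sup>2 + (L2_norm LO w)\<^sup>2 / (2 * s)"
proof -
  have i: "integrable (cube_measure LO) (\<lambda>x. s / 2 * (norm (v x))\<^sup>2 + (norm (w x))\<^sup>2 / (2 * s))"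
    using assms by (auto simp: L2_iff)
  have pw: "\<bar>a \<bullet> b\<bar> \<le> s / 2 * (norm a)\<^sup>2 + (norm b)\<^sup>2 / (2 * s)" for a b :: 'a
  proof -
    have "0 \<le> (s * norm a - norm b)\<^sup>2 / (2 * s)" using assms by simp
    also have "\<dots> = s / 2 * (norm a)\<^sup>2 + (norm b)\<^sup>2 / (2 * s) - norm a * norm b"
      using assms by (simp add: field_simps power2_eq_square)
    finally show ?thesis using Cauchy_Schwarz_ineq2[of a b] by linarith
  qed
  have "\<bar>L2_inner LO v w\<bar> \<le> (\<integral>x. \<bar>v x \<bullet> w x\<bar> \<partial>cube_measure LO)"
    unfolding L2_inner_def set_integral_cube by (rule integral_abs_bound)
  also have "\<dots> \<le> (\<integral>x. s / 2 * (norm (v x))\<^sup>2 + (norm (w x))\<^sup>2 / (2 * s) \<partial>cube_measure LO)"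
    using assms(3) by (intro integral_mono' i pw) auto
  also have "\<dots> = s / 2 * (L2_norm LO v)\<^sup>2 + (L2_norm LO w)\<^sup>2 / (2 * s)"
    using assms unfolding L2_norm_square L2_iff by simp
  finally show ?thesis .
qed

lemma L2_norm_nonneg: "0 \<le> L2_norm LO v"
  unfolding L2_norm_def set_integral_cube by (simp add: integral_nonneg_AE)

lemma L2_inner_self: "L2_inner LO v v = (L2_norm LO v)\<^sup>2"
  unfolding L2_norm_square L2_inner_def set_integral_cube by (simp add: power2_norm_eq_inner)

section \<open>Energy balance of the individual realizations\<close>

locale ensemble_flow =
  fixes LO \<nu> \<mu> \<tau> :: real and J :: nat
    and u0 f :: "nat \<Rightarrow> real^3 \<Rightarrow> real^3"
    and u :: "nat \<Rightarrow> real \<Rightarrow> real^3 \<Rightarrow> real^3"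
    and Du :: "nat \<Rightarrow> real \<Rightarrow> real^3 \<Rightarrow> real^3^3"
  assumes pos: "LO > 0" "\<nu> > 0" "\<mu> > 0" "\<tau> > 0" "J \<ge> 1"
    and u0: "\<And>j. j \<in> {1..J} \<Longrightarrow> admissible_data LO (u0 j)"
    and f: "\<And>j. j \<in> {1..J} \<Longrightarrow> admissible_data LO (f j)"
    and sol: "weak_solution LO \<nu> \<mu> \<tau> J u0 f u Du"
begin

text \<open>Twice the kinetic energy, and not divided by the volume.\<close>

definition kinetic :: "nat \<Rightarrow> real \<Rightarrow> real" where
  "kinetic j t = (L2_norm LO (u j t))\<^sup>2"

definition dissip :: "nat \<Rightarrow> real \<Rightarrow> real" where
  "dissip j t = (\<integral>x. (\<nu> + nu_turb \<mu> \<tau> J u t x) * (norm (Du j t x))\<^sup>2 \<partial>cube_measure LO)"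

definition fluct_energy :: "real \<Rightarrow> real" where
  "fluct_energy t = (\<integral>x. fluct_magnitude_sq J u t x \<partial>cube_measure LO)"

lemma nu_turb_nonneg: "0 \<le> nu_turb \<mu> \<tau> J u t x"
  unfolding nu_turb_def using pos by (simp add: fluct_magnitude_sq_nonneg)

lemma kinetic_nonneg: "0 \<le> kinetic j t" by (simp add: kinetic_def)

lemma dissip_nonneg: "0 \<le> dissip j t"
  unfolding dissip_def using pos nu_turb_nonneg by (intro integral_nonneg_AE AE_I2) (simp add: add_nonneg_nonneg)

lemma fluct_energy_nonneg: "0 \<le> fluct_energy t"
  unfolding fluct_energy_def by (intro integral_nonneg_AE AE_I2 fluct_magnitude_sq_nonneg)

lemma in_solution_space: "j \<in> {1..J} \<Longrightarrow> solution_space LO (u j) (Du j)"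
  using sol unfolding weak_solution_def by blast

lemma u_L2: "j \<in> {1..J} \<Longrightarrow> t \<ge> 0 \<Longrightarrow> L2 LO (u j t)"
  using in_solution_space unfolding solution_space_def by blast

lemma f_L2: "j \<in> {1..J} \<Longrightarrow> L2 LO (f j)"
  using f unfolding admissible_data_def by blast

lemma u_joint: "j \<in> {1..J} \<Longrightarrow> (\<lambda>z. u j (fst z) (snd z)) \<in> borel_measurable (time_measure T \<Otimes>\<^sub>M cube_measure LO)"
  using in_solution_space unfolding solution_space_def by (intro joint_measurable) blast

lemma Du_joint: "j \<in> {1..J} \<Longrightarrow> (\<lambda>z. Du j (fst z) (snd z)) \<in> borel_measurable (time_measure T \<Otimes>\<^sub>M cube_measure LO)"
  using in_solution_space unfolding solution_space_def by (intro joint_measurable) blast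

lemma fluct_joint:
  "(\<lambda>z. fluct_magnitude_sq J u (fst z) (snd z)) \<in> borel_measurable (time_measure T \<Otimes>\<^sub>M cube_measure LO)"
proof -
  have "(\<lambda>z. fluct J u j (fst z) (snd z)) \<in> borel_measurable (time_measure T \<Otimes>\<^sub>M cube_measure LO)"
    if "j \<in> {1..J}" for j
    unfolding fluct_def ens_def
    by (intro borel_measurable_diff borel_measurable_scaleR borel_measurable_const borel_measurable_sum
        u_joint that)
  then show ?thesis
    unfolding fluct_magnitude_sq_def ens_real
    by (intro borel_measurable_divide borel_measurable_const borel_measurable_sum borel_measurable_power)
      (auto intro: measurable_compose[OF _ borel_measurable_norm])
qed

lemma kinetic_measurable: "j \<in> {1..J} \<Longrightarrow> kinetic j \<in> borel_measurable (time_measure T)"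
proof -
  assume j: "j \<in> {1..J}"
  interpret M: finite_measure "cube_measure LO" by (rule finite_measure_cube)
  have "(\<lambda>t. \<integral>x. (norm (u j t x))\<^sup>2 \<partial>cube_measure LO) \<in> borel_measurable (time_measure T)"
    by (rule M.borel_measurable_lebesgue_integral)
      (use u_joint[OF j] in \<open>auto simp: case_prod_unfold intro!: borel_measurable_power measurable_compose[OF _ borel_measurable_norm]\<close>)
  then show ?thesis unfolding kinetic_def[abs_def] L2_norm_square .
qed

lemma kinetic_integrable: "j \<in> {1..J} \<Longrightarrow> T > 0 \<Longrightarrow> integrable (time_measure T) (kinetic j)"
proof -
  assume j: "j \<in> {1..J}" and T: "T > 0"
  interpret finite_measure "time_measure T" by (rule finite_measure_time)
  obtain C where "AE t in time_measure T. L2_norm LO (u j t) \<le> C"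
    using in_solution_space[OF j] T unfolding solution_space_def AE_time_measure by blast
  then have "AE t in time_measure T. norm (kinetic j t) \<le> C\<^sup>2"
    by (rule AE_mp) (auto intro!: AE_I2 power_mono L2_norm_nonneg simp: kinetic_def)
  then show ?thesis by (rule integrable_const_bound) (rule kinetic_measurable[OF j])
qed

lemma fluct_integrable:
  assumes "t \<ge> 0"
  shows "integrable (cube_measure LO) (fluct_magnitude_sq J u t)" "fluct_energy t \<le> ens J (\<lambda>j. kinetic j t)"
proof -
  have um: "u j t \<in> borel_measurable (cube_measure LO)" if "j \<in> {1..J}" for j
    using u_L2[OF that assms] by (simp add: L2_iff)
  have i: "integrable (cube_measure LO) (\<lambda>x. ens J (\<lambda>j. (norm (u j t x))\<^sup>2))"
    unfolding ens_real using u_L2[OF _ assms] by (intro integrable_divide Bochner_Integration.integrable_sum) (auto simp: L2_iff)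
  have fm: "fluct_magnitude_sq J u t \<in> borel_measurable (cube_measure LO)"
    unfolding fluct_magnitude_sq_def[abs_def] fluct_def ens_def
    by (intro borel_measurable_scaleR borel_measurable_sum borel_measurable_power measurable_compose[OF _ borel_measurable_norm]
      borel_measurable_diff borel_measurable_const um) auto
  show I: "integrable (cube_measure LO) (fluct_magnitude_sq J u t)"
    by (rule Bochner_Integration.integrable_bound[OF i fm])
      (use fluct_magnitude_sq_le[OF pos(5)] fluct_magnitude_sq_nonneg in \<open>auto intro!: AE_I2 intro: order_trans[OF _ abs_ge_self]\<close>)
  have "fluct_energy t \<le> (\<integral>x. ens J (\<lambda>j. (norm (u j t x))\<^sup>2) \<partial>cube_measure LO)"
    unfolding fluct_energy_def by (intro integral_mono I i fluct_magnitude_sq_le pos)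
  also have "\<dots> = ens J (\<lambda>j. kinetic j t)"
    unfolding ens_real kinetic_def L2_norm_square
    using u_L2[OF _ assms] by (subst integral_divide_zero, subst Bochner_Integration.integral_sum) (auto simp: L2_iff)
  finally show "fluct_energy t \<le> ens J (\<lambda>j. kinetic j t)" .
qed

lemma fluct_energy_integrable:
  assumes "T > 0" shows "integrable (time_measure T) fluct_energy"
proof (rule Bochner_Integration.integrable_bound)
  interpret M: finite_measure "cube_measure LO" by (rule finite_measure_cube)
  show "integrable (time_measure T) (\<lambda>t. ens J (\<lambda>j. kinetic j t))"
    unfolding ens_real
    by (intro integrable_divide Bochner_Integration.integrable_sum kinetic_integrable[OF _ assms])
  show "fluct_energy \<in> borel_measurable (time_measure T)"
    unfolding fluct_energy_def[abs_def] 
    by (rule M.borel_measurable_lebesgue_integral) (use fluct_joint in \<open>simp add: case_prod_unfold\<close>)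
  show "AE t in time_measure T. norm (fluct_energy t) \<le> norm (ens J (\<lambda>j. kinetic j t))"
    using fluct_integrable(2) fluct_energy_nonneg by (auto intro!: AE_I2 intro: order_trans[OF _ abs_ge_self])
qed

text \<open>The right side of the energy inequality is a real number, so the extended dissipation
  integral is finite. This yields integrability in space at almost every time, and then in
  time.\<close>

lemma energy:
  assumes j: "j \<in> {1..J}" and T: "T > 0"
  shows "AE t in time_measure T. integrable (cube_measure LO) (\<lambda>x. (\<nu> + nu_turb \<mu> \<tau> J u t x) * (norm (Du j t x))\<^sup>2)"
    and "integrable (time_measure T) (dissip j)"
    and "kinetic j T / 2 + (\<integral>t. dissip j t \<partial>time_measure T)
      \<le> (L2_norm LO (u0 j))\<^sup>2 / 2 + (\<integral>t. L2_inner LO (f j) (u j t) \<partial>time_measure T)"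
proof -
  define g where "g t x = (\<nu> + nu_turb \<mu> \<tau> J u t x) * (norm (Du j t x))\<^sup>2" for t x
  define K where "K = (\<integral>\<^sup>+t. (\<integral>\<^sup>+x. ennreal (g t x) \<partial>cube_measure LO) \<partial>time_measure T)"
  define R where "R = (L2_norm LO (u0 j))\<^sup>2 / 2 + (\<integral>t. L2_inner LO (f j) (u j t) \<partial>time_measure T)"
  have m: "(\<lambda>z. g (fst z) (snd z)) \<in> borel_measurable (time_measure T \<Otimes>\<^sub>M cube_measure LO)"
    unfolding g_def nu_turb_def
    by (intro borel_measurable_times borel_measurable_add borel_measurable_const fluct_joint
        borel_measurable_power measurable_compose[OF _ borel_measurable_norm] Du_joint j)
  have nn: "0 \<le> g t x" for t x unfolding g_def using pos nu_turb_nonneg by (simp add: add_nonneg_nonneg)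
  have "energy_inequality LO \<nu> (nu_turb \<mu> \<tau> J u) (u0 j) (f j) (u j) (Du j) T"
    using sol j T unfolding weak_solution_def by blast
  then have E: "ereal (kinetic j T / 2) + enn2ereal K \<le> ereal R"
    unfolding energy_inequality_def K_def R_def g_def kinetic_def set_integral_time
    by (simp add: nn_integral_restrict_space)
  then have "K < \<infinity>" by (cases K) (auto simp: less_top[symmetric] top_ereal_def)
  note it = iterated_integral[OF m nn this[unfolded K_def]]
  show "AE t in time_measure T. integrable (cube_measure LO) (\<lambda>x. (\<nu> + nu_turb \<mu> \<tau> J u t x) * (norm (Du j t x))\<^sup>2)"
    using it(1) unfolding g_def .
  show "integrable (time_measure T) (dissip j)"
    using it(2) unfolding g_def dissip_def[abs_def] .
  have "K = ennreal (\<integral>t. dissip j t \<partial>time_measure T)"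
    using it(3) unfolding K_def g_def dissip_def by simp
  moreover have "0 \<le> (\<integral>t. dissip j t \<partial>time_measure T)" by (intro integral_nonneg_AE AE_I2 dissip_nonneg)
  ultimately show "kinetic j T / 2 + (\<integral>t. dissip j t \<partial>time_measure T)
      \<le> (L2_norm LO (u0 j))\<^sup>2 / 2 + (\<integral>t. L2_inner LO (f j) (u j t) \<partial>time_measure T)"
    using E unfolding R_def by (simp add: enn2ereal_ennreal)
qed

text \<open>The Poincare inequality at almost every time; of the total viscosity only \<nu> is kept,
  the turbulent part being nonnegative.\<close>

lemma kinetic_le_dissip:
  assumes j: "j \<in> {1..J}" and T: "T > 0"
  shows "(\<integral>t. kinetic j t \<partial>time_measure T) \<le> (LO / (2 * pi))\<^sup>2 / \<nu> * (\<integral>t. dissip j t \<partial>time_measure T)"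
proof -
  have "AE t in time_measure T. weak_gradient LO (u j t) (Du j t)"
    using in_solution_space[OF j] unfolding solution_space_def AE_time_measure
    by (auto elim!: eventually_mono)
  moreover have "AE t in time_measure T. t \<in> {0..T}" by (simp add: AE_time_measure)
  ultimately have "AE t in time_measure T. kinetic j t \<le> (LO / (2 * pi))\<^sup>2 / \<nu> * dissip j t"
    using energy(1)[OF j T]
  proof eventually_elim
    case (elim t)
    then have t: "t \<ge> 0" by simp
    have G: "L2 LO (Du j t)" using elim by (simp add: weak_gradient_def)
    have "kinetic j t \<le> (LO / (2 * pi))\<^sup>2 * (L2_norm LO (Du j t))\<^sup>2"
      unfolding kinetic_def using in_solution_space[OF j] t elim pos
      by (intro poincare_inequality) (auto simp: solution_space_def)
    also have "\<nu> * (L2_norm LO (Du j t))\<^sup>2 \<le> dissip j t"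
      unfolding dissip_def L2_norm_square integral_mult_right_zero[symmetric]
      using G elim pos nu_turb_nonneg
      by (intro integral_mono) (auto simp: L2_iff intro!: mult_right_mono)
    then have "(LO / (2 * pi))\<^sup>2 * (L2_norm LO (Du j t))\<^sup>2 \<le> (LO / (2 * pi))\<^sup>2 * (dissip j t / \<nu>)"
      using pos by (intro mult_left_mono) (auto simp: field_simps)
    finally show ?case by simp
  qed
  then have "(\<integral>t. kinetic j t \<partial>time_measure T) \<le> (\<integral>t. (LO / (2 * pi))\<^sup>2 / \<nu> * dissip j t \<partial>time_measure T)"
    using kinetic_integrable[OF j T] energy(2)[OF j T] by (intro integral_mono_AE) auto
  then show ?thesis by simp
qed

lemma work_le:
  assumes j: "j \<in> {1..J}" and T: "T > 0" and s: "s > 0"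
  shows "(\<integral>t. L2_inner LO (f j) (u j t) \<partial>time_measure T)
    \<le> s / 2 * T * (L2_norm LO (f j))\<^sup>2 + (\<integral>t. kinetic j t \<partial>time_measure T) / (2 * s)"
proof -
  interpret finite_measure "time_measure T" by (rule finite_measure_time)
  have i: "integrable (time_measure T) (\<lambda>t. s / 2 * (L2_norm LO (f j))\<^sup>2 + kinetic j t / (2 * s))"
    using kinetic_integrable[OF j T] by auto
  have "(\<integral>t. L2_inner LO (f j) (u j t) \<partial>time_measure T)
      \<le> (\<integral>t. s / 2 * (L2_norm LO (f j))\<^sup>2 + kinetic j t / (2 * s) \<partial>time_measure T)"
  \<comment> \<open>Integrability is established for the majorant alone; its nonnegativity covers
    the default value 0 of the other integral.\<close>
  proof (rule integral_mono'[OF i])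
    fix t assume "t \<in> space (time_measure T)"
    then show "L2_inner LO (f j) (u j t) \<le> s / 2 * (L2_norm LO (f j))\<^sup>2 + kinetic j t / (2 * s)"
      using L2_inner_le[OF f_L2[OF j] u_L2[OF j, of t] s] by (auto simp: kinetic_def)
    show "0 \<le> s / 2 * (L2_norm LO (f j))\<^sup>2 + kinetic j t / (2 * s)" using s kinetic_nonneg[of j t] by simp
  qed
  also have "\<dots> = s / 2 * T * (L2_norm LO (f j))\<^sup>2 + (\<integral>t. kinetic j t \<partial>time_measure T) / (2 * s)"
    using kinetic_integrable[OF j T] T by (simp add: measure_time)
  finally show ?thesis .
qed

lemma dissip_le:
  assumes "j \<in> {1..J}" "T > 0" "s > 0"
  shows "(\<integral>t. dissip j t \<partial>time_measure T) \<le> (L2_norm LO (u0 j))\<^sup>2 / 2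
    + s / 2 * T * (L2_norm LO (f j))\<^sup>2 + (\<integral>t. kinetic j t \<partial>time_measure T) / (2 * s)"
  using energy(3)[OF assms(1,2)] work_le[OF assms] kinetic_nonneg[of j T] by linarith

text \<open>With \<open>P\<close> as the weight of Young's inequality, the Poincare inequality absorbs half of the
  dissipation into the left side of the energy inequality.\<close>

lemma kinetic_bounds:
  assumes j: "j \<in> {1..J}"
  shows "\<exists>C\<ge>0. \<forall>T\<ge>1. (\<integral>t. kinetic j t \<partial>time_measure T) \<le> C * T \<and> kinetic j T \<le> C * T"
proof -
  define P where "P = (LO / (2 * pi))\<^sup>2 / \<nu>"
  have P: "P > 0" using pos by (simp add: P_def)
  define a b where "a = (L2_norm LO (u0 j))\<^sup>2" and "b = (L2_norm LO (f j))\<^sup>2"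
  have ab: "a \<ge> 0" "b \<ge> 0" by (auto simp: a_def b_def)
  define c where "c = a + P * b"
  have c: "c \<ge> 0" using P ab by (simp add: c_def)
  have 1: "(\<integral>t. kinetic j t \<partial>time_measure T) \<le> P * c * T \<and> kinetic j T \<le> 2 * c * T" if "T \<ge> 1" for T
  proof -
    define k where "k = (\<integral>t. kinetic j t \<partial>time_measure T)"
    define d where "d = (\<integral>t. dissip j t \<partial>time_measure T)"
    define w where "w = (\<integral>t. L2_inner LO (f j) (u j t) \<partial>time_measure T)"
    have T: "T > 0" using that by simp
    have d0: "0 \<le> d" unfolding d_def by (intro integral_nonneg_AE AE_I2 dissip_nonneg)
    have kd: "k \<le> P * d" using kinetic_le_dissip[OF j T] unfolding P_def k_def d_def .
    have w: "w \<le> P / 2 * T * b + k / (2 * P)" using work_le[OF j T P] unfolding w_def k_def b_def .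
    have e: "kinetic j T / 2 + d \<le> a / 2 + w" using energy(3)[OF j T] unfolding d_def w_def a_def .
    have "k / (2 * P) \<le> d / 2" using kd P by (simp add: divide_le_eq mult.commute)
    with e w have "kinetic j T / 2 + d / 2 \<le> a / 2 + P / 2 * T * b" by linarith
    \<comment> \<open>Here \<open>T \<ge> 1\<close> is used to absorb the initial energy
      \<open>a\<close> into \<open>a * T\<close>.\<close>
    moreover have "a / 2 + P / 2 * T * b \<le> c * T / 2"
      using mult_left_mono[OF that ab(1)] by (simp add: c_def algebra_simps)
    ultimately have 2: "kinetic j T + d \<le> c * T" by simp
    then have "d \<le> c * T" using kinetic_nonneg[of j T] by linarith
    then have "P * d \<le> P * (c * T)" using P by (intro mult_left_mono) auto
    moreover have "c * T \<ge> 0" using c T by simp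
    ultimately show ?thesis using kd 2 d0 unfolding k_def by (simp add: mult.assoc)
  qed
  define C where "C = P * c + 2 * c"
  have "C \<ge> 0" using P c by (simp add: C_def)
  moreover have "P * c * T \<le> C * T" "2 * c * T \<le> C * T" if "T \<ge> 1" for T
    using that P c by (auto intro!: mult_right_mono simp: C_def)
  ultimately show ?thesis using 1 by (meson order_trans)
qed

section \<open>The momentum balance tested with the force\<close>

lemma f_smooth: "j \<in> {1..J} \<Longrightarrow> smooth_on UNIV (f j)"
  using f unfolding admissible_data_def by blast

definition grad_bound :: real where
  "grad_bound = Max ((\<lambda>j. Linf_norm LO (grad (f j))) ` {1..J})"

lemma AE_grad_le:
  assumes j: "j \<in> {1..J}"
  shows "AE x in cube_measure LO. norm (grad (f j) x) \<le> grad_bound" "0 \<le> grad_bound"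
proof -
  have le: "Linf_norm LO (grad (f j)) \<le> grad_bound"
    unfolding grad_bound_def using j by (intro Max_ge) auto
  note a = AE_norm_le_Linf_norm[OF pos(1) continuous_grad[OF f_smooth[OF j]]]
  show "AE x in cube_measure LO. norm (grad (f j) x) \<le> grad_bound"
    using a(1) by eventually_elim (use le in linarith)
  show "0 \<le> grad_bound" using a(2) le by linarith
qed

text \<open>Young's inequality with the total viscosity as weight: one half is the dissipation
  itself. In the other half \<nu> keeps the mean square of the force gradient, whereas the turbulent
  viscosity is merely integrable in space and needs the uniform bound.\<close>

lemma viscous_term_le:
  assumes j: "j \<in> {1..J}" and t: "t \<ge> 0" and l: "l > 0"
    and i: "integrable (cube_measure LO) (\<lambda>x. (\<nu> + nu_turb \<mu> \<tau> J u t x) * (norm (Du j t x))\<^sup>2)"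
  shows "(\<integral>x. (\<nu> + nu_turb \<mu> \<tau> J u t x) * (Du j t x \<bullet> grad (f j) x) \<partial>cube_measure LO)
    \<le> l / 2 * dissip j t + (\<nu> * (L2_norm LO (grad (f j)))\<^sup>2 + \<mu> * \<tau> * grad_bound\<^sup>2 * fluct_energy t) / (2 * l)"
proof -
  define M where "M = cube_measure LO"
  define m where "m = fluct_magnitude_sq J u t"
  have m0: "0 \<le> m x" for x unfolding m_def by (rule fluct_magnitude_sq_nonneg)
  have im: "integrable M m" unfolding m_def M_def by (rule fluct_integrable(1)[OF t])
  have ig: "integrable M (\<lambda>x. (norm (grad (f j) x))\<^sup>2)"
    using L2_continuous[OF continuous_grad[OF f_smooth[OF j]]] by (simp add: L2_iff M_def)
  have nt: "nu_turb \<mu> \<tau> J u t x = \<mu> * \<tau> * m x" for x by (simp add: nu_turb_def m_def)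
  define h where "h x = l / 2 * ((\<nu> + \<mu> * \<tau> * m x) * (norm (Du j t x))\<^sup>2)
      + (\<nu> * (norm (grad (f j) x))\<^sup>2 + \<mu> * \<tau> * grad_bound\<^sup>2 * m x) / (2 * l)" for x
  have ih: "integrable M h"
    using i im ig unfolding h_def nt M_def[symmetric] by auto
  have pw: "(\<nu> + \<mu> * \<tau> * m x) * (Du j t x \<bullet> grad (f j) x) \<le> h x \<and> 0 \<le> h x"
    if "norm (grad (f j) x) \<le> grad_bound" for x
  proof -
    define w where "w = \<nu> + \<mu> * \<tau> * m x"
    have w: "0 \<le> w" unfolding w_def using pos m0 by simp
    define a b where "a = norm (Du j t x)" and "b = norm (grad (f j) x)"
    have "0 \<le> (l * a - b)\<^sup>2 / (2 * l)" using l by simp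
    also have "\<dots> = l / 2 * a\<^sup>2 + b\<^sup>2 / (2 * l) - a * b"
      using l by (simp add: field_simps power2_eq_square)
    finally have "Du j t x \<bullet> grad (f j) x \<le> l / 2 * a\<^sup>2 + b\<^sup>2 / (2 * l)"
      using Cauchy_Schwarz_ineq2[of "Du j t x" "grad (f j) x"] unfolding a_def b_def by linarith
    then have "w * (Du j t x \<bullet> grad (f j) x) \<le> w * (l / 2 * a\<^sup>2 + b\<^sup>2 / (2 * l))"
      using w by (rule mult_left_mono)
    also have "\<dots> = l / 2 * (w * a\<^sup>2) + (\<nu> * b\<^sup>2 + \<mu> * \<tau> * m x * b\<^sup>2) / (2 * l)"
      unfolding w_def by (simp add: algebra_simps add_divide_distrib)
    also have "\<dots> \<le> l / 2 * (w * a\<^sup>2) + (\<nu> * b\<^sup>2 + \<mu> * \<tau> * m x * grad_bound\<^sup>2) / (2 * l)"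
      using that pos m0[of x] l unfolding b_def
      by (intro add_left_mono divide_right_mono mult_left_mono power_mono) auto
    also have "\<dots> = h x" unfolding h_def w_def a_def b_def by (simp add: mult_ac)
    finally have "w * (Du j t x \<bullet> grad (f j) x) \<le> h x" .
    moreover have "0 \<le> h x"
      unfolding h_def w_def[symmetric] using l w pos m0[of x] by (intro add_nonneg_nonneg) auto
    ultimately show ?thesis unfolding w_def by blast
  qed
  have "(\<integral>x. (\<nu> + \<mu> * \<tau> * m x) * (Du j t x \<bullet> grad (f j) x) \<partial>M) \<le> (\<integral>x. h x \<partial>M)"
    using AE_grad_le(1)[OF j] unfolding M_def[symmetric]
    by (intro integral_mono_AE' ih; eventually_elim) (use pw in blast)+
  also have "\<dots> = l / 2 * dissip j t + (\<nu> * (L2_norm LO (grad (f j)))\<^sup>2 + \<mu> * \<tau> * grad_bound\<^sup>2 * fluct_energy t) / (2 * l)"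
    using i im ig
    unfolding h_def nt M_def[symmetric] dissip_def L2_norm_square fluct_energy_def m_def[symmetric] by simp
  finally show ?thesis unfolding nt M_def .
qed

text \<open>Paired with itself, the force gives the left side. Convection costs
  \<open>grad_bound\<close> times \<open>kinetic\<close>, by Cauchy-Schwarz for the Frobenius
  product. The values at the two ends of the time interval are left to
  \<open>force_work_le\<close>.\<close>

lemma momentum:
  assumes j: "j \<in> {1..J}" and T: "T > 0" and l: "l > 0"
  shows "T * (L2_norm LO (f j))\<^sup>2 \<le> L2_inner LO (u j T) (f j) - L2_inner LO (u0 j) (f j)
    + grad_bound * (\<integral>t. kinetic j t \<partial>time_measure T) + l / 2 * (\<integral>t. dissip j t \<partial>time_measure T)
    + (\<nu> * T * (L2_norm LO (grad (f j)))\<^sup>2 + \<mu> * \<tau> * grad_bound\<^sup>2 * (\<integral>t. fluct_energy t \<partial>time_measure T)) / (2 * l)"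
proof -
  interpret finite_measure "time_measure T" by (rule finite_measure_time)
  define I1 where "I1 = (\<integral>t. \<integral>x. tensor (u j t x) (u j t x) \<bullet> grad (f j) x \<partial>cube_measure LO \<partial>time_measure T)"
  define I2 where "I2 = (\<integral>t. \<integral>x. (\<nu> + nu_turb \<mu> \<tau> J u t x) * (Du j t x \<bullet> grad (f j) x) \<partial>cube_measure LO \<partial>time_measure T)"
  \<comment> \<open>A derivative within \<open>{0..T}\<close> is unique only on a nondegenerate
    interval, so \<open>T > 0\<close> matters.\<close>
  have vd: "vector_derivative (\<lambda>s. f j x) (at t within {0..T}) = 0" if "t \<in> {0..T}" for t x
    using T that by (intro vector_derivative_within_closed_interval) auto
  have "(\<integral>t. L2_inner LO (u j t) (\<lambda>x. vector_derivative (\<lambda>s. f j x) (at t within {0..T})) \<partial>time_measure T)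
      = (\<integral>t. 0 \<partial>time_measure T)"
    by (rule Bochner_Integration.integral_cong) (simp_all add: vd L2_inner_def)
  moreover have "weak_momentum LO \<nu> (nu_turb \<mu> \<tau> J u) (u0 j) (f j) (u j) (Du j) T"
    using sol j T unfolding weak_solution_def by blast
  ultimately have eq: "L2_inner LO (u j T) (f j) - I1 + I2 = L2_inner LO (u0 j) (f j) + T * (L2_norm LO (f j))\<^sup>2"
    using test_field_const[OF f[OF j], of T] T
    unfolding weak_momentum_def set_integral_time set_integral_cube I1_def I2_def L2_inner_self[symmetric]
    by (auto simp: measure_time)
  \<comment> \<open>Only the majorants are known to be integrable. Where the minorant is not, its integral is 0,
    which \<open>integral_mono'\<close> also covers because the majorants are nonnegative.\<close>
  have "- I1 = (\<integral>t. - (\<integral>x. tensor (u j t x) (u j t x) \<bullet> grad (f j) x \<partial>cube_measure LO) \<partial>time_measure T)"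
    unfolding I1_def by simp
  also have "\<dots> \<le> (\<integral>t. grad_bound * kinetic j t \<partial>time_measure T)"
  proof (rule integral_mono')
    show "integrable (time_measure T) (\<lambda>t. grad_bound * kinetic j t)" using kinetic_integrable[OF j T] by simp
    fix t assume "t \<in> space (time_measure T)"
    then have t: "t \<ge> 0" by simp
    have pw: "- (tensor (u j t x) (u j t x) \<bullet> grad (f j) x) \<le> grad_bound * (norm (u j t x))\<^sup>2"
      if "norm (grad (f j) x) \<le> grad_bound" for x
    proof -
      have "- (tensor (u j t x) (u j t x) \<bullet> grad (f j) x) \<le> norm (tensor (u j t x) (u j t x)) * norm (grad (f j) x)"
        using Cauchy_Schwarz_ineq2[of "tensor (u j t x) (u j t x)" "grad (f j) x"] by linarith
      also have "\<dots> \<le> (norm (u j t x))\<^sup>2 * grad_bound"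
        unfolding norm_tensor power2_eq_square using that by (intro mult_left_mono) auto
      finally show ?thesis by (simp add: mult.commute)
    qed
    have iu: "integrable (cube_measure LO) (\<lambda>x. grad_bound * (norm (u j t x))\<^sup>2)"
      using u_L2[OF j t] by (simp add: L2_iff)
    have "- (\<integral>x. tensor (u j t x) (u j t x) \<bullet> grad (f j) x \<partial>cube_measure LO)
        = (\<integral>x. - (tensor (u j t x) (u j t x) \<bullet> grad (f j) x) \<partial>cube_measure LO)" by simp
    also have "\<dots> \<le> (\<integral>x. grad_bound * (norm (u j t x))\<^sup>2 \<partial>cube_measure LO)"
    proof (rule integral_mono_AE'[OF iu])
      show "AE x in cube_measure LO. - (tensor (u j t x) (u j t x) \<bullet> grad (f j) x) \<le> grad_bound * (norm (u j t x))\<^sup>2"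
        using AE_grad_le(1)[OF j] by eventually_elim (rule pw)
      show "AE x in cube_measure LO. 0 \<le> grad_bound * (norm (u j t x))\<^sup>2"
        using AE_grad_le(2)[OF j] by simp
    qed
    also have "\<dots> = grad_bound * kinetic j t" unfolding kinetic_def L2_norm_square by simp
    finally show "- (\<integral>x. tensor (u j t x) (u j t x) \<bullet> grad (f j) x \<partial>cube_measure LO) \<le> grad_bound * kinetic j t" .
    show "0 \<le> grad_bound * kinetic j t" using AE_grad_le(2)[OF j] kinetic_nonneg by simp
  qed
  also have "\<dots> = grad_bound * (\<integral>t. kinetic j t \<partial>time_measure T)" by simp
  finally have 1: "- I1 \<le> grad_bound * (\<integral>t. kinetic j t \<partial>time_measure T)" .
  define h where "h t = l / 2 * dissip j t
      + (\<nu> * (L2_norm LO (grad (f j)))\<^sup>2 + \<mu> * \<tau> * grad_bound\<^sup>2 * fluct_energy t) / (2 * l)" for t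
  have ih: "integrable (time_measure T) h"
    unfolding h_def using energy(2)[OF j T] fluct_energy_integrable[OF T] by auto
  have "I2 \<le> (\<integral>t. h t \<partial>time_measure T)"
    unfolding I2_def
  proof (rule integral_mono_AE'[OF ih])
    have "AE t in time_measure T. t \<in> {0..T}" by (simp add: AE_time_measure)
    then show "AE t in time_measure T. (\<integral>x. (\<nu> + nu_turb \<mu> \<tau> J u t x) * (Du j t x \<bullet> grad (f j) x) \<partial>cube_measure LO) \<le> h t"
      using energy(1)[OF j T]
    proof eventually_elim
      case (elim t)
      then show ?case unfolding h_def by (intro viscous_term_le[OF j _ l]) auto
    qed
    show "AE t in time_measure T. 0 \<le> h t"
      unfolding h_def using l pos dissip_nonneg fluct_energy_nonneg
      by (intro AE_I2 add_nonneg_nonneg divide_nonneg_nonneg mult_nonneg_nonneg) auto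
  qed
  also have "\<dots> = l / 2 * (\<integral>t. dissip j t \<partial>time_measure T)
    + (\<nu> * T * (L2_norm LO (grad (f j)))\<^sup>2 + \<mu> * \<tau> * grad_bound\<^sup>2 * (\<integral>t. fluct_energy t \<partial>time_measure T)) / (2 * l)"
    unfolding h_def using energy(2)[OF j T] fluct_energy_integrable[OF T] T by (simp add: measure_time mult_ac)
  finally show ?thesis using 1 eq by linarith
qed

text \<open>Young's inequality with the weight \<open>1 / sqrt T\<close> makes the boundary terms \<open>o(T)\<close>, although the
  energy estimate only shows that \<open>\<parallel>u(T)\<parallel>\<^sup>2\<close> grows at most linearly.\<close>

lemma force_work_le:
  assumes j: "j \<in> {1..J}"
  shows "\<exists>C. \<forall>T\<ge>1. \<bar>L2_inner LO (u j T) (f j)\<bar> + \<bar>L2_inner LO (u0 j) (f j)\<bar> \<le> C * sqrt T"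
proof -
  obtain C where C: "C \<ge> 0" "\<And>T. T \<ge> 1 \<Longrightarrow> kinetic j T \<le> C * T" using kinetic_bounds[OF j] by blast
  define b d where "b = (L2_norm LO (f j))\<^sup>2" and "d = \<bar>L2_inner LO (u0 j) (f j)\<bar>"
  have "\<bar>L2_inner LO (u j T) (f j)\<bar> + d \<le> (C / 2 + b / 2 + d) * sqrt T" if "T \<ge> 1" for T
  proof -
    have s: "sqrt T > 0" "sqrt T * sqrt T = T" "1 \<le> sqrt T" using that by auto
    have "\<bar>L2_inner LO (u j T) (f j)\<bar> \<le> (1 / sqrt T) / 2 * kinetic j T + b / (2 * (1 / sqrt T))"
      unfolding kinetic_def b_def using that s by (intro L2_inner_le u_L2 f_L2 j) auto
    also have "(1 / sqrt T) / 2 * kinetic j T \<le> (1 / sqrt T) / 2 * (C * T)"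
      using C(2)[OF that] s by (intro mult_left_mono) auto
    also have "(1 / sqrt T) / 2 * (C * T) = C / 2 * sqrt T" using that s by (simp add: divide_eq_eq mult.assoc)
    also have "b / (2 * (1 / sqrt T)) = b / 2 * sqrt T" by simp
    finally have "\<bar>L2_inner LO (u j T) (f j)\<bar> \<le> C / 2 * sqrt T + b / 2 * sqrt T" by simp
    moreover have "d \<le> d * sqrt T" using s mult_left_mono[OF s(3), of d] by (simp add: d_def)
    ultimately show ?thesis by (simp add: algebra_simps)
  qed
  then show ?thesis unfolding d_def by blast
qed

end

section \<open>Long-time limits\<close>

text \<open>Boundedness makes the limit superior a real number; the eventual bound
  \<open>A T < a + d\<close> is the form in which it is used.\<close>

lemma Limsup_bounded_real:
  fixes A :: "real \<Rightarrow> real"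
  assumes "\<forall>\<^sub>F T in at_top. 0 \<le> A T \<and> A T \<le> C"
  shows "\<exists>a\<ge>0. Limsup at_top (\<lambda>T. ereal (A T)) = ereal a \<and> (\<forall>d>0. \<forall>\<^sub>F T in at_top. A T < a + d)"
proof -
  define l where "l = Limsup at_top (\<lambda>T. ereal (A T))"
  have "l \<le> ereal C" unfolding l_def
    by (rule Limsup_bounded) (use assms in eventually_elim, simp)
  moreover have "0 \<le> l" unfolding l_def
    by (rule le_Limsup) (use assms in \<open>auto elim: eventually_mono\<close>)
  ultimately obtain a where a: "l = ereal a" "a \<ge> 0" by (cases l) auto
  have "\<forall>\<^sub>F T in at_top. A T < a + d" if "d > 0" for d
  proof -
    have "Limsup at_top (\<lambda>T. ereal (A T)) < ereal (a + d)" using a that unfolding l_def by simp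
    from Limsup_lessD[OF this] show ?thesis by simp
  qed
  then show ?thesis using a unfolding l_def by blast
qed

text \<open>In \<open>h2\<close> the left side is constant, so one late time at which all eventual
  bounds hold is enough. In \<open>h1\<close> the dissipation stands on the left, and the estimate
  has to hold at all late times.\<close>

lemma limsup_inequalities:
  fixes A D P r1 r2 :: "real \<Rightarrow> real"
  assumes A: "\<And>T. T \<ge> 1 \<Longrightarrow> 0 \<le> A T \<and> A T \<le> C" and P: "\<And>T. T \<ge> 1 \<Longrightarrow> 0 \<le> P T \<and> P T \<le> A T"
    and D: "\<And>T. T \<ge> 1 \<Longrightarrow> 0 \<le> D T"
    and r1: "(r1 \<longlongrightarrow> 0) at_top" and r2: "(r2 \<longlongrightarrow> 0) at_top"
    and h1: "\<And>T s. T \<ge> 1 \<Longrightarrow> s > 0 \<Longrightarrow> D T \<le> r1 T + s / 2 * F\<^sup>2 + A T / (2 * s)"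
    and h2: "\<And>T l. T \<ge> 1 \<Longrightarrow> l > 0 \<Longrightarrow> F\<^sup>2 \<le> r2 T + N * A T + l / 2 * D T + (g + c * P T) / (2 * l)"
    and nn: "0 \<le> N" "0 \<le> c"
  obtains a p e where "0 \<le> a" "0 \<le> p" "0 \<le> e"
    "Limsup at_top (\<lambda>T. ereal (A T)) = ereal a"
    "Limsup at_top (\<lambda>T. ereal (P T)) = ereal p"
    "Limsup at_top (\<lambda>T. ereal (D T)) = ereal e"
    "\<And>s. s > 0 \<Longrightarrow> e \<le> s / 2 * F\<^sup>2 + a / (2 * s)"
    "\<And>l. l > 0 \<Longrightarrow> F\<^sup>2 \<le> N * a + l / 2 * e + (g + c * p) / (2 * l)"
proof -
  have ev1: "\<forall>\<^sub>F T in at_top. T \<ge> (1::real)" by (rule eventually_ge_at_top)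
  have r1s: "\<forall>\<^sub>F T in at_top. r1 T < d" and r2s: "\<forall>\<^sub>F T in at_top. r2 T < d" if "d > 0" for d
    using r1 r2 that by (auto intro: order_tendstoD(2))
  have "\<forall>\<^sub>F T in at_top. 0 \<le> A T \<and> A T \<le> C" using ev1 by eventually_elim (rule A)
  then obtain a where a: "a \<ge> 0" "Limsup at_top (\<lambda>T. ereal (A T)) = ereal a"
      "\<And>d. d > 0 \<Longrightarrow> \<forall>\<^sub>F T in at_top. A T < a + d"
    using Limsup_bounded_real by blast
  have "\<forall>\<^sub>F T in at_top. 0 \<le> P T \<and> P T \<le> C" using ev1 by eventually_elim (use A P in force)
  then obtain p where p: "p \<ge> 0" "Limsup at_top (\<lambda>T. ereal (P T)) = ereal p"
      "\<And>d. d > 0 \<Longrightarrow> \<forall>\<^sub>F T in at_top. P T < p + d"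
    using Limsup_bounded_real by blast
  \<comment> \<open>The hypotheses give no upper bound for \<open>D\<close> directly;
    \<open>h1\<close> with weight 1 provides it.\<close>
  have "\<forall>\<^sub>F T in at_top. 0 \<le> D T \<and> D T \<le> 1 + 1 / 2 * F\<^sup>2 + C / 2"
    using ev1 r1s[of 1, simplified]
  proof eventually_elim
    case (elim T)
    then show ?case using h1[of T 1] D[of T] A[of T] by auto
  qed
  then obtain e where e: "e \<ge> 0" "Limsup at_top (\<lambda>T. ereal (D T)) = ereal e"
      "\<And>d. d > 0 \<Longrightarrow> \<forall>\<^sub>F T in at_top. D T < e + d"
    using Limsup_bounded_real by blast
  have E: "e \<le> s / 2 * F\<^sup>2 + a / (2 * s)" if s: "s > 0" for s
  proof (rule field_le_epsilon)
    fix d :: real assume d: "d > 0"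
    \<comment> \<open>Half of \<open>d\<close> pays for \<open>r1\<close>; an excess of
      \<open>d * s\<close> in the velocity average costs the other half after division by
      \<open>2 * s\<close>.\<close>
    have d2: "d / 2 > 0" "d * s > 0" using d s by auto
    have "\<forall>\<^sub>F T in at_top. ereal (D T) \<le> ereal (s / 2 * F\<^sup>2 + a / (2 * s) + d)"
      using ev1 r1s[OF d2(1)] a(3)[OF d2(2)]
    proof eventually_elim
      case (elim T)
      have "A T / (2 * s) \<le> (a + d * s) / (2 * s)" using elim s by (intro divide_right_mono) auto
      also have "\<dots> = a / (2 * s) + d / 2" using s by (simp add: add_divide_distrib)
      finally show ?case using h1[OF elim(1) s] elim by simp
    qed
    then have "ereal e \<le> ereal (s / 2 * F\<^sup>2 + a / (2 * s) + d)"
      unfolding e(2)[symmetric] by (rule Limsup_bounded)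
    then show "e \<le> s / 2 * F\<^sup>2 + a / (2 * s) + d" by simp
  qed
  have G: "F\<^sup>2 \<le> N * a + l / 2 * e + (g + c * p) / (2 * l)" if l: "l > 0" for l
  proof (rule field_le_epsilon)
    fix d :: real assume d: "d > 0"
    \<comment> \<open>The sum of the factors with which an error \<open>h\<close> in each of
      \<open>r2\<close>, \<open>A\<close>, \<open>D\<close> and \<open>P\<close> enters.\<close>
    define K where "K = 1 + N + l / 2 + c / (2 * l)"
    have "0 \<le> c / (2 * l)" using nn l by simp
    then have K: "K > 0" using nn l unfolding K_def by linarith
    define h where "h = d / K"
    have h: "h > 0" "h * K = d" using d K by (auto simp: h_def)
    have "\<forall>\<^sub>F T in at_top. T \<ge> 1 \<and> r2 T < h \<and> A T < a + h \<and> P T < p + h \<and> D T < e + h"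
      using ev1 r2s[OF h(1)] a(3)[OF h(1)] p(3)[OF h(1)] e(3)[OF h(1)] by eventually_elim auto
    then obtain T where T: "T \<ge> 1" "r2 T < h" "A T < a + h" "P T < p + h" "D T < e + h"
      using eventually_happens'[of at_top] by (metis (no_types, lifting) trivial_limit_at_top_linorder)
    have "F\<^sup>2 \<le> r2 T + N * A T + l / 2 * D T + (g + c * P T) / (2 * l)" by (rule h2[OF T(1) l])
    also have "\<dots> \<le> h + N * (a + h) + l / 2 * (e + h) + (g + c * (p + h)) / (2 * l)"
      using T nn l by (intro add_mono mult_left_mono divide_right_mono) auto
    also have "\<dots> = N * a + l / 2 * e + (g + c * p) / (2 * l) + h * K"
      unfolding K_def by (simp add: algebra_simps add_divide_distrib)
    finally show "F\<^sup>2 \<le> N * a + l / 2 * e + (g + c * p) / (2 * l) + d" unfolding h(2) .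
  qed
  show ?thesis by (rule that[OF a(1) p(1) e(1) a(2) p(2) e(2) E G])
qed

text \<open>Multiplied by \<open>U / F\<close>, inequality \<open>G\<close> has \<open>U * F\<close>
  on the left, which dominates \<open>e\<close> by \<open>E\<close>. On the right \<open>F\<close>
  cancels, because \<open>N\<close> is at most \<open>F / L\<close> and \<open>g\<close> at most its
  square.\<close>

lemma dissipation_algebra:
  fixes F L U N g c e p \<nu> \<alpha> :: real
  assumes pos: "F > 0" "L > 0" "U \<ge> 0" "\<nu> > 0" "c \<ge> 0" "p \<ge> 0" and \<alpha>: "0 < \<alpha>" "\<alpha> < 1"
    and N: "0 \<le> N" "N \<le> F / L" and g: "0 \<le> g" "g \<le> (F / L)\<^sup>2"
    and E: "\<And>s. s > 0 \<Longrightarrow> e \<le> s / 2 * F\<^sup>2 + U\<^sup>2 / (2 * s)"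
    and G: "\<And>l. l > 0 \<Longrightarrow> F\<^sup>2 \<le> N * U\<^sup>2 + l / 2 * e + (\<nu> * g + c * N\<^sup>2 * p) / (2 * l)"
  shows "(1 - \<alpha>) * e \<le> U ^ 3 / L + U\<^sup>2 * (\<nu> + c * p) / (4 * \<alpha> * L\<^sup>2)"
proof (cases "U = 0")
  \<comment> \<open>For \<open>U = 0\<close> the asserted bound is 0, and \<open>E\<close> with
    arbitrarily small weights leaves \<open>e \<le> 0\<close>.\<close>
  case True
  have "e \<le> 0 + d" if "d > 0" for d
    using E[of "2 * d / F\<^sup>2"] that pos True by simp
  then have "e \<le> 0" by (rule field_le_epsilon)
  then show ?thesis using True \<alpha> by (simp add: mult_nonneg_nonpos)
next
  case False
  then have U: "U > 0" using pos by simp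
  \<comment> \<open>The weight \<open>U / F\<close> minimises the right side of
    \<open>E\<close>.\<close>
  have eUF: "e \<le> U * F"
    using E[of "U / F"] U pos by (simp add: power2_eq_square mult.commute)
  \<comment> \<open>this weight turns the term \<open>l / 2 * e\<close>, multiplied by \<open>U / F\<close>, into \<open>\<alpha> * e\<close>\<close>
  define l where "l = 2 * \<alpha> * F / U"
  have l: "l > 0" using U pos \<alpha> by (simp add: l_def)
  have N2: "N\<^sup>2 \<le> (F / L)\<^sup>2" using N by (intro power_mono) auto
  have "\<nu> * g + c * N\<^sup>2 * p \<le> \<nu> * (F / L)\<^sup>2 + c * (F / L)\<^sup>2 * p"
    using g N2 pos by (intro add_mono mult_left_mono mult_right_mono) auto
  also have "\<dots> = (F / L)\<^sup>2 * (\<nu> + c * p)"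
    by (simp only: distrib_left mult.commute[of "(F / L)\<^sup>2"]) (simp only: mult.assoc mult.commute[of "(F / L)\<^sup>2"])
  finally have "(\<nu> * g + c * N\<^sup>2 * p) / (2 * l) \<le> (F / L)\<^sup>2 * (\<nu> + c * p) / (2 * l)"
    using l by (intro divide_right_mono) auto
  moreover have "N * U\<^sup>2 \<le> F / L * U\<^sup>2" using N by (intro mult_right_mono) auto
  ultimately have "F\<^sup>2 \<le> F / L * U\<^sup>2 + l / 2 * e + (F / L)\<^sup>2 * (\<nu> + c * p) / (2 * l)"
    using G[OF l] by linarith
  then have "U / F * F\<^sup>2 \<le> U / F * (F / L * U\<^sup>2 + l / 2 * e + (F / L)\<^sup>2 * (\<nu> + c * p) / (2 * l))"
    using U pos by (intro mult_left_mono) auto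
  also have "U / F * F\<^sup>2 = U * F" using pos by (simp add: power2_eq_square)
  also have "U / F * (F / L * U\<^sup>2 + l / 2 * e + (F / L)\<^sup>2 * (\<nu> + c * p) / (2 * l))
      = U / F * (F / L * U\<^sup>2) + U / F * (l / 2 * e) + U / F * ((F / L)\<^sup>2 * (\<nu> + c * p) / (2 * l))"
    by (simp only: distrib_left)
  also have "U / F * (F / L * U\<^sup>2) = U ^ 3 / L" using pos by (simp add: power2_eq_square power3_eq_cube)
  also have "U / F * (l / 2 * e) = \<alpha> * e" using pos U by (simp add: l_def)
  also have "U / F * ((F / L)\<^sup>2 * (\<nu> + c * p) / (2 * l)) = U\<^sup>2 * (\<nu> + c * p) / (4 * \<alpha> * L\<^sup>2)"
    using pos U \<alpha> by (simp add: l_def power2_eq_square mult_ac)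
  finally show ?thesis using eUF by (simp add: algebra_simps)
qed

text \<open>The factor \<open>U ^ 3\<close> cancels every \<open>U\<close> in a denominator. For
  \<open>U = 0\<close> both sides are 0, division by zero having the value 0.\<close>

lemma bound_algebra:
  fixes L U U' \<nu> \<mu> \<tau> \<alpha> :: real
  assumes "L > 0" "U \<ge> 0" "\<nu> > 0" "0 < \<alpha>" "\<alpha> < 1"
  shows "(1 / (1 - \<alpha>) + 1 / (4 * \<alpha> * (1 - \<alpha>)) * inverse (L * U / \<nu>)
           + \<mu> / (4 * \<alpha> * (1 - \<alpha>)) * (\<tau> / (L / U)) * (U' / U)\<^sup>2) * (U ^ 3 / L)
    = (U ^ 3 / L + U\<^sup>2 * (\<nu> + \<mu> * \<tau> * U'\<^sup>2) / (4 * \<alpha> * L\<^sup>2)) / (1 - \<alpha>)"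
proof (cases "U = 0")
  case False
  define b where "b = 1 - \<alpha>"
  have "b \<noteq> 0" "L \<noteq> 0" "\<alpha> \<noteq> 0" "\<nu> \<noteq> 0" using assms by (auto simp: b_def)
  then show ?thesis using False unfolding b_def[symmetric]
    by (simp add: field_simps power2_eq_square power3_eq_cube)
qed simp

lemma time_avg_ens:
  assumes "\<And>j. j \<in> {1..J} \<Longrightarrow> integrable (time_measure T) (\<phi> j)"
  shows "time_avg T (\<lambda>t. ens J (\<lambda>j. c * \<phi> j t)) = ens J (\<lambda>j. c * (1 / T * (\<integral>t. \<phi> j t \<partial>time_measure T)))"
proof -
  have "(\<integral>t. ens J (\<lambda>j. c * \<phi> j t) \<partial>time_measure T) = ens J (\<lambda>j. c * (\<integral>t. \<phi> j t \<partial>time_measure T))"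
    unfolding ens_real using assms by simp
  then have "time_avg T (\<lambda>t. ens J (\<lambda>j. c * \<phi> j t)) = 1 / T * ens J (\<lambda>j. c * (\<integral>t. \<phi> j t \<partial>time_measure T))"
    unfolding time_avg_def set_integral_time by simp
  then show ?thesis unfolding ens_mult[symmetric] by (simp add: mult.left_commute)
qed

section \<open>Averages over the ensemble and over time, and their limits\<close>

context ensemble_flow
begin

definition vol :: real where "vol = measure lborel (cube LO)"

lemma vol_pos: "vol > 0"
  using pos by (simp add: vol_def measure_cube)

text \<open>Matches the quantity that defines \<open>U'\<close> with the fluctuation energy that the
  turbulent viscosity produces. Each realization is at most \<open>J\<close> times the ensemble
  mean, hence integrable.\<close>

lemma fluct_norms:
  assumes t: "t \<ge> 0"
  shows "ens J (\<lambda>j. 1 / vol * (L2_norm LO (fluct J u j t))\<^sup>2) = 1 / vol * fluct_energy t"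
proof -
  have um: "u j t \<in> borel_measurable (cube_measure LO)" if "j \<in> {1..J}" for j
    using u_L2[OF that t] by (simp add: L2_iff)
  have "integrable (cube_measure LO) (\<lambda>x. (norm (fluct J u j t x))\<^sup>2)" if j: "j \<in> {1..J}" for j
  proof (rule Bochner_Integration.integrable_bound)
    show "integrable (cube_measure LO) (\<lambda>x. real J * fluct_magnitude_sq J u t x)"
      using fluct_integrable(1)[OF t] by simp
    have "fluct J u j t \<in> borel_measurable (cube_measure LO)"
      unfolding fluct_def[abs_def] ens_def
      by (intro borel_measurable_diff borel_measurable_scaleR borel_measurable_const borel_measurable_sum um j)
    then show "(\<lambda>x. (norm (fluct J u j t x))\<^sup>2) \<in> borel_measurable (cube_measure LO)" by measurable
    have "(norm (fluct J u j t x))\<^sup>2 \<le> real J * fluct_magnitude_sq J u t x" for x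
      unfolding fluct_magnitude_sq_def ens_real using pos(5) j
      by (auto intro: member_le_sum)
    then show "AE x in cube_measure LO. norm ((norm (fluct J u j t x))\<^sup>2) \<le> norm (real J * fluct_magnitude_sq J u t x)"
      by (auto intro!: AE_I2 intro: order_trans[OF _ abs_ge_self])
  qed
  then have "fluct_energy t = ens J (\<lambda>j. (L2_norm LO (fluct J u j t))\<^sup>2)"
    unfolding fluct_energy_def fluct_magnitude_sq_def L2_norm_square ens_real by simp
  then show ?thesis by (simp only: ens_mult)
qed

lemma avg_kinetic:
  assumes "T > 0"
  shows "time_avg T (\<lambda>t. ens J (\<lambda>j. 1 / vol * (L2_norm LO (u j t))\<^sup>2))
    = ens J (\<lambda>j. 1 / vol * (1 / T * (\<integral>t. kinetic j t \<partial>time_measure T)))"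
  using time_avg_ens[of J T kinetic "1 / vol"] kinetic_integrable[OF _ assms] unfolding kinetic_def by blast

lemma avg_dissip:
  assumes "T > 0"
  shows "time_avg T (dissipation LO \<nu> \<mu> \<tau> J u Du)
    = ens J (\<lambda>j. 1 / vol * (1 / T * (\<integral>t. dissip j t \<partial>time_measure T)))"
proof -
  have "dissipation LO \<nu> \<mu> \<tau> J u Du = (\<lambda>t. ens J (\<lambda>j. 1 / vol * dissip j t))"
    unfolding dissipation_def[abs_def] dissip_def set_integral_cube vol_def ..
  then show ?thesis using time_avg_ens[of J T dissip "1 / vol"] energy(2)[OF _ assms] by simp
qed

lemma avg_fluct_energy:
  assumes "T > 0"
  shows "time_avg T (\<lambda>t. ens J (\<lambda>j. 1 / vol * (L2_norm LO (fluct J u j t))\<^sup>2))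
    = 1 / vol * (1 / T * (\<integral>t. fluct_energy t \<partial>time_measure T))"
proof -
  have "(\<integral>t. ens J (\<lambda>j. 1 / vol * (L2_norm LO (fluct J u j t))\<^sup>2) \<partial>time_measure T)
      = (\<integral>t. 1 / vol * fluct_energy t \<partial>time_measure T)"
    by (rule Bochner_Integration.integral_cong[OF refl]) (simp only: fluct_norms space_time_measure atLeastAtMost_iff)
  then show ?thesis unfolding time_avg_def set_integral_time by simp
qed

lemma force_scale_square: "(force_scale LO J f)\<^sup>2 = ens J (\<lambda>j. 1 / vol * (L2_norm LO (f j))\<^sup>2)"
  unfolding force_scale_def vol_def[symmetric] using vol_pos by (intro real_sqrt_pow2 ens_nonneg) simp

text \<open>The square of the last denominator in the length scale.\<close>

definition grad_square :: real where
  "grad_square = ens J (\<lambda>j. 1 / vol * (L2_norm LO (grad (f j)))\<^sup>2)"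

lemma grad_square_nonneg: "0 \<le> grad_square"
  unfolding grad_square_def using vol_pos by (intro ens_nonneg) simp

lemma force_scale_0:
  assumes "\<And>j. j \<in> {1..J} \<Longrightarrow> AE x in cube_measure LO. grad (f j) x = 0"
  shows "force_scale LO J f = 0"
proof -
  have "L2_norm LO (f j) = 0" if "j \<in> {1..J}" for j
    by (rule admissible_grad_zero[OF pos(1) f[OF that] assms[OF that]])
  then have "(force_scale LO J f)\<^sup>2 = 0" unfolding force_scale_square ens_real by simp
  then show ?thesis by simp
qed

text \<open>If a denominator in the length scale vanished, division by zero would make the length scale 0.
  But then every force has zero gradient, hence is constant, hence vanishes, having mean zero.\<close>

lemma length_scale_bounds:
  assumes F: "force_scale LO J f > 0"
  shows "length_scale LO J f > 0" "grad_bound \<le> force_scale LO J f / length_scale LO J f"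
    "grad_square \<le> (force_scale LO J f / length_scale LO J f)\<^sup>2" "0 \<le> grad_bound"
proof -
  have N0: "0 \<le> grad_bound" using AE_grad_le(2)[of 1] pos(5) by simp
  have "grad_bound \<noteq> 0"
  proof
    assume 0: "grad_bound = 0"
    have "AE x in cube_measure LO. grad (f j) x = 0" if "j \<in> {1..J}" for j
      using AE_grad_le(1)[OF that] unfolding 0 by eventually_elim simp
    then show False using force_scale_0 F by simp
  qed
  with N0 have N: "grad_bound > 0" by simp
  have "grad_square \<noteq> 0"
  proof
    assume 0: "grad_square = 0"
    have "AE x in cube_measure LO. grad (f j) x = 0" if j: "j \<in> {1..J}" for j
    proof -
      have "(\<Sum>j=1..J. 1 / vol * (L2_norm LO (grad (f j)))\<^sup>2) = 0"
        using 0 pos(5) unfolding grad_square_def ens_real by simp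
      moreover have "0 \<le> 1 / vol * (L2_norm LO (grad (f j)))\<^sup>2" for j using vol_pos by simp
      ultimately have "1 / vol * (L2_norm LO (grad (f j)))\<^sup>2 = 0"
        using j by (subst (asm) sum_nonneg_eq_0_iff) auto
      then have "(\<integral>x. (norm (grad (f j) x))\<^sup>2 \<partial>cube_measure LO) = 0"
        using vol_pos unfolding L2_norm_square by simp
      moreover have "integrable (cube_measure LO) (\<lambda>x. (norm (grad (f j) x))\<^sup>2)"
        using L2_continuous[OF continuous_grad[OF f_smooth[OF j]]] by (simp add: L2_iff)
      ultimately show ?thesis by (subst (asm) integral_nonneg_eq_0_iff_AE) auto
    qed
    then show False using force_scale_0 F by simp
  qed
  with grad_square_nonneg have g: "grad_square > 0" by simp
  define F where "F = force_scale LO J f"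
  define L where "L = length_scale LO J f"
  have L: "L = min LO (min (F / grad_bound) (F / sqrt grad_square))"
    unfolding L_def F_def length_scale_def Let_def grad_bound_def grad_square_def vol_def ..
  have Fp: "F > 0" using F unfolding F_def .
  show L0: "L > 0" unfolding L using pos N g Fp by simp
  have "L \<le> F / grad_bound" "L \<le> F / sqrt grad_square" unfolding L by auto
  then have 1: "grad_bound \<le> F / L" "sqrt grad_square \<le> F / L"
    using N g L0 by (auto simp: field_simps)
  show "grad_bound \<le> F / L" by (rule 1)
  show "grad_square \<le> (F / L)\<^sup>2"
    using power_mono[OF 1(2), of 2] g by simp
  show "0 \<le> grad_bound" by (rule N0)
qed

text \<open>The initial energy appears only divided by \<open>T\<close>, so it disappears in the
  limit.\<close>

lemma averaged_energy:
  assumes T: "T \<ge> 1" and s: "s > 0"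
  shows "time_avg T (dissipation LO \<nu> \<mu> \<tau> J u Du)
    \<le> ens J (\<lambda>j. 1 / vol * ((L2_norm LO (u0 j))\<^sup>2 / 2)) / T + s / 2 * (force_scale LO J f)\<^sup>2
      + time_avg T (\<lambda>t. ens J (\<lambda>j. 1 / vol * (L2_norm LO (u j t))\<^sup>2)) / (2 * s)"
proof -
  have T0: "T > 0" using T by simp
  have "time_avg T (dissipation LO \<nu> \<mu> \<tau> J u Du)
      \<le> ens J (\<lambda>j. 1 / T * (1 / vol * ((L2_norm LO (u0 j))\<^sup>2 / 2)) + (s / 2 * (1 / vol * (L2_norm LO (f j))\<^sup>2)
        + 1 / (2 * s) * (1 / vol * (1 / T * (\<integral>t. kinetic j t \<partial>time_measure T)))))"
    unfolding avg_dissip[OF T0]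
  proof (rule ens_mono)
    fix j assume j: "j \<in> {1..J}"
    have "1 / vol * (1 / T * (\<integral>t. dissip j t \<partial>time_measure T))
        \<le> 1 / vol * (1 / T * ((L2_norm LO (u0 j))\<^sup>2 / 2
          + s / 2 * T * (L2_norm LO (f j))\<^sup>2 + (\<integral>t. kinetic j t \<partial>time_measure T) / (2 * s)))"
      using dissip_le[OF j T0 s] vol_pos T0 by (intro mult_left_mono) auto
    also have "\<dots> = 1 / T * (1 / vol * ((L2_norm LO (u0 j))\<^sup>2 / 2)) + (s / 2 * (1 / vol * (L2_norm LO (f j))\<^sup>2)
        + 1 / (2 * s) * (1 / vol * (1 / T * (\<integral>t. kinetic j t \<partial>time_measure T))))"
      using T0 s vol_pos by (simp add: field_simps)
    finally show "1 / vol * (1 / T * (\<integral>t. dissip j t \<partial>time_measure T)) \<le> \<dots>" .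
  qed
  then show ?thesis
    unfolding ens_add ens_mult[of J "1 / T"] ens_mult[of J "s / 2"] ens_mult[of J "1 / (2 * s)"]
      force_scale_square avg_kinetic[OF T0] by simp
qed

text \<open>\<open>K\<close> depends neither on \<open>T\<close> nor on \<open>l\<close>, so the
  boundary terms, of size \<open>K / sqrt T\<close>, vanish in the limit for each weight.\<close>

lemma averaged_momentum:
  obtains K where "\<And>T l. T \<ge> 1 \<Longrightarrow> l > 0 \<Longrightarrow>
    (force_scale LO J f)\<^sup>2 \<le> K * (1 / T * sqrt T)
      + grad_bound * time_avg T (\<lambda>t. ens J (\<lambda>j. 1 / vol * (L2_norm LO (u j t))\<^sup>2))
      + l / 2 * time_avg T (dissipation LO \<nu> \<mu> \<tau> J u Du)
      + (\<nu> * grad_square + \<mu> * \<tau> * grad_bound\<^sup>2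
          * time_avg T (\<lambda>t. ens J (\<lambda>j. 1 / vol * (L2_norm LO (fluct J u j t))\<^sup>2))) / (2 * l)"
proof -
  obtain C where C: "\<And>j T. j \<in> {1..J} \<Longrightarrow> T \<ge> 1 \<Longrightarrow>
      \<bar>L2_inner LO (u j T) (f j)\<bar> + \<bar>L2_inner LO (u0 j) (f j)\<bar> \<le> C j * sqrt T"
    using force_work_le by metis
  define K where "K = ens J (\<lambda>j. 1 / vol * C j)"
  have "(force_scale LO J f)\<^sup>2 \<le> K * (1 / T * sqrt T)
      + grad_bound * time_avg T (\<lambda>t. ens J (\<lambda>j. 1 / vol * (L2_norm LO (u j t))\<^sup>2))
      + l / 2 * time_avg T (dissipation LO \<nu> \<mu> \<tau> J u Du)
      + (\<nu> * grad_square + \<mu> * \<tau> * grad_bound\<^sup>2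
          * time_avg T (\<lambda>t. ens J (\<lambda>j. 1 / vol * (L2_norm LO (fluct J u j t))\<^sup>2))) / (2 * l)"
    if T: "T \<ge> 1" and l: "l > 0" for T l
  proof -
    have T0: "T > 0" using T by simp
    \<comment> \<open>The fluctuation energy is common to all realizations, so the ensemble average
      leaves this term unchanged.\<close>
    define p where "p = 1 / vol * (1 / T * (\<integral>t. fluct_energy t \<partial>time_measure T))"
    have "(force_scale LO J f)\<^sup>2 \<le> ens J (\<lambda>j. (1 / T * sqrt T) * (1 / vol * C j)
        + (grad_bound * (1 / vol * (1 / T * (\<integral>t. kinetic j t \<partial>time_measure T)))
        + (l / 2 * (1 / vol * (1 / T * (\<integral>t. dissip j t \<partial>time_measure T)))
        + (\<nu> / (2 * l) * (1 / vol * (L2_norm LO (grad (f j)))\<^sup>2) + \<mu> * \<tau> * grad_bound\<^sup>2 * p / (2 * l)))))"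
      unfolding force_scale_square
    proof (rule ens_mono)
      fix j assume j: "j \<in> {1..J}"
      define k d g w where "k = (\<integral>t. kinetic j t \<partial>time_measure T)" and "d = (\<integral>t. dissip j t \<partial>time_measure T)"
        and "g = (L2_norm LO (grad (f j)))\<^sup>2" and "w = (\<integral>t. fluct_energy t \<partial>time_measure T)"
      have "T * (L2_norm LO (f j))\<^sup>2 \<le> C j * sqrt T + grad_bound * k + l / 2 * d
          + (\<nu> * T * g + \<mu> * \<tau> * grad_bound\<^sup>2 * w) / (2 * l)"
        using momentum[OF j T0 l] C[OF j T] unfolding k_def d_def g_def w_def by linarith
      then have "1 / vol * (1 / T * (T * (L2_norm LO (f j))\<^sup>2)) \<le> 1 / vol * (1 / T * (C j * sqrt T + grad_bound * k + l / 2 * d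
          + (\<nu> * T * g + \<mu> * \<tau> * grad_bound\<^sup>2 * w) / (2 * l)))"
        using vol_pos T0 by (intro mult_left_mono) auto
      also have "1 / vol * (1 / T * (T * (L2_norm LO (f j))\<^sup>2)) = 1 / vol * (L2_norm LO (f j))\<^sup>2"
        using T0 by simp
      also have "1 / vol * (1 / T * (C j * sqrt T + grad_bound * k + l / 2 * d
          + (\<nu> * T * g + \<mu> * \<tau> * grad_bound\<^sup>2 * w) / (2 * l)))
          = (1 / T * sqrt T) * (1 / vol * C j) + (grad_bound * (1 / vol * (1 / T * k))
        + (l / 2 * (1 / vol * (1 / T * d)) + (\<nu> / (2 * l) * (1 / vol * g)
        + \<mu> * \<tau> * grad_bound\<^sup>2 * (1 / vol * (1 / T * w)) / (2 * l))))"
        using T0 l vol_pos by (simp add: distrib_left add_divide_distrib mult_ac)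
      finally show "1 / vol * (L2_norm LO (f j))\<^sup>2 \<le> (1 / T * sqrt T) * (1 / vol * C j)
        + (grad_bound * (1 / vol * (1 / T * (\<integral>t. kinetic j t \<partial>time_measure T)))
        + (l / 2 * (1 / vol * (1 / T * (\<integral>t. dissip j t \<partial>time_measure T)))
        + (\<nu> / (2 * l) * (1 / vol * (L2_norm LO (grad (f j)))\<^sup>2) + \<mu> * \<tau> * grad_bound\<^sup>2 * p / (2 * l))))"
        unfolding k_def d_def g_def w_def p_def .
    qed
    also have "\<dots> = (1 / T * sqrt T) * K
        + (grad_bound * time_avg T (\<lambda>t. ens J (\<lambda>j. 1 / vol * (L2_norm LO (u j t))\<^sup>2))
        + (l / 2 * time_avg T (dissipation LO \<nu> \<mu> \<tau> J u Du)
        + (\<nu> / (2 * l) * grad_square + \<mu> * \<tau> * grad_bound\<^sup>2 * p / (2 * l))))"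
      unfolding ens_add ens_mult[of J "1 / T * sqrt T"] ens_mult[of J grad_bound] ens_mult[of J "l / 2"]
        ens_mult[of J "\<nu> / (2 * l)"] ens_const[OF pos(5)]
        avg_kinetic[OF T0] avg_dissip[OF T0] K_def grad_square_def ..
    finally show ?thesis unfolding avg_fluct_energy[OF T0] p_def[symmetric] by (simp add: add_divide_distrib mult.commute)
  qed
  then show ?thesis using that by blast
qed

lemma averaged_bounds:
  obtains C where "\<And>T. T \<ge> 1 \<Longrightarrow> 0 \<le> time_avg T (\<lambda>t. ens J (\<lambda>j. 1 / vol * (L2_norm LO (u j t))\<^sup>2)) \<and>
    time_avg T (\<lambda>t. ens J (\<lambda>j. 1 / vol * (L2_norm LO (u j t))\<^sup>2)) \<le> C"
proof -
  obtain C where C: "\<And>j T. j \<in> {1..J} \<Longrightarrow> T \<ge> 1 \<Longrightarrow> (\<integral>t. kinetic j t \<partial>time_measure T) \<le> C j * T"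
    using kinetic_bounds by metis
  show ?thesis
  proof (rule that[of "ens J (\<lambda>j. 1 / vol * C j)"])
    fix T :: real assume T: "T \<ge> 1"
    then have T0: "T > 0" by simp
    have "0 \<le> (\<integral>t. kinetic j t \<partial>time_measure T)" for j by (intro integral_nonneg_AE AE_I2 kinetic_nonneg)
    then have "0 \<le> ens J (\<lambda>j. 1 / vol * (1 / T * (\<integral>t. kinetic j t \<partial>time_measure T)))"
      using vol_pos T0 by (intro ens_nonneg) simp
    moreover have "ens J (\<lambda>j. 1 / vol * (1 / T * (\<integral>t. kinetic j t \<partial>time_measure T))) \<le> ens J (\<lambda>j. 1 / vol * C j)"
      using C[OF _ T] vol_pos T0 by (intro ens_mono mult_left_mono) (auto simp: divide_le_eq)
    ultimately show "0 \<le> time_avg T (\<lambda>t. ens J (\<lambda>j. 1 / vol * (L2_norm LO (u j t))\<^sup>2)) \<and>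
      time_avg T (\<lambda>t. ens J (\<lambda>j. 1 / vol * (L2_norm LO (u j t))\<^sup>2)) \<le> ens J (\<lambda>j. 1 / vol * C j)"
      unfolding avg_kinetic[OF T0] by blast
  qed
qed

text \<open>The variance bound, integrated; it makes the limit superior behind \<open>U'\<close>
  finite.\<close>

lemma averaged_fluct_bounds:
  assumes T: "T \<ge> 1"
  shows "0 \<le> time_avg T (\<lambda>t. ens J (\<lambda>j. 1 / vol * (L2_norm LO (fluct J u j t))\<^sup>2))"
    "time_avg T (\<lambda>t. ens J (\<lambda>j. 1 / vol * (L2_norm LO (fluct J u j t))\<^sup>2))
      \<le> time_avg T (\<lambda>t. ens J (\<lambda>j. 1 / vol * (L2_norm LO (u j t))\<^sup>2))"
proof -
  have T0: "T > 0" using T by simp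
  have "0 \<le> (\<integral>t. fluct_energy t \<partial>time_measure T)" by (intro integral_nonneg_AE AE_I2 fluct_energy_nonneg)
  then show "0 \<le> time_avg T (\<lambda>t. ens J (\<lambda>j. 1 / vol * (L2_norm LO (fluct J u j t))\<^sup>2))"
    unfolding avg_fluct_energy[OF T0] using vol_pos T0 by simp
  have i: "integrable (time_measure T) (\<lambda>t. ens J (\<lambda>j. kinetic j t))"
    unfolding ens_real by (intro integrable_divide Bochner_Integration.integrable_sum kinetic_integrable[OF _ T0])
  have "(\<integral>t. fluct_energy t \<partial>time_measure T) \<le> (\<integral>t. ens J (\<lambda>j. kinetic j t) \<partial>time_measure T)"
    by (intro integral_mono fluct_energy_integrable[OF T0] i fluct_integrable(2)) simp
  then have "1 / vol * (1 / T * (\<integral>t. fluct_energy t \<partial>time_measure T)) \<le> 1 / vol * (1 / T * (\<integral>t. ens J (\<lambda>j. kinetic j t) \<partial>time_measure T))"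
    using vol_pos T0 by (intro mult_left_mono) auto
  also have "\<dots> = time_avg T (\<lambda>t. ens J (\<lambda>j. 1 / vol * (L2_norm LO (u j t))\<^sup>2))"
    unfolding time_avg_def set_integral_time ens_mult kinetic_def[symmetric] by (simp only: integral_mult_right_zero mult.left_commute)
  finally show "time_avg T (\<lambda>t. ens J (\<lambda>j. 1 / vol * (L2_norm LO (fluct J u j t))\<^sup>2))
      \<le> time_avg T (\<lambda>t. ens J (\<lambda>j. 1 / vol * (L2_norm LO (u j t))\<^sup>2))"
    unfolding avg_fluct_energy[OF T0] .
qed

lemma averaged_dissip_nonneg: "T \<ge> 1 \<Longrightarrow> 0 \<le> time_avg T (dissipation LO \<nu> \<mu> \<tau> J u Du)"
proof -
  assume "T \<ge> 1"
  then have T: "T > 0" by simp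
  have "0 \<le> (\<integral>t. dissip j t \<partial>time_measure T)" for j by (intro integral_nonneg_AE AE_I2 dissip_nonneg)
  then show ?thesis unfolding avg_dissip[OF T] using vol_pos T by (intro ens_nonneg) simp
qed

theorem dissipation_bound:
  fixes F U U' L \<alpha> :: real
  defines "F \<equiv> force_scale LO J f" and "U \<equiv> velocity_scale LO J u"
    and "U' \<equiv> velocity_scale LO J (fluct J u)" and "L \<equiv> length_scale LO J f"
  assumes F: "F > 0" and \<alpha>: "0 < \<alpha>" "\<alpha> < 1"
  shows "limsup_avg (dissipation LO \<nu> \<mu> \<tau> J u Du) \<le>
    ereal ((1 / (1 - \<alpha>) + 1 / (4 * \<alpha> * (1 - \<alpha>)) * inverse (L * U / \<nu>)
      + \<mu> / (4 * \<alpha> * (1 - \<alpha>)) * (\<tau> / (L / U)) * (U' / U)\<^sup>2) * (U ^ 3 / L))"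
proof -
  define A where "A T = time_avg T (\<lambda>t. ens J (\<lambda>j. 1 / vol * (L2_norm LO (u j t))\<^sup>2))" for T
  define P where "P T = time_avg T (\<lambda>t. ens J (\<lambda>j. 1 / vol * (L2_norm LO (fluct J u j t))\<^sup>2))" for T
  define D where "D T = time_avg T (dissipation LO \<nu> \<mu> \<tau> J u Du)" for T
  define c0 where "c0 = ens J (\<lambda>j. 1 / vol * ((L2_norm LO (u0 j))\<^sup>2 / 2))"
  obtain C where C: "\<And>T. T \<ge> 1 \<Longrightarrow> 0 \<le> A T \<and> A T \<le> C"
    using averaged_bounds unfolding A_def by blast
  obtain K where K: "\<And>T l. T \<ge> 1 \<Longrightarrow> l > 0 \<Longrightarrow> F\<^sup>2 \<le> K * (1 / T * sqrt T) + grad_bound * A T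
      + l / 2 * D T + (\<nu> * grad_square + \<mu> * \<tau> * grad_bound\<^sup>2 * P T) / (2 * l)"
    using averaged_momentum unfolding F_def A_def P_def D_def by blast
  note Lb = length_scale_bounds[OF F[unfolded F_def], folded F_def L_def]
  have r1: "((\<lambda>T. c0 / T) \<longlongrightarrow> 0) at_top" by real_asymp
  have r2: "((\<lambda>T. K * (1 / T * sqrt T)) \<longlongrightarrow> 0) at_top" by real_asymp
  have PA: "0 \<le> P T \<and> P T \<le> A T" if "T \<ge> 1" for T
    using averaged_fluct_bounds[OF that] unfolding P_def A_def by blast
  have D0: "0 \<le> D T" if "T \<ge> 1" for T using averaged_dissip_nonneg[OF that] unfolding D_def .
  have D1: "D T \<le> c0 / T + s / 2 * F\<^sup>2 + A T / (2 * s)" if "T \<ge> 1" "s > 0" for T s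
    using averaged_energy[OF that] unfolding D_def c0_def F_def A_def .
  have mt: "0 \<le> \<mu> * \<tau> * grad_bound\<^sup>2" using pos by simp
  obtain a p e where ape: "0 \<le> a" "0 \<le> p" "0 \<le> e"
    "Limsup at_top (\<lambda>T. ereal (A T)) = ereal a"
    "Limsup at_top (\<lambda>T. ereal (P T)) = ereal p"
    "Limsup at_top (\<lambda>T. ereal (D T)) = ereal e"
    and E: "\<And>s. s > 0 \<Longrightarrow> e \<le> s / 2 * F\<^sup>2 + a / (2 * s)"
    and G: "\<And>l. l > 0 \<Longrightarrow> F\<^sup>2 \<le> grad_bound * a + l / 2 * e + (\<nu> * grad_square + \<mu> * \<tau> * grad_bound\<^sup>2 * p) / (2 * l)"
    using limsup_inequalities[OF C PA D0 r1 r2 D1 K Lb(4) mt] by blast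
  \<comment> \<open>Both limits superior are real numbers, so \<open>real_of_ereal\<close> loses
    nothing.\<close>
  have U: "U = sqrt a" "U' = sqrt p"
    unfolding U_def U'_def velocity_scale_def limsup_avg_def vol_def[symmetric]
      A_def[symmetric] P_def[symmetric] ape by simp_all
  then have U2: "U\<^sup>2 = a" "U'\<^sup>2 = p" "U \<ge> 0" using ape by auto
  have "(1 - \<alpha>) * e \<le> U ^ 3 / L + U\<^sup>2 * (\<nu> + \<mu> * \<tau> * U'\<^sup>2) / (4 * \<alpha> * L\<^sup>2)"
    using E G pos ape(2) unfolding U2(2)
    by (intro dissipation_algebra[OF F Lb(1) U2(3) pos(2) _ ape(2) \<alpha> Lb(4,2) grad_square_nonneg Lb(3)])
      (auto simp: U2(1))
  then have "e \<le> (U ^ 3 / L + U\<^sup>2 * (\<nu> + \<mu> * \<tau> * U'\<^sup>2) / (4 * \<alpha> * L\<^sup>2)) / (1 - \<alpha>)"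
    using \<alpha> by (simp add: pos_le_divide_eq mult.commute)
  then show ?thesis
    unfolding limsup_avg_def D_def[symmetric] ape(6) bound_algebra[OF Lb(1) U2(3) pos(2) \<alpha>] by simp
qed

end

theorem theorem3p1:
  fixes LO \<nu> \<mu> \<tau> F U U' L Tstar Iu Rey :: real
    and J :: nat
    and u0 f :: "nat \<Rightarrow> real^3 \<Rightarrow> real^3"
    and u :: "nat \<Rightarrow> real \<Rightarrow> real^3 \<Rightarrow> real^3"
    and Du :: "nat \<Rightarrow> real \<Rightarrow> real^3 \<Rightarrow> real^3^3"
  assumes "LO > 0" and "\<nu> > 0" and "\<mu> > 0" and "\<tau> > 0" and "J \<ge> 1"
    and "\<And>j. j \<in> {1..J} \<Longrightarrow> admissible_data LO (u0 j)"
    and "\<And>j. j \<in> {1..J} \<Longrightarrow> admissible_data LO (f j)"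
    and "weak_solution LO \<nu> \<mu> \<tau> J u0 f u Du"
    and "F = force_scale LO J f"
    and "F > 0"
    and "U = velocity_scale LO J u"
    and "U' = velocity_scale LO J (fluct J u)"
    and "L = length_scale LO J f"
    and "Tstar = L / U"
    and "Iu = (U' / U)\<^sup>2"
    and "Rey = L * U / \<nu>"
  shows "(\<forall>\<alpha>. 0 < \<alpha> \<and> \<alpha> < 1 \<longrightarrow>
            limsup_avg (dissipation LO \<nu> \<mu> \<tau> J u Du) \<le>
              ereal ((1 / (1 - \<alpha>) + 1 / (4 * \<alpha> * (1 - \<alpha>)) * inverse Rey
                       + \<mu> / (4 * \<alpha> * (1 - \<alpha>)) * (\<tau> / Tstar) * Iu) * (U ^ 3 / L)))
       \<and> (\<mu> = 0.55 \<longrightarrow>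
            limsup_avg (dissipation LO \<nu> \<mu> \<tau> J u Du) \<le>
              ereal ((2 + inverse Rey + 0.55 * (\<tau> / Tstar) * Iu) * (U ^ 3 / L)))"
proof -
  interpret ensemble_flow LO \<nu> \<mu> \<tau> J u0 f u Du
    by unfold_locales (use assms in auto)
  have bound: "limsup_avg (dissipation LO \<nu> \<mu> \<tau> J u Du) \<le>
      ereal ((1 / (1 - \<alpha>) + 1 / (4 * \<alpha> * (1 - \<alpha>)) * inverse Rey
        + \<mu> / (4 * \<alpha> * (1 - \<alpha>)) * (\<tau> / Tstar) * Iu) * (U ^ 3 / L))" if "0 < \<alpha>" "\<alpha> < 1" for \<alpha>
    using dissipation_bound[OF _ that] assms(9-16) by simp
  \<comment> \<open>At \<open>1 / 2\<close> the first coefficient is 2 and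
    \<open>4 * \<alpha> * (1 - \<alpha>)\<close> attains its maximum 1.\<close>
  have "limsup_avg (dissipation LO \<nu> \<mu> \<tau> J u Du) \<le>
      ereal ((2 + inverse Rey + 0.55 * (\<tau> / Tstar) * Iu) * (U ^ 3 / L))" if "\<mu> = 0.55"
    using bound[of "1 / 2"] unfolding that by simp
  with bound show ?thesis by blast
qed

end
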